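(* Suppose that the spectral measure is absolutely continuous, $\mu_\rho(dx)=\psi_\rho(x)\,dx$, where the spectral density $\psi_\rho$ is of class $\mathcal{C}^1$ with Hölder continuous derivative on an open set of full Lebesgue measure. Then $$\lim_{n\to+\infty}\frac{\mathbb{E}[\mathcal{N}(f_n,[0,2\pi])]}{n}=\frac{\lambda(\{\psi_\rho=0\})}{\pi\sqrt{2}}+\frac{2\pi-\lambda(\{\psi_\rho=0\})}{\pi\sqrt{3}}.$$
   Context: Let $\mu_\rho$ be a symmetric probability measure on $[-\pi,\pi]$ (the spectral measure), regarded as a measure on the circle $\mathbb{R}/2\pi\mathbb{Z}$, and let $\rho(k)=\int_{-\pi}^{\pi}e^{-ikx}\,\mu_\rho(dx)$, $k\in\mathbb{Z}$. On a probability space $(\Omega,\mathcal{F},\mathbb{P})$ with expectation $\mathbb{E}$, let $(a_k)_{k\ge1}$ and $(b_k)_{k\ge1}$ be two independent centered stationary Gaussian sequences with $\mathbb{E}[a_ka_\ell]=\mathbb{E}[b_kb_\ell]=\rho(|k-\ell|)$ for $k,\ell\ge1$ (so each variable has variance $\rho(0)=1$). For $n\ge1$ set $f_n(x)=\frac{1}{\sqrt n}\sum_{k=1}^n a_k\cos(kx)+b_k\sin(kx)$. For a function $f$ and an interval $[a,b]$, $\mathcal{N}(f,[a,b])=\#\{t\in[a,b]: f(t)=0\}$. $\lambda$ is Lebesgue measure. The density $\psi_\rho$ is regarded as a $2\pi$-periodic function, and $\{\psi_\rho=0\}$ denotes its zero set in one period. *)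

theory Defs
  imports "HOL-Probability.Probability"
begin

text \<open>Degenerate (almost surely constant) variables count as Gaussian.\<close>

definition gaussian_rv :: "'a measure \<Rightarrow> ('a \<Rightarrow> real) \<Rightarrow> bool" where
  "gaussian_rv M X \<longleftrightarrow>
     X \<in> borel_measurable M \<and>
     ((\<exists>m. AE \<omega> in M. X \<omega> = m) \<or>
      (\<exists>m \<sigma>. \<sigma> > 0 \<and> distributed M lborel X (\<lambda>x. ennreal (normal_density m \<sigma> x))))"

text \<open>All sequences of random variables are indexed by the integers \<open>k \<ge> 1\<close>;
  the value at \<open>0\<close> is never used.\<close>

definition sample_path :: "(nat \<Rightarrow> 'a \<Rightarrow> real) \<Rightarrow> 'a \<Rightarrow> nat \<Rightarrow> real" where
  "sample_path X \<omega> = (\<lambda>k\<in>{1..}. X k \<omega>)"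

abbreviation path_space :: "(nat \<Rightarrow> real) measure" where
  "path_space \<equiv> PiM {1..} (\<lambda>_. borel)"

definition gaussian_sequence :: "'a measure \<Rightarrow> (nat \<Rightarrow> 'a \<Rightarrow> real) \<Rightarrow> bool" where
  "gaussian_sequence M X \<longleftrightarrow>
     (\<forall>n c. gaussian_rv M (\<lambda>\<omega>. \<Sum>k=1..n. c k * X k \<omega>))"

definition centered_sequence :: "'a measure \<Rightarrow> (nat \<Rightarrow> 'a \<Rightarrow> real) \<Rightarrow> bool" where
  "centered_sequence M X \<longleftrightarrow>
     (\<forall>k\<ge>1. integrable M (X k) \<and> integral\<^sup>L M (X k) = 0)"

definition stationary_sequence :: "'a measure \<Rightarrow> (nat \<Rightarrow> 'a \<Rightarrow> real) \<Rightarrow> bool" where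
  "stationary_sequence M X \<longleftrightarrow>
     (\<forall>h. distr M path_space (sample_path (\<lambda>k. X (k + h))) = distr M path_space (sample_path X))"

definition symmetric_measure :: "real measure \<Rightarrow> bool" where
  "symmetric_measure \<mu> \<longleftrightarrow> distr \<mu> borel uminus = \<mu>"

text \<open>A spectral measure is a symmetric probability measure on the Borel sets of the real line
  that is carried by \<open>[-\<pi>, \<pi>]\<close>.\<close>

definition spectral_measure :: "real measure \<Rightarrow> bool" where
  "spectral_measure \<mu> \<longleftrightarrow>
     real_distribution \<mu> \<and> (AE x in \<mu>. x \<in> {-pi..pi}) \<and> symmetric_measure \<mu>"

definition correlation :: "real measure \<Rightarrow> int \<Rightarrow> complex" where
  "correlation \<mu> k = (LINT x|\<mu>. exp (- (\<i> * of_int k * complex_of_real x)))"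

text \<open>The complex-valued equation also says that the correlation is real.\<close>

definition has_correlation ::
    "'a measure \<Rightarrow> (nat \<Rightarrow> 'a \<Rightarrow> real) \<Rightarrow> (int \<Rightarrow> complex) \<Rightarrow> bool" where
  "has_correlation M X \<rho> \<longleftrightarrow>
     (\<forall>k\<ge>1. \<forall>l\<ge>1. integrable M (\<lambda>\<omega>. X k \<omega> * X l \<omega>) \<and>
        complex_of_real (LINT \<omega>|M. X k \<omega> * X l \<omega>) = \<rho> \<bar>int k - int l\<bar>)"

text \<open>The density is a nonnegative \<open>2\<pi>\<close>-periodic function on the real line.\<close>

definition spectral_density :: "real measure \<Rightarrow> (real \<Rightarrow> real) \<Rightarrow> bool" where
  "spectral_density \<mu> \<psi> \<longleftrightarrow>
     \<psi> \<in> borel_measurable borel \<and> (\<forall>x. 0 \<le> \<psi> x) \<and> (\<forall>x. \<psi> (x + 2 * pi) = \<psi> x) \<and>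
     \<mu> = density lborel (\<lambda>x. ennreal (indicator {-pi..pi} x * \<psi> x))"

text \<open>Hoelder continuity on an open set is understood locally: exponent and constant may depend
  on the point. This covers in particular functions that are uniformly Hoelder continuous on the
  set, and allows the derivative to blow up at its boundary.\<close>

definition locally_hoelder_on :: "real set \<Rightarrow> (real \<Rightarrow> real) \<Rightarrow> bool" where
  "locally_hoelder_on U g \<longleftrightarrow>
     (\<forall>x\<in>U. \<exists>e>0. \<exists>\<alpha>\<in>{0<..1}. \<exists>C.
        \<forall>y\<in>U \<inter> ball x e. \<forall>z\<in>U \<inter> ball x e. \<bar>g y - g z\<bar> \<le> C * \<bar>y - z\<bar> powr \<alpha>)"

definition C1_hoelder_on :: "real set \<Rightarrow> (real \<Rightarrow> real) \<Rightarrow> bool" where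
  "C1_hoelder_on U f \<longleftrightarrow>
     (\<exists>f'. (\<forall>x\<in>U. (f has_real_derivative f' x) (at x)) \<and> continuous_on U f' \<and>
           locally_hoelder_on U f')"

text \<open>Open subsets of the circle of full Lebesgue measure, represented by their
  \<open>2\<pi>\<close>-periodic lifts to the real line.\<close>

definition open_full_measure :: "real set \<Rightarrow> bool" where
  "open_full_measure U \<longleftrightarrow>
     open U \<and> (\<forall>x. x + 2 * pi \<in> U \<longleftrightarrow> x \<in> U) \<and> (AE x in lborel. x \<in> U)"

definition trig_poly :: "(nat \<Rightarrow> real) \<Rightarrow> (nat \<Rightarrow> real) \<Rightarrow> nat \<Rightarrow> real \<Rightarrow> real" where
  "trig_poly a b n x =
     1 / sqrt (real n) * (\<Sum>k=1..n. a k * cos (real k * x) + b k * sin (real k * x))"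

text \<open>Extended-valued, so that infinitely many zeros count as \<open>\<infinity>\<close> (\<open>card\<close> would give \<open>0\<close>).\<close>

definition num_zeros :: "(real \<Rightarrow> real) \<Rightarrow> real set \<Rightarrow> ennreal" where
  "num_zeros f S = emeasure (count_space UNIV) {t \<in> S. f t = 0}"

end

theory Submission
  imports Defs "HOL-Complex_Analysis.Complex_Analysis" "HOL-Real_Asymp.Real_Asymp"
begin

text \<open>
  Write \<open>A\<close>, \<open>B\<close>, \<open>C\<close> for the variance of \<open>f\<^sub>n(x)\<close>, its covariance with \<open>f\<^sub>n'(x)\<close> and the variance of
  \<open>f\<^sub>n'(x)\<close>. The Kac--Rice formula says that \<open>f\<^sub>n\<close> has on average \<open>\<integral> sqrt (A C - B\<^sup>2) / (\<pi> A)\<close> zeros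
  on an interval, so the theorem is a statement about the limit of this density divided by \<open>n\<close>.

  In spectral form the covariances are integrals of \<open>\<psi>(x - t)\<close> against quadratic expressions in the
  Dirichlet kernel. Centring the frequencies \<open>1, \<dots>, n\<close> at \<open>(n + 1) / 2\<close> makes this kernel the real
  function \<open>s(t) = sin (n t / 2) / sin (t / 2)\<close>, and the density (\<open>intensity\<close> below) becomes
  \<open>1 / \<pi>\<close> times the square root of
  \<open>((n + 1) / 2)\<^sup>2 + \<integral> s'\<^sup>2 \<psi> / \<integral> s\<^sup>2 \<psi> - (\<integral> s s' \<psi> / \<integral> s\<^sup>2 \<psi>)\<^sup>2\<close>.
  Where \<open>\<psi>(x) > 0\<close>, the normalised kernels are approximate identities, the first quotient is
  asymptotic to \<open>n\<^sup>2 / 12\<close> and the second is \<open>o(n)\<close>; this gives \<open>n\<^sup>2 / 3\<close> under the root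
  (\<open>intensity_limit_positive\<close>). Where \<open>\<psi>(x) = 0\<close> and \<open>x \<in> U\<close>, the nonnegative function \<open>\<psi>\<close> has a
  minimum, so \<open>\<psi>'(x) = 0\<close>, and the Hoelder condition makes \<open>\<psi>(x - t) / sin\<^sup>2 (t / 2)\<close> integrable.
  The oscillating factors \<open>sin\<^sup>2 (n t / 2)\<close> and \<open>cos\<^sup>2 (n t / 2)\<close> both average to \<open>1 / 2\<close> by the
  Riemann--Lebesgue lemma, the first quotient is asymptotic to \<open>n\<^sup>2 / 4\<close>, and \<open>n\<^sup>2 / 2\<close> stands under
  the root (\<open>intensity_limit_zero\<close>).

  Passing to the limit under the integral is the delicate point, because nothing is known about
  \<open>\<psi>\<close> near the complement of \<open>U\<close>, so that no dominating function is at hand there. Two bounds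
  replace domination. Near a point of \<open>U\<close> the density is \<open>O(n)\<close> uniformly
  (\<open>intensity_locally_bounded\<close>): the even kernels \<open>s\<^sup>2\<close> and \<open>s'\<^sup>2\<close> annihilate the linear term of \<open>\<psi>\<close>,
  the Hoelder condition controls the rest, and \<open>\<integral> s\<^sup>2 \<psi> \<ge> 1 / 3\<close> for large \<open>n\<close>, again by the
  Riemann--Lebesgue lemma. On an arbitrary interval of length \<open>\<delta>\<close> the mean number of zeros is at most
  \<open>C n \<delta> + o(n)\<close> (\<open>intensity_interval_bound\<close>): \<open>f\<^sub>n\<close> is a complex polynomial of degree \<open>2 n\<close> on the
  unit circle, it grows by a factor of at most \<open>exp (O(n \<delta>))\<close> at distance \<open>O(\<delta>)\<close>, each zero costs a
  factor \<open>2\<close> in the value at the end of the interval, and this value is rarely small. On a fine grid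
  the first bound handles the cells that meet a large compact subset of \<open>U\<close>, the second bound the
  other cells, whose total length is small (\<open>tendsto_nn_integral_by_intervals\<close>).

  The Kac--Rice formula itself (\<open>kac_rice\<close>) is obtained by smoothing: the integral of
  \<open>\<phi>\<^sub>\<epsilon>(f) \<bar>f'\<bar>\<close>, with \<open>\<phi>\<^sub>\<epsilon>\<close> the centred normal density of standard deviation \<open>\<epsilon>\<close>, tends to the number of
  zeros, and its expectation can be computed in closed form.
\<close>

section \<open>The Kac--Rice density of a Gaussian pair\<close>

lemma integral_normal_density_cos:
  assumes "\<tau> > 0"
  shows "integrable lborel (\<lambda>t. normal_density 0 \<tau> t * cos (x * t))"
    and "(\<integral>t. normal_density 0 \<tau> t * cos (x * t) \<partial>lborel) = exp (- (\<tau> * x)\<^sup>2 / 2)"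
proof -
  show "integrable lborel (\<lambda>t. normal_density 0 \<tau> t * cos (x * t))"
    by (rule Bochner_Integration.integrable_bound[OF integrable_normal_density[OF assms, of 0]])
      (auto simp: abs_mult intro!: mult_left_le)
  have std: "(\<integral>t. std_normal_density t * cos (x * t) \<partial>lborel) = exp (- x\<^sup>2 / 2)" for x :: real
  proof -
    have "char std_normal_distribution x = (\<integral>t. std_normal_density t *\<^sub>R iexp (x * t) \<partial>lborel)"
      unfolding char_def by (subst integral_density) (auto simp: normal_density_nonneg)
    then have "complex_of_real (exp (- x\<^sup>2 / 2)) = (\<integral>t. std_normal_density t *\<^sub>R iexp (x * t) \<partial>lborel)"
      by (simp add: char_std_normal_distribution)
    then have "exp (- x\<^sup>2 / 2) = Re (\<integral>t. std_normal_density t *\<^sub>R iexp (x * t) \<partial>lborel)"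
      by (metis Re_complex_of_real)
    also have "\<dots> = (\<integral>t. Re (std_normal_density t *\<^sub>R iexp (x * t)) \<partial>lborel)"
      by (rule integral_Re[symmetric], rule Bochner_Integration.integrable_bound[OF integrable_normal_density[of 1 0]])
        auto
    also have "\<dots> = (\<integral>t. std_normal_density t * cos (x * t) \<partial>lborel)"
      by (simp add: Re_exp)
    finally show ?thesis by simp
  qed
  have "(\<integral>t. normal_density 0 \<tau> t * cos (x * t) \<partial>lborel)
     = \<bar>\<tau>\<bar> *\<^sub>R (\<integral>t. normal_density 0 \<tau> (0 + \<tau> * t) * cos (x * (0 + \<tau> * t)) \<partial>lborel)"
    using assms by (intro lborel_integral_real_affine) auto
  also have "\<dots> = (\<integral>t. std_normal_density t * cos ((x * \<tau>) * t) \<partial>lborel)"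
    using assms
    by (simp flip: integral_mult_right_zero)
      (intro Bochner_Integration.integral_cong,
        auto simp: normal_density_def real_sqrt_mult power_mult_distrib mult_ac)
  also have "\<dots> = exp (- (\<tau> * x)\<^sup>2 / 2)"
    using std[of "x * \<tau>"] by (simp add: mult.commute)
  finally show "(\<integral>t. normal_density 0 \<tau> t * cos (x * t) \<partial>lborel) = exp (- (\<tau> * x)\<^sup>2 / 2)" .
qed

lemma normal_density_fourier:
  assumes "\<epsilon> > 0"
  shows "integrable lborel (\<lambda>t. exp (- (\<epsilon> * t)\<^sup>2 / 2) * cos (x * t))"
    and "normal_density 0 \<epsilon> x = (\<integral>t. exp (- (\<epsilon> * t)\<^sup>2 / 2) * cos (x * t) \<partial>lborel) / (2 * pi)"
proof -
  have eq: "exp (- (\<epsilon> * t)\<^sup>2 / 2) = sqrt (2 * pi) / \<epsilon> * normal_density 0 (1 / \<epsilon>) t" for t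
    using assms by (simp add: normal_density_def real_sqrt_divide real_sqrt_mult power_divide power_mult_distrib mult_ac)
  show "integrable lborel (\<lambda>t. exp (- (\<epsilon> * t)\<^sup>2 / 2) * cos (x * t))"
    unfolding eq using integral_normal_density_cos(1)[of "1/\<epsilon>" x] assms by (simp add: mult.assoc)
  have "(\<integral>t. exp (- (\<epsilon> * t)\<^sup>2 / 2) * cos (x * t) \<partial>lborel) = sqrt (2 * pi) / \<epsilon> * exp (- (1 / \<epsilon> * x)\<^sup>2 / 2)"
    unfolding eq using assms by (simp only: mult.assoc integral_mult_right_zero integral_normal_density_cos zero_less_divide_1_iff)
  moreover have "sqrt (2 * pi) / \<epsilon> * exp (- (1 / \<epsilon> * x)\<^sup>2 / 2) = 2 * pi * normal_density 0 \<epsilon> x"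
  proof -
    have "sqrt (2 * pi) * sqrt (2 * pi) = 2 * pi" by simp
    then have "2 * pi / sqrt (2 * pi) = sqrt (2 * pi)" by (simp add: field_simps)
    then show ?thesis using assms
      by (simp add: normal_density_def real_sqrt_mult power_divide power_mult_distrib field_simps)
  qed
  ultimately show "normal_density 0 \<epsilon> x = (\<integral>t. exp (- (\<epsilon> * t)\<^sup>2 / 2) * cos (x * t) \<partial>lborel) / (2 * pi)"
    by simp
qed

lemma gaussian_integral_quadratic:
  fixes A B C s :: real
  assumes "A > 0"
  shows "integrable lborel (\<lambda>t. exp (- (A * t\<^sup>2 + 2 * B * t * s + C * s\<^sup>2) / 2))"
    and "(\<integral>t. exp (- (A * t\<^sup>2 + 2 * B * t * s + C * s\<^sup>2) / 2) \<partial>lborel)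
       = sqrt (2 * pi / A) * exp (- (C - B\<^sup>2 / A) * s\<^sup>2 / 2)"
proof -
  have eq: "exp (- (A * t\<^sup>2 + 2 * B * t * s + C * s\<^sup>2) / 2)
    = sqrt (2 * pi / A) * exp (- (C - B\<^sup>2 / A) * s\<^sup>2 / 2) * normal_density (- B * s / A) (1 / sqrt A) t" for t
  proof -
    have "- (A * t\<^sup>2 + 2 * B * t * s + C * s\<^sup>2) / 2
        = - (C - B\<^sup>2 / A) * s\<^sup>2 / 2 + (- (t - (- B * s / A))\<^sup>2 / (2 * (1 / sqrt A)\<^sup>2))"
      using assms by (simp add: power_divide) (simp add: field_simps power2_eq_square)
    then have e: "exp (- (A * t\<^sup>2 + 2 * B * t * s + C * s\<^sup>2) / 2)
        = exp (- (C - B\<^sup>2 / A) * s\<^sup>2 / 2) * exp (- (t - (- B * s / A))\<^sup>2 / (2 * (1 / sqrt A)\<^sup>2))"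
      by (simp only: exp_add)
    have c: "sqrt (2 * pi / A) * (1 / sqrt (2 * pi * (1 / sqrt A)\<^sup>2)) = 1"
      using assms by (simp add: power_divide)
    have r: "x * y = r * x * (q * y)" if "r * q = 1" for x y r q :: real
    proof -
      have "r * x * (q * y) = (r * q) * (x * y)" by (simp only: mult_ac)
      then show ?thesis using that by simp
    qed
    show ?thesis
      unfolding normal_density_def e by (rule r[OF c])
  qed
  show "integrable lborel (\<lambda>t. exp (- (A * t\<^sup>2 + 2 * B * t * s + C * s\<^sup>2) / 2))"
    unfolding eq using assms by (intro integrable_mult_right integrable_normal_density) auto
  show "(\<integral>t. exp (- (A * t\<^sup>2 + 2 * B * t * s + C * s\<^sup>2) / 2) \<partial>lborel)
       = sqrt (2 * pi / A) * exp (- (C - B\<^sup>2 / A) * s\<^sup>2 / 2)"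
    unfolding eq using assms by simp
qed

text \<open>The constant in \<open>\<integral> (1 - cos (s y)) / s\<^sup>2 ds = abs_const \<bar>y\<bar>\<close>, which expresses \<open>\<bar>y\<bar>\<close> through
  characteristic functions. It occurs on both sides of the final computation and cancels there,
  because it is positive and finite.\<close>
definition abs_const :: ennreal where
  "abs_const = (\<integral>\<^sup>+s. ennreal ((1 - cos s) / s\<^sup>2) \<partial>lborel)"

lemma abs_const_finite: "abs_const < \<infinity>"
proof -
  have "(1 - cos s) / s\<^sup>2 \<le> 4 * inverse (1 + s\<^sup>2)" for s :: real
  proof (cases "s = 0")
    case False
    have "1 - cos s = 2 * (sin (s / 2))\<^sup>2" using cos_double_sin[of "s/2"] by simp
    moreover have "(sin (s / 2))\<^sup>2 \<le> (s / 2)\<^sup>2"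
      using abs_sin_x_le_abs_x[of "s/2"] by (metis abs_le_square_iff)
    ultimately have 1: "1 - cos s \<le> s\<^sup>2 / 2" by (simp add: power_divide)
    have 2: "s\<^sup>2 * (1 - cos s) \<le> s\<^sup>2 * 2"
      by (intro mult_left_mono) (use cos_ge_minus_one[of s] in linarith, simp)
    have "(1 - cos s) * (1 + s\<^sup>2) \<le> 4 * s\<^sup>2"
      using 1 2 by (simp add: algebra_simps) (smt (verit) zero_le_power2)
    then show ?thesis using False by (simp add: field_simps add_pos_nonneg)
  qed (simp)
  then have "abs_const \<le> (\<integral>\<^sup>+s. ennreal (4 * inverse (1 + s\<^sup>2)) \<partial>lborel)"
    unfolding abs_const_def by (intro nn_integral_mono ennreal_leI)
  also have "\<dots> < \<infinity>"
  proof -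
    have "integrable lborel (\<lambda>s::real. 4 * inverse (1 + s\<^sup>2))"
      using integrable_inverse_1_plus_square by (simp add: set_integrable_def)
    then show ?thesis
      by (subst nn_integral_eq_integral) (auto simp: add_nonneg_nonneg)
  qed
  finally show ?thesis .
qed

lemma abs_const_pos: "abs_const > 0"
proof -
  have "(\<integral>\<^sup>+s. ennreal ((1 - cos 1) / 4) * indicator {1..2::real} s \<partial>lborel) \<le> abs_const"
    unfolding abs_const_def
  proof (intro nn_integral_mono)
    fix s :: real
    show "ennreal ((1 - cos 1) / 4) * indicator {1..2} s \<le> ennreal ((1 - cos s) / s\<^sup>2)"
    proof (cases "s \<in> {1..2}")
      case True
      have "cos s \<le> cos 1" using True pi_gt3 by (intro cos_monotone_0_pi_le) auto
      moreover have "s\<^sup>2 \<le> 4" using True power_mono[of s 2 2] by simp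
      ultimately have "(1 - cos 1) / 4 \<le> (1 - cos s) / s\<^sup>2"
        using True by (intro frac_le) auto
      then show ?thesis using True by (simp add: ennreal_leI)
    qed simp
  qed
  moreover have "(\<integral>\<^sup>+s. ennreal ((1 - cos 1) / 4) * indicator {1..2::real} s \<partial>lborel) = ennreal ((1 - cos 1) / 4)"
    by (simp add: nn_integral_cmult_indicator)
  moreover have "cos (1::real) < 1"
    using cos_monotone_0_pi[of 0 1] pi_gt3 by simp
  ultimately show ?thesis by (metis diff_gt_0_iff_gt ennreal_less_zero_iff less_le_trans zero_less_divide_iff zero_less_numeral)
qed

lemma abs_const_times_abs:
  "(\<integral>\<^sup>+s. ennreal ((1 - cos (s * y)) / s\<^sup>2) \<partial>lborel) = abs_const * ennreal \<bar>y\<bar>"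
proof (cases "y = 0")
  case False
  have "(\<integral>\<^sup>+s. ennreal ((1 - cos (s * y)) / s\<^sup>2) \<partial>lborel)
     = ennreal \<bar>1 / y\<bar> * (\<integral>\<^sup>+s. ennreal ((1 - cos ((0 + (1 / y) * s) * y)) / (0 + (1 / y) * s)\<^sup>2) \<partial>lborel)"
    using False by (intro nn_integral_real_affine) auto
  also have "(\<lambda>s. ennreal ((1 - cos ((0 + (1 / y) * s) * y)) / (0 + (1 / y) * s)\<^sup>2))
      = (\<lambda>s. ennreal (y\<^sup>2) * ennreal ((1 - cos s) / s\<^sup>2))"
    using False by (auto simp: fun_eq_iff power_divide power_mult_distrib simp flip: ennreal_mult')
  also have "ennreal \<bar>1 / y\<bar> * (\<integral>\<^sup>+s. ennreal (y\<^sup>2) * ennreal ((1 - cos s) / s\<^sup>2) \<partial>lborel) = (ennreal \<bar>1 / y\<bar> * ennreal (y\<^sup>2)) * abs_const"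
    by (subst nn_integral_cmult) (auto simp: abs_const_def mult.assoc)
  also have "ennreal \<bar>1 / y\<bar> * ennreal (y\<^sup>2) = ennreal \<bar>y\<bar>"
    using False by (simp flip: ennreal_mult' add: power2_eq_square field_simps)
  finally show ?thesis by (simp add: mult.commute)
qed simp

text \<open>Integrating the representation of \<open>\<bar>y\<bar>\<close> against the normal density of variance \<open>v\<close> evaluates
  the \<open>s\<close>-integral by the known first absolute moment \<open>sqrt (2 v / \<pi>)\<close>.\<close>
lemma abs_const_times_sqrt:
  assumes "v \<ge> 0"
  shows "(\<integral>\<^sup>+s. ennreal ((1 - exp (- v * s\<^sup>2 / 2)) / s\<^sup>2) \<partial>lborel) = abs_const * ennreal (sqrt (2 / pi) * sqrt v)"
proof (cases "v = 0")
  case False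
  define \<sigma> where "\<sigma> = sqrt v"
  have \<sigma>: "\<sigma> > 0" "\<sigma>\<^sup>2 = v" using assms False by (auto simp: \<sigma>_def)
  have "abs_const * ennreal (sqrt (2 / pi) * \<sigma>) = abs_const * (\<integral>\<^sup>+y. ennreal (normal_density 0 \<sigma> y * \<bar>y\<bar>) \<partial>lborel)"
  proof -
    have "has_bochner_integral lborel (\<lambda>x. normal_density 0 \<sigma> x * \<bar>x - 0\<bar> ^ (2 * 0 + 1))
      (2 ^ 0 * \<sigma> ^ (2 * 0 + 1) * fact 0 * sqrt (2 / pi))"
      using normal_moment_abs_odd[of \<sigma> 0 0] \<sigma> by simp
    then have "has_bochner_integral lborel (\<lambda>x. normal_density 0 \<sigma> x * \<bar>x\<bar>) (sqrt (2 / pi) * \<sigma>)"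
      by (simp add: mult.commute)
    then have "(\<integral>\<^sup>+y. ennreal (normal_density 0 \<sigma> y * \<bar>y\<bar>) \<partial>lborel) = ennreal (sqrt (2 / pi) * \<sigma>)"
      by (subst nn_integral_eq_integral) (auto simp: has_bochner_integral_iff)
    then show ?thesis by simp
  qed
  also have "\<dots> = (\<integral>\<^sup>+y. ennreal (normal_density 0 \<sigma> y) * (\<integral>\<^sup>+s. ennreal ((1 - cos (s * y)) / s\<^sup>2) \<partial>lborel) \<partial>lborel)"
    unfolding abs_const_times_abs
    by (subst nn_integral_cmult[symmetric]) (auto simp: ennreal_mult' mult_ac)
  also have "\<dots> = (\<integral>\<^sup>+y. (\<integral>\<^sup>+s. ennreal (normal_density 0 \<sigma> y * ((1 - cos (s * y)) / s\<^sup>2)) \<partial>lborel) \<partial>lborel)"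
    by (subst nn_integral_cmult[symmetric]) (simp_all only: ennreal_mult'[OF normal_density_nonneg], simp)
  also have "\<dots> = (\<integral>\<^sup>+s. (\<integral>\<^sup>+y. ennreal (normal_density 0 \<sigma> y * ((1 - cos (s * y)) / s\<^sup>2)) \<partial>lborel) \<partial>lborel)"
    by (rule lborel_pair.Fubini') measurable
  also have "\<dots> = (\<integral>\<^sup>+s. ennreal ((1 - exp (- v * s\<^sup>2 / 2)) / s\<^sup>2) \<partial>lborel)"
  proof (intro nn_integral_cong)
    fix s :: real
    have "has_bochner_integral lborel (\<lambda>y. (normal_density 0 \<sigma> y - normal_density 0 \<sigma> y * cos (s * y)) / s\<^sup>2)
      ((1 - exp (- (\<sigma> * s)\<^sup>2 / 2)) / s\<^sup>2)"
      by (intro has_bochner_integral_divide_zero has_bochner_integral_diff)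
        (auto simp: has_bochner_integral_iff \<sigma> integral_normal_density_cos)
    then have "has_bochner_integral lborel (\<lambda>y. normal_density 0 \<sigma> y * ((1 - cos (s * y)) / s\<^sup>2))
      ((1 - exp (- v * s\<^sup>2 / 2)) / s\<^sup>2)"
      using \<sigma> by (simp add: algebra_simps diff_divide_distrib power_mult_distrib)
    then show "(\<integral>\<^sup>+y. ennreal (normal_density 0 \<sigma> y * ((1 - cos (s * y)) / s\<^sup>2)) \<partial>lborel) = ennreal ((1 - exp (- v * s\<^sup>2 / 2)) / s\<^sup>2)"
      by (subst nn_integral_eq_integral) (auto simp: has_bochner_integral_iff)
  qed
  finally show ?thesis by (simp add: \<sigma>_def)
qed simp

text \<open>A possibly degenerate centred Gaussian vector with covariance matrix \<open>((A, B), (B, C))\<close>, given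
  through its characteristic function, the form in which Fourier inversion takes it.\<close>
locale gaussian_pair = prob_space +
  fixes X Y :: "'a \<Rightarrow> real" and A B C :: real
  assumes meas[measurable]: "X \<in> borel_measurable M" "Y \<in> borel_measurable M"
    and char_pair: "\<And>t s. expectation (\<lambda>\<omega>. cos (t * X \<omega> + s * Y \<omega>)) = exp (- (A * t\<^sup>2 + 2 * B * t * s + C * s\<^sup>2) / 2)"
begin

lemma quadratic_form_nonneg: "A * t\<^sup>2 + 2 * B * t * s + C * s\<^sup>2 \<ge> 0"
proof -
  have "expectation (\<lambda>\<omega>. cos (t * X \<omega> + s * Y \<omega>)) \<le> expectation (\<lambda>\<omega>. 1)"
    by (intro integral_mono integrable_const_bound[where B=1]) auto
  then show ?thesis by (simp add: char_pair prob_space)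
qed

lemma A_nonneg: "A \<ge> 0"
  using quadratic_form_nonneg[of 1 0] by simp

text \<open>The value of the quadratic form at \<open>(B / A', -1)\<close>.\<close>
lemma schur_nonneg:
  assumes "A' > 0" "A \<le> A'"
  shows "C - B\<^sup>2 / A' \<ge> 0"
proof -
  have "0 \<le> A * (B / A')\<^sup>2 + 2 * B * (B / A') * (- 1) + C * (- 1)\<^sup>2"
    by (rule quadratic_form_nonneg)
  also have "A * (B / A')\<^sup>2 \<le> A' * (B / A')\<^sup>2" using assms by (intro mult_right_mono) auto
  finally show ?thesis using assms by (simp add: power2_eq_square field_simps)
qed

text \<open>By Fourier inversion of the Gaussian window. Smoothing at scale \<open>\<epsilon>\<close> acts as if an independent
  normal variable of variance \<open>\<epsilon>\<^sup>2\<close> had been added to \<open>X\<close>: it replaces \<open>A\<close> by \<open>A + \<epsilon>\<^sup>2\<close>.\<close>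
lemma expectation_normal_density_cos:
  assumes "\<epsilon> > 0"
  defines "A' \<equiv> A + \<epsilon>\<^sup>2"
  shows "expectation (\<lambda>\<omega>. normal_density 0 \<epsilon> (X \<omega>) * cos (s * Y \<omega>))
     = exp (- (C - B\<^sup>2 / A') * s\<^sup>2 / 2) / sqrt (2 * pi * A')"
proof -
  have A': "A' > 0" using assms A_nonneg by (simp add: add_nonneg_pos)
  interpret pair_sigma_finite M lborel ..
  define g where "g = (\<lambda>\<omega> t. exp (- (\<epsilon> * t)\<^sup>2 / 2) * cos (X \<omega> * t) * cos (s * Y \<omega>))"
  have [measurable]: "case_prod g \<in> borel_measurable (M \<Otimes>\<^sub>M lborel)"
    unfolding g_def by measurable
  have g_bound: "\<bar>g \<omega> t\<bar> \<le> exp (- (\<epsilon> * t)\<^sup>2 / 2)" for \<omega> t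
    unfolding g_def abs_mult mult.assoc by (simp add: mult_left_le mult_le_one)
  have int_exp: "integrable lborel (\<lambda>t. exp (- (\<epsilon> * t)\<^sup>2 / 2))"
    using normal_density_fourier(1)[OF assms(1), of 0] by simp
  have int: "integrable (M \<Otimes>\<^sub>M lborel) (\<lambda>(\<omega>, t). g \<omega> t)"
  proof (rule Fubini_integrable)
    show "integrable M (\<lambda>\<omega>. LINT t|lborel. norm (case (\<omega>, t) of (\<omega>, t) \<Rightarrow> g \<omega> t))"
    proof (rule integrable_const_bound)
      show "AE \<omega> in M. norm (LINT t|lborel. norm (case (\<omega>, t) of (\<omega>, t) \<Rightarrow> g \<omega> t)) \<le> (LINT t|lborel. exp (- (\<epsilon> * t)\<^sup>2 / 2))"
        using int_exp g_bound by (intro AE_I2) (auto intro!: integral_mono_AE' AE_I2)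
    qed measurable
    show "AE \<omega> in M. integrable lborel (\<lambda>t. case (\<omega>, t) of (\<omega>, t) \<Rightarrow> g \<omega> t)"
      using g_bound by (intro AE_I2) (auto intro!: Bochner_Integration.integrable_bound[OF int_exp] AE_I2)
  qed measurable
  have "expectation (\<lambda>\<omega>. normal_density 0 \<epsilon> (X \<omega>) * cos (s * Y \<omega>)) = expectation (\<lambda>\<omega>. (\<integral>t. g \<omega> t \<partial>lborel) / (2 * pi))"
    unfolding normal_density_fourier(2)[OF assms(1)] g_def by simp
  also have "\<dots> = expectation (\<lambda>\<omega>. (\<integral>t. g \<omega> t \<partial>lborel)) / (2 * pi)"
    by simp
  also have "expectation (\<lambda>\<omega>. (\<integral>t. g \<omega> t \<partial>lborel)) = (\<integral>t. expectation (\<lambda>\<omega>. g \<omega> t) \<partial>lborel)"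
    by (rule Fubini_integral[OF int, symmetric])
  also have "(\<lambda>t. expectation (\<lambda>\<omega>. g \<omega> t)) = (\<lambda>t. (exp (- (A' * t\<^sup>2 + 2 * B * t * s + C * s\<^sup>2) / 2) + exp (- (A' * t\<^sup>2 + 2 * B * t * (-s) + C * (-s)\<^sup>2) / 2)) / 2)"
  proof
    fix t
    have "g \<omega> t = exp (- (\<epsilon> * t)\<^sup>2 / 2) / 2 * (cos (t * X \<omega> + s * Y \<omega>) + cos (t * X \<omega> + (- s) * Y \<omega>))" for \<omega>
      by (simp add: g_def cos_add cos_diff field_simps)
    then have "expectation (\<lambda>\<omega>. g \<omega> t) = exp (- (\<epsilon> * t)\<^sup>2 / 2) / 2 *
       (expectation (\<lambda>\<omega>. cos (t * X \<omega> + s * Y \<omega>)) + expectation (\<lambda>\<omega>. cos (t * X \<omega> + (- s) * Y \<omega>)))"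
      by (simp only: integral_mult_right_zero, subst Bochner_Integration.integral_add)
        (auto intro!: integrable_const_bound[where B=1])
    also have "\<dots> = (exp (- (\<epsilon> * t)\<^sup>2 / 2 + (- (A * t\<^sup>2 + 2 * B * t * s + C * s\<^sup>2) / 2))
       + exp (- (\<epsilon> * t)\<^sup>2 / 2 + (- (A * t\<^sup>2 + 2 * B * t * (-s) + C * (-s)\<^sup>2) / 2))) / 2"
      unfolding char_pair exp_add by (simp add: field_simps)
    finally show "expectation (\<lambda>\<omega>. g \<omega> t) = (exp (- (A' * t\<^sup>2 + 2 * B * t * s + C * s\<^sup>2) / 2) + exp (- (A' * t\<^sup>2 + 2 * B * t * (-s) + C * (-s)\<^sup>2) / 2)) / 2"
      by (simp add: A'_def power_mult_distrib algebra_simps diff_divide_distrib add_divide_distrib)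
  qed
  also have "(\<integral>t. \<dots> t \<partial>lborel) = sqrt (2 * pi / A') * exp (- (C - B\<^sup>2 / A') * s\<^sup>2 / 2)"
    using gaussian_integral_quadratic[OF A', of B s C] gaussian_integral_quadratic[OF A', of B "-s" C]
    by (subst integral_divide_zero, subst Bochner_Integration.integral_add) auto
  also have "sqrt (2 * pi / A') * exp (- (C - B\<^sup>2 / A') * s\<^sup>2 / 2) / (2 * pi) = exp (- (C - B\<^sup>2 / A') * s\<^sup>2 / 2) / sqrt (2 * pi * A')"
  proof -
    have "sqrt (2 * pi) * sqrt (2 * pi) = 2 * pi" by simp
    then have "sqrt (2 * pi / A') / (2 * pi) = 1 / sqrt (2 * pi * A')"
      using A' by (simp add: real_sqrt_divide real_sqrt_mult field_simps)
    then show ?thesis by (metis (no_types, opaque_lifting) mult.commute mult.left_neutral times_divide_eq_left)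
  qed
  finally show ?thesis .
qed

text \<open>The smoothed Kac--Rice density. The factor \<open>\<bar>Y\<bar>\<close> is written as an integral of \<open>1 - cos (s Y)\<close>,
  which reduces the claim to the preceding lemma at \<open>0\<close> and at \<open>s\<close>.\<close>
lemma expectation_normal_density_abs:
  assumes "\<epsilon> > 0"
  defines "A' \<equiv> A + \<epsilon>\<^sup>2"
  shows "(\<integral>\<^sup>+\<omega>. ennreal (normal_density 0 \<epsilon> (X \<omega>) * \<bar>Y \<omega>\<bar>) \<partial>M) = ennreal (sqrt ((C - B\<^sup>2 / A') / A') / pi)"
proof -
  interpret pair_sigma_finite lborel M ..
  have A': "A' > 0" using assms A_nonneg by (simp add: add_nonneg_pos)
  have v: "C - B\<^sup>2 / A' \<ge> 0" using A' assms by (intro schur_nonneg) auto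
  have nd_le: "normal_density 0 \<epsilon> x \<le> normal_density 0 \<epsilon> 0" for x
    unfolding normal_density_def by (intro mult_left_mono) auto
  have "abs_const * (\<integral>\<^sup>+\<omega>. ennreal (normal_density 0 \<epsilon> (X \<omega>) * \<bar>Y \<omega>\<bar>) \<partial>M)
     = (\<integral>\<^sup>+\<omega>. ennreal (normal_density 0 \<epsilon> (X \<omega>)) * (\<integral>\<^sup>+s. ennreal ((1 - cos (s * Y \<omega>)) / s\<^sup>2) \<partial>lborel) \<partial>M)"
    unfolding abs_const_times_abs
    by (subst nn_integral_cmult[symmetric]) (auto simp: ennreal_mult' mult_ac)
  also have "\<dots> = (\<integral>\<^sup>+\<omega>. (\<integral>\<^sup>+s. ennreal (normal_density 0 \<epsilon> (X \<omega>) * ((1 - cos (s * Y \<omega>)) / s\<^sup>2)) \<partial>lborel) \<partial>M)"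
    by (subst nn_integral_cmult[symmetric]) (simp_all only: ennreal_mult'[OF normal_density_nonneg], simp)
  also have "\<dots> = (\<integral>\<^sup>+s. (\<integral>\<^sup>+\<omega>. ennreal (normal_density 0 \<epsilon> (X \<omega>) * ((1 - cos (s * Y \<omega>)) / s\<^sup>2)) \<partial>M) \<partial>lborel)"
    by (rule Fubini') measurable
  also have "\<dots> = (\<integral>\<^sup>+s. ennreal (1 / sqrt (2 * pi * A')) * ennreal ((1 - exp (- (C - B\<^sup>2 / A') * s\<^sup>2 / 2)) / s\<^sup>2) \<partial>lborel)"
  proof (intro nn_integral_cong)
    fix s :: real
    have int: "integrable M (\<lambda>\<omega>. normal_density 0 \<epsilon> (X \<omega>) * cos (s * Y \<omega>))" for s
      by (rule integrable_const_bound[where B="normal_density 0 \<epsilon> 0"])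
        (auto simp: abs_mult intro!: AE_I2 order_trans[OF mult_left_le nd_le])
    have "has_bochner_integral M (\<lambda>\<omega>. (normal_density 0 \<epsilon> (X \<omega>) * cos (0 * Y \<omega>) - normal_density 0 \<epsilon> (X \<omega>) * cos (s * Y \<omega>)) / s\<^sup>2)
      ((exp (- (C - B\<^sup>2 / A') * 0\<^sup>2 / 2) / sqrt (2 * pi * A') - exp (- (C - B\<^sup>2 / A') * s\<^sup>2 / 2) / sqrt (2 * pi * A')) / s\<^sup>2)"
      unfolding A'_def
      by (intro has_bochner_integral_divide_zero has_bochner_integral_diff)
        (simp_all only: has_bochner_integral_iff int expectation_normal_density_cos[OF assms(1)])
    then have "has_bochner_integral M (\<lambda>\<omega>. normal_density 0 \<epsilon> (X \<omega>) * ((1 - cos (s * Y \<omega>)) / s\<^sup>2))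
      (1 / sqrt (2 * pi * A') * ((1 - exp (- (C - B\<^sup>2 / A') * s\<^sup>2 / 2)) / s\<^sup>2))"
      by (simp add: right_diff_distrib diff_divide_distrib mult.commute)
    then show "(\<integral>\<^sup>+\<omega>. ennreal (normal_density 0 \<epsilon> (X \<omega>) * ((1 - cos (s * Y \<omega>)) / s\<^sup>2)) \<partial>M)
       = ennreal (1 / sqrt (2 * pi * A')) * ennreal ((1 - exp (- (C - B\<^sup>2 / A') * s\<^sup>2 / 2)) / s\<^sup>2)"
      using A' v by (subst nn_integral_eq_integral)
        (auto simp: has_bochner_integral_iff simp flip: ennreal_mult' intro!: mult_nonneg_nonneg)
  qed
  also have "\<dots> = ennreal (1 / sqrt (2 * pi * A')) * (abs_const * ennreal (sqrt (2 / pi) * sqrt (C - B\<^sup>2 / A')))"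
    by (simp only: abs_const_times_sqrt[OF v, symmetric], subst nn_integral_cmult) auto
  also have "\<dots> = abs_const * ennreal (1 / sqrt (2 * pi * A') * (sqrt (2 / pi) * sqrt (C - B\<^sup>2 / A')))"
    using A' v by (subst ennreal_mult) (auto simp: mult_ac)
  also have "1 / sqrt (2 * pi * A') * (sqrt (2 / pi) * sqrt (C - B\<^sup>2 / A')) = sqrt ((C - B\<^sup>2 / A') / A') / pi"
    using A' by (simp add: real_sqrt_divide real_sqrt_mult)
  finally show ?thesis
    using abs_const_finite abs_const_pos by (subst (asm) ennreal_mult_cancel_left) auto
qed

text \<open>On \<open>[-\<eta>, \<eta>]\<close> the window \<open>\<phi>\<^sub>\<eta>\<close> is at least a constant over \<open>\<eta>\<close>, so the small ball probability is
  controlled by the expectation of \<open>\<phi>\<^sub>\<eta>(X)\<close>.\<close>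
lemma prob_abs_le:
  assumes "A > 0" "\<eta> > 0"
  shows "prob {\<omega> \<in> space M. \<bar>X \<omega>\<bar> \<le> \<eta>} \<le> 2 * \<eta> / sqrt A"
proof -
  have "normal_density 0 \<eta> x \<ge> exp (- 1 / 2) / (sqrt (2 * pi) * \<eta>)" if "\<bar>x\<bar> \<le> \<eta>" for x
  proof -
    have "x\<^sup>2 \<le> \<eta>\<^sup>2" using that abs_le_square_iff[of x \<eta>] assms by simp
    then have "x\<^sup>2 / (2 * \<eta>\<^sup>2) \<le> 1 / 2" using assms by (simp add: field_simps)
    then show ?thesis using assms
      by (auto simp: normal_density_def real_sqrt_mult divide_simps)
  qed
  then have *: "indicator {\<omega> \<in> space M. \<bar>X \<omega>\<bar> \<le> \<eta>} \<omega> \<le> (sqrt (2 * pi) * \<eta> * exp (1 / 2)) * normal_density 0 \<eta> (X \<omega>)" for \<omega>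
    using assms by (auto simp: indicator_def field_simps exp_minus)
  have nd_le: "normal_density 0 \<eta> x \<le> normal_density 0 \<eta> 0" for x
    unfolding normal_density_def by (intro mult_left_mono) auto
  have "prob {\<omega> \<in> space M. \<bar>X \<omega>\<bar> \<le> \<eta>} = expectation (indicator {\<omega> \<in> space M. \<bar>X \<omega>\<bar> \<le> \<eta>})"
    by simp
  also have "\<dots> \<le> expectation (\<lambda>\<omega>. (sqrt (2 * pi) * \<eta> * exp (1 / 2)) * normal_density 0 \<eta> (X \<omega>))"
    by (intro integral_mono integrable_mult_right * integrable_real_indicator integrable_const_bound[where B="normal_density 0 \<eta> 0"])
      (auto simp: nd_le less_top[symmetric])
  also have "\<dots> = (sqrt (2 * pi) * \<eta> * exp (1 / 2)) * (1 / sqrt (2 * pi * (A + \<eta>\<^sup>2)))"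
    using expectation_normal_density_cos[OF assms(2), of 0] by simp
  also have "\<dots> = \<eta> * exp (1 / 2) / sqrt (A + \<eta>\<^sup>2)"
    using assms by (simp add: real_sqrt_mult)
  also have "\<dots> \<le> \<eta> * 2 / sqrt A"
  proof -
    have "exp (1/2::real) ^ 2 \<le> 2 ^ 2" using exp_le by (simp flip: exp_double)
    then have "exp (1/2::real) \<le> 2" by (rule power2_le_imp_le) simp
    then show ?thesis using assms by (intro frac_le mult_left_mono mult_nonneg_nonneg) auto
  qed
  finally show ?thesis by (simp add: mult.commute)
qed

lemma AE_nonzero:
  assumes "A > 0"
  shows "AE \<omega> in M. X \<omega> \<noteq> 0"
proof -
  have "prob {\<omega> \<in> space M. X \<omega> = 0} \<le> 0"
  proof (rule field_le_epsilon)
    fix e :: real assume "e > 0"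
    define \<eta> where "\<eta> = e * sqrt A / 2"
    have "\<eta> > 0" using assms \<open>e > 0\<close> by (simp add: \<eta>_def)
    have "prob {\<omega> \<in> space M. X \<omega> = 0} \<le> prob {\<omega> \<in> space M. \<bar>X \<omega>\<bar> \<le> \<eta>}"
      using \<open>\<eta> > 0\<close> by (intro finite_measure_mono) auto
    also have "\<dots> \<le> 2 * \<eta> / sqrt A" by (rule prob_abs_le) fact+
    also have "\<dots> = e" using assms by (simp add: \<eta>_def)
    finally show "prob {\<omega> \<in> space M. X \<omega> = 0} \<le> 0 + e" by simp
  qed
  then have "prob {\<omega> \<in> space M. X \<omega> = 0} = 0" by (simp add: measure_le_0_iff)
  then show ?thesis by (subst AE_iff_measurable[OF _ refl]) (auto simp: emeasure_eq_measure)
qed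

end

section \<open>Kac counting formula with a Gaussian window\<close>

text \<open>As the standard deviation \<open>\<epsilon>\<close> of the centred normal law tends to \<open>0\<close>, an interval that ends
  at \<open>0\<close> keeps half of the mass; this makes every zero count exactly once.\<close>
definition normal_mass :: "real \<Rightarrow> real set \<Rightarrow> ennreal" where
  "normal_mass \<epsilon> S = (\<integral>\<^sup>+x. ennreal (normal_density 0 \<epsilon> x) * indicator S x \<partial>lborel)"

lemma normal_mass_UNIV: "\<epsilon> > 0 \<Longrightarrow> normal_mass \<epsilon> UNIV = 1"
  unfolding normal_mass_def by (simp add: nn_integral_eq_integral)

lemma normal_mass_le_1: "\<epsilon> > 0 \<Longrightarrow> normal_mass \<epsilon> S \<le> 1"
  unfolding normal_mass_UNIV[symmetric] unfolding normal_mass_def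
  by (intro nn_integral_mono mult_left_mono) (auto simp: indicator_def)

lemma normal_mass_uminus: "normal_mass \<epsilon> {u..v} = normal_mass \<epsilon> {- v..- u}"
proof -
  have "normal_mass \<epsilon> {u..v} = ennreal \<bar>- 1\<bar> * (\<integral>\<^sup>+x. ennreal (normal_density 0 \<epsilon> (0 + (- 1) * x)) * indicator {u..v} (0 + (- 1) * x) \<partial>lborel)"
    unfolding normal_mass_def by (rule nn_integral_real_affine) auto
  also have "\<dots> = normal_mass \<epsilon> {- v..- u}"
    unfolding normal_mass_def by (auto intro!: nn_integral_cong simp: normal_density_def indicator_def)
  finally show ?thesis .
qed

lemma normal_mass_tail:
  assumes "\<epsilon> > 0" "\<delta> > 0" "\<And>x. x \<in> S \<Longrightarrow> \<delta> \<le> \<bar>x\<bar>"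
  shows "normal_mass \<epsilon> S \<le> ennreal (\<epsilon>\<^sup>2 / \<delta>\<^sup>2)"
proof -
  have "has_bochner_integral lborel (\<lambda>x. normal_density 0 \<epsilon> x * (x - 0) ^ (2 * 1)) (fact (2 * 1) / ((2 / \<epsilon>\<^sup>2) ^ 1 * fact 1))"
    by (rule normal_moment_even) fact
  then have 2: "has_bochner_integral lborel (\<lambda>x. normal_density 0 \<epsilon> x * x\<^sup>2 / \<delta>\<^sup>2) (\<epsilon>\<^sup>2 / \<delta>\<^sup>2)"
    by (intro has_bochner_integral_divide_zero) (simp add: eval_nat_numeral)
  have "normal_mass \<epsilon> S \<le> (\<integral>\<^sup>+x. ennreal (normal_density 0 \<epsilon> x * x\<^sup>2 / \<delta>\<^sup>2) \<partial>lborel)"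
    unfolding normal_mass_def
  proof (intro nn_integral_mono)
    fix x
    show "ennreal (normal_density 0 \<epsilon> x) * indicator S x \<le> ennreal (normal_density 0 \<epsilon> x * x\<^sup>2 / \<delta>\<^sup>2)"
    proof (cases "x \<in> S")
      case True
      then have "1 \<le> x\<^sup>2 / \<delta>\<^sup>2"
        using assms(3)[OF True] assms(2) power_mono[of \<delta> "\<bar>x\<bar>" 2] by simp
      then have "normal_density 0 \<epsilon> x * 1 \<le> normal_density 0 \<epsilon> x * (x\<^sup>2 / \<delta>\<^sup>2)"
        by (intro mult_left_mono) auto
      then show ?thesis using True
        by (simp add: ennreal_leI)
    qed simp
  qed
  also have "\<dots> = ennreal (\<epsilon>\<^sup>2 / \<delta>\<^sup>2)"
    using 2 by (subst nn_integral_eq_integral) (auto simp: has_bochner_integral_iff)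
  finally show ?thesis .
qed

lemma normal_mass_tail_limit:
  assumes e: "\<And>j. e j > 0" "e \<longlonglongrightarrow> 0" and "\<delta> > 0" "\<And>x. x \<in> S \<Longrightarrow> \<delta> \<le> \<bar>x\<bar>"
  shows "(\<lambda>j. normal_mass (e j) S) \<longlonglongrightarrow> 0"
proof (rule tendsto_sandwich[OF _ _ tendsto_const])
  show "\<forall>\<^sub>F j in sequentially. normal_mass (e j) S \<le> ennreal ((e j)\<^sup>2 / \<delta>\<^sup>2)"
    using normal_mass_tail[OF e(1) assms(3,4)] by simp
  have "(\<lambda>j. (e j)\<^sup>2 / \<delta>\<^sup>2) \<longlonglongrightarrow> 0\<^sup>2 / \<delta>\<^sup>2"
    by (intro tendsto_intros e) (use assms in simp)
  then show "(\<lambda>j. ennreal ((e j)\<^sup>2 / \<delta>\<^sup>2)) \<longlonglongrightarrow> 0"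
    using tendsto_ennrealI[of "\<lambda>j. (e j)\<^sup>2 / \<delta>\<^sup>2" 0] by simp
qed simp

lemma normal_mass_half: 
  assumes "\<epsilon> > 0"
  shows "normal_mass \<epsilon> {0..} = ennreal (1 / 2)"
proof -
  have AE: "AE x::real in lborel. x \<noteq> 0" by (rule AE_lborel_singleton)
  have "normal_mass \<epsilon> {..0} = ennreal \<bar>- 1\<bar> * (\<integral>\<^sup>+x. ennreal (normal_density 0 \<epsilon> (0 + (- 1) * x)) * indicator {..0} (0 + (- 1) * x) \<partial>lborel)"
    unfolding normal_mass_def by (intro nn_integral_real_affine) auto
  also have "\<dots> = normal_mass \<epsilon> {0..}"
    unfolding normal_mass_def by (auto intro!: nn_integral_cong simp: normal_density_def indicator_def)
  finally have sym: "normal_mass \<epsilon> {..0} = normal_mass \<epsilon> {0..}" .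
  have "1 = normal_mass \<epsilon> {..0} + normal_mass \<epsilon> {0..}"
    unfolding normal_mass_UNIV[OF assms, symmetric] unfolding normal_mass_def
    by (subst nn_integral_add[symmetric], simp, simp, intro nn_integral_cong_AE eventually_mono[OF AE])
      (auto simp: indicator_def)
  then have *: "1 = normal_mass \<epsilon> {0..} + normal_mass \<epsilon> {0..}" unfolding sym .
  obtain r where r: "r \<ge> 0" "normal_mass \<epsilon> {0..} = ennreal r"
    using normal_mass_le_1[OF assms, of "{0..}"] by (cases "normal_mass \<epsilon> {0..}") (auto simp: top_unique)
  have "ennreal 1 = ennreal (r + r)"     unfolding ennreal_plus[OF r(1) r(1)] r(2)[symmetric] ennreal_1 by (rule *)
  then have "1 = r + r" using r by (simp only: ennreal_inj add_nonneg_nonneg zero_le_one)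
  then have r2: "r = 1 / 2" by linarith
  show ?thesis unfolding r(2) r2 by (rule refl)
qed

lemma normal_mass_half_limit:
  assumes e: "\<And>j. e j > 0" "e \<longlonglongrightarrow> 0" and "v > 0"
  shows "(\<lambda>j. normal_mass (e j) {0..v}) \<longlonglongrightarrow> ennreal (1 / 2)"
proof -
  have split: "ennreal (1 / 2) - normal_mass (e j) {v<..} = normal_mass (e j) {0..v}" for j
  proof -
    have "ennreal (1 / 2) = normal_mass (e j) {0..v} + normal_mass (e j) {v<..}"
      unfolding normal_mass_half[OF e(1), symmetric, of j] unfolding normal_mass_def
      by (subst nn_integral_add[symmetric], simp, simp, intro nn_integral_cong) (use assms(3) in \<open>auto simp: indicator_def\<close>)
    moreover have "normal_mass (e j) {v<..} \<noteq> \<top>"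
      using normal_mass_le_1[OF e(1), of j "{v<..}"] by (auto simp: top_unique)
    ultimately show ?thesis by simp
  qed
  have "(\<lambda>j. ennreal (1 / 2) - normal_mass (e j) {v<..}) \<longlonglongrightarrow> ennreal (1 / 2) - 0"
    by (intro tendsto_diff_ennreal tendsto_const normal_mass_tail_limit[OF e assms(3)]) auto
  then show ?thesis unfolding split by simp
qed

lemma normal_mass_interval_limit:
  assumes e: "\<And>j. e j > 0" "e \<longlonglongrightarrow> 0" and uv: "u < v" "\<not> (u < 0 \<and> 0 < v)"
  shows "(\<lambda>j. normal_mass (e j) {u..v}) \<longlonglongrightarrow> ennreal (of_bool (u = 0) / 2 + of_bool (v = 0) / 2)"
proof -
  consider "u = 0" | "v = 0" | "u > 0" | "v < 0" using uv by linarith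
  then show ?thesis
  proof cases
    case 1 then show ?thesis using normal_mass_half_limit[OF e, of v] uv by simp
  next
    case 2 then show ?thesis using normal_mass_half_limit[OF e, of "-u"] uv unfolding normal_mass_uminus[of _ u v] by simp
  next
    case 3 then show ?thesis using normal_mass_tail_limit[OF e, of u "{u..v}"] uv by simp
  next
    case 4
    then have "\<delta> \<le> \<bar>x\<bar>" if "x \<in> {u..v}" "\<delta> = - v" for x \<delta> using that by auto
    then show ?thesis using normal_mass_tail_limit[OF e, of "-v" "{u..v}"] uv 4 by simp
  qed
qed

definition kac_integral :: "(real \<Rightarrow> real) \<Rightarrow> (real \<Rightarrow> real) \<Rightarrow> real \<Rightarrow> real \<Rightarrow> real \<Rightarrow> ennreal" where
  "kac_integral f f' p q \<epsilon> = (\<integral>\<^sup>+x. ennreal (normal_density 0 \<epsilon> (f x) * \<bar>f' x\<bar>) * indicator {p..q} x \<partial>lborel)"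

context
  fixes f f' :: "real \<Rightarrow> real"
  assumes deriv: "\<And>x. (f has_real_derivative f' x) (at x)"
    and cont: "continuous_on UNIV f'"
begin

lemma differentiable_measurable: "f \<in> borel_measurable borel" "f' \<in> borel_measurable borel"
  using deriv cont by (auto intro!: borel_measurable_continuous_onI continuous_at_imp_continuous_on DERIV_isCont)

lemma kac_integral_increasing:
  assumes "p < q" "\<And>x. x \<in> {p..q} \<Longrightarrow> f' x \<ge> 0"
  shows "kac_integral f f' p q \<epsilon> = normal_mass \<epsilon> {f p..f q}"
proof -
  note [measurable] = differentiable_measurable
  have "normal_mass \<epsilon> {f p..f q} = (\<integral>\<^sup>+x. ennreal (normal_density 0 \<epsilon> x * indicator {f p..f q} x) \<partial>lborel)"
    unfolding normal_mass_def by (intro nn_integral_cong) (auto simp: indicator_def)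
  also have "\<dots> = (\<integral>\<^sup>+x. ennreal (normal_density 0 \<epsilon> (f x) * f' x * indicator {p..q} x) \<partial>lborel)"
    using assms by (intro nn_integral_substitution deriv continuous_on_subset[OF cont])
      (auto simp: set_borel_measurable_def)
  also have "\<dots> = kac_integral f f' p q \<epsilon>"
    unfolding kac_integral_def using assms(2) by (intro nn_integral_cong) (auto simp: indicator_def)
  finally show ?thesis by simp
qed

lemma kac_integral_split:
  assumes "p \<le> t" "t \<le> q"
  shows "kac_integral f f' p q \<epsilon> = kac_integral f f' p t \<epsilon> + kac_integral f f' t q \<epsilon>"
proof -
  note [measurable] = differentiable_measurable
  show ?thesis
    unfolding kac_integral_def
    by (subst nn_integral_add[symmetric], simp, simp, intro nn_integral_cong_AE eventually_mono[OF AE_lborel_singleton[of t]])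
      (use assms in \<open>auto simp: indicator_def\<close>)
qed

end

lemma kac_integral_uminus: "kac_integral (\<lambda>x. - f x) (\<lambda>x. - f' x) p q \<epsilon> = kac_integral f f' p q \<epsilon>"
  unfolding kac_integral_def by (simp add: normal_density_def)

text \<open>Substitution turns the Kac integral over a monotone piece into the normal mass of the range of
  \<open>f\<close>. If \<open>f\<close> vanishes at most at the ends, the range lies on one side of \<open>0\<close>, and each end that is a
  zero contributes \<open>1 / 2\<close> in the limit.\<close>
lemma kac_piece_increasing:
  fixes f f' :: "real \<Rightarrow> real"
  assumes deriv: "\<And>x. (f has_real_derivative f' x) (at x)" and cont: "continuous_on UNIV f'"
    and "p < q" and pos: "\<And>x. x \<in> {p<..<q} \<Longrightarrow> f x \<noteq> 0 \<and> f' x > 0"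
    and e: "\<And>j. e j > 0" "e \<longlonglongrightarrow> 0"
  shows "(\<lambda>j. kac_integral f f' p q (e j)) \<longlonglongrightarrow> ennreal (of_bool (f p = 0) / 2 + of_bool (f q = 0) / 2)"
    and "kac_integral f f' p q (e j) \<le> 1"
proof -
  have nn: "f' x \<ge> 0" if "x \<in> {p..q}" for x
  proof -
    have "x \<in> closure {p<..<q}" using that \<open>p < q\<close> by simp
    moreover have "closed {x. f' x \<ge> 0}" using cont by (intro closed_Collect_le) auto
    moreover have "{p<..<q} \<subseteq> {x. f' x \<ge> 0}" using pos by (auto intro: less_imp_le)
    ultimately show ?thesis using closure_minimal[of "{p<..<q}" "{x. f' x \<ge> 0}"] by auto
  qed
  have K: "kac_integral f f' p q \<epsilon> = normal_mass \<epsilon> {f p..f q}" for \<epsilon>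
    by (rule kac_integral_increasing[OF deriv cont \<open>p < q\<close>]) (use nn in auto)
  show "kac_integral f f' p q (e j) \<le> 1" unfolding K by (rule normal_mass_le_1[OF e(1)])
  have cf: "continuous_on S f" for S
    using deriv by (auto intro!: continuous_at_imp_continuous_on DERIV_isCont)
  have lt: "f p < f q"
    using \<open>p < q\<close> pos deriv by (intro DERIV_pos_imp_increasing_open[of p q f]) (auto intro: cf)
  have "\<not> (f p < 0 \<and> 0 < f q)"
  proof
    assume *: "f p < 0 \<and> 0 < f q"
    then obtain x where "p \<le> x" "x \<le> q" "f x = 0"
      using IVT'[of f p 0 q] cf \<open>p < q\<close> by auto
    then show False using * pos[of x] by (cases "x = p"; cases "x = q") auto
  qed
  from normal_mass_interval_limit[OF e lt this]
  show "(\<lambda>j. kac_integral f f' p q (e j)) \<longlonglongrightarrow> ennreal (of_bool (f p = 0) / 2 + of_bool (f q = 0) / 2)"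
    unfolding K .
qed

lemma kac_piece:
  fixes f f' :: "real \<Rightarrow> real"
  assumes deriv: "\<And>x. (f has_real_derivative f' x) (at x)" and cont: "continuous_on UNIV f'"
    and "p < q" and nz: "\<And>x. x \<in> {p<..<q} \<Longrightarrow> f x \<noteq> 0 \<and> f' x \<noteq> 0"
    and e: "\<And>j. e j > 0" "e \<longlonglongrightarrow> 0"
  shows "(\<lambda>j. kac_integral f f' p q (e j)) \<longlonglongrightarrow> ennreal (of_bool (f p = 0) / 2 + of_bool (f q = 0) / 2)"
    and "kac_integral f f' p q (e j) \<le> 1"
proof -
  have cf: "continuous_on S f'" for S by (rule continuous_on_subset[OF cont]) simp
  have "(\<forall>x\<in>{p<..<q}. f' x > 0) \<or> (\<forall>x\<in>{p<..<q}. f' x < 0)"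
  proof (rule ccontr)
    assume "\<not> ?thesis"
    then obtain x y where xy: "x \<in> {p<..<q}" "y \<in> {p<..<q}" "\<not> f' x > 0" "\<not> f' y < 0"
      by blast
    have "connected (f' ` {p<..<q})" by (intro connected_continuous_image cf) auto
    then have "0 \<in> f' ` {p<..<q}"
      using xy by (intro connectedD_interval[of "f' ` {p<..<q}" "f' x" "f' y" 0] imageI) auto
    then show False using nz by auto
  qed
  then have "(\<lambda>j. kac_integral f f' p q (e j)) \<longlonglongrightarrow> ennreal (of_bool (f p = 0) / 2 + of_bool (f q = 0) / 2)
     \<and> kac_integral f f' p q (e j) \<le> 1"
  proof
    assume "\<forall>x\<in>{p<..<q}. f' x > 0"
    then have "f x \<noteq> 0 \<and> f' x > 0" if "x \<in> {p<..<q}" for x using nz that by auto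
    from kac_piece_increasing[OF deriv cont \<open>p < q\<close> this e]
    show ?thesis by simp
  next
    assume neg: "\<forall>x\<in>{p<..<q}. f' x < 0"
    have d: "((\<lambda>x. - f x) has_real_derivative - f' x) (at x)" for x
      by (intro derivative_intros deriv)
    have c: "continuous_on UNIV (\<lambda>x. - f' x)" by (intro continuous_intros cont)
    have "- f x \<noteq> 0 \<and> - f' x > 0" if "x \<in> {p<..<q}" for x using neg nz that by auto
    from kac_piece_increasing[OF d c \<open>p < q\<close> this e]
    show ?thesis by (simp add: kac_integral_uminus)
  qed
  then show "(\<lambda>j. kac_integral f f' p q (e j)) \<longlonglongrightarrow> ennreal (of_bool (f p = 0) / 2 + of_bool (f q = 0) / 2)"
     and "kac_integral f f' p q (e j) \<le> 1" by auto
qed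

text \<open>Cutting at all zeros of \<open>f\<close> and \<open>f'\<close> leaves monotone pieces without inner zeros. An inner zero
  collects \<open>1 / 2\<close> from each of its two neighbouring pieces, whether \<open>f\<close> crosses the axis there or
  only touches it. Each piece has mass at most \<open>1\<close>, which gives the bound uniform in \<open>\<epsilon>\<close>.\<close>
lemma kac_counting_aux:
  fixes f f' :: "real \<Rightarrow> real"
  assumes deriv: "\<And>x. (f has_real_derivative f' x) (at x)" and cont: "continuous_on UNIV f'"
    and "p < q" and fin: "finite {x \<in> {p<..<q}. f x = 0 \<or> f' x = 0}"
    and e: "\<And>j. e j > 0" "e \<longlonglongrightarrow> 0"
  shows "(\<lambda>j. kac_integral f f' p q (e j)) \<longlonglongrightarrow>
      ennreal (of_bool (f p = 0) / 2 + of_bool (f q = 0) / 2 + real (card {x \<in> {p<..<q}. f x = 0}))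
   \<and> (\<forall>j. kac_integral f f' p q (e j) \<le> of_nat (card {x \<in> {p<..<q}. f x = 0 \<or> f' x = 0} + 1))"
  using \<open>p < q\<close> fin
proof (induction "card {x \<in> {p<..<q}. f x = 0 \<or> f' x = 0}" arbitrary: p q rule: less_induct)
  case (less p q)
  let ?Z = "\<lambda>p q. {x \<in> {p<..<q}. f x = 0 \<or> f' x = 0}" and ?N = "\<lambda>p q. {x \<in> {p<..<q}. f x = 0}"
  show ?case
  proof (cases "?Z p q = {}")
    case True
    then have nz: "\<And>x. x \<in> {p<..<q} \<Longrightarrow> f x \<noteq> 0 \<and> f' x \<noteq> 0" by blast
    then have N: "?N p q = {}" by blast
    show ?thesis
      using kac_piece[OF deriv cont less.prems(1) nz e] unfolding N True by simp
  next
    case False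
    then obtain t where t: "t \<in> ?Z p q" by blast
    then have pt: "p < t" "t < q" by auto
    have ZN: "?Z p q = insert t (?Z p t \<union> ?Z t q)" using t pt by (auto dest: not_less_iff_gr_or_eq[THEN iffD1])
    have fin: "finite (?Z p t)" "finite (?Z t q)" using less.prems(2) unfolding ZN by auto
    have "card (?Z p q) = Suc (card (?Z p t \<union> ?Z t q))"
      unfolding ZN using fin by (subst card_insert_disjoint) auto
    also have "card (?Z p t \<union> ?Z t q) = card (?Z p t) + card (?Z t q)"
      using fin by (intro card_Un_disjoint) auto
    finally have cZ: "card (?Z p q) = Suc (card (?Z p t) + card (?Z t q))" .
    have finN: "finite (?N p t)" "finite (?N t q)"
      by (rule finite_subset[OF _ fin(1)], auto) (rule finite_subset[OF _ fin(2)], auto)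
    have NN: "?N p q = (if f t = 0 then {t} else {}) \<union> (?N p t \<union> ?N t q)"
      using pt by (auto dest: not_less_iff_gr_or_eq[THEN iffD1] split: if_splits)
    have "card (?N p q) = card (if f t = 0 then {t} else {}) + card (?N p t \<union> ?N t q)"
      unfolding NN using finN by (intro card_Un_disjoint) auto
    also have "card (?N p t \<union> ?N t q) = card (?N p t) + card (?N t q)"
      using finN by (intro card_Un_disjoint) auto
    finally have cN: "card (?N p q) = of_bool (f t = 0) + (card (?N p t) + card (?N t q))"
      by (auto split: if_splits)
    have I1: "(\<lambda>j. kac_integral f f' p t (e j)) \<longlonglongrightarrow>
      ennreal (of_bool (f p = 0) / 2 + of_bool (f t = 0) / 2 + real (card (?N p t)))
        \<and> (\<forall>j. kac_integral f f' p t (e j) \<le> of_nat (card (?Z p t) + 1))"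
      using cZ pt fin by (intro less.hyps) auto
    have I2: "(\<lambda>j. kac_integral f f' t q (e j)) \<longlonglongrightarrow>
      ennreal (of_bool (f t = 0) / 2 + of_bool (f q = 0) / 2 + real (card (?N t q)))
        \<and> (\<forall>j. kac_integral f f' t q (e j) \<le> of_nat (card (?Z t q) + 1))"
      using cZ pt fin by (intro less.hyps) auto
    have sp: "kac_integral f f' p q (e j) = kac_integral f f' p t (e j) + kac_integral f f' t q (e j)" for j
      using pt by (intro kac_integral_split deriv cont) auto
    show ?thesis
    proof (intro conjI allI)
      have "(\<lambda>j. kac_integral f f' p q (e j)) \<longlonglongrightarrow>
         ennreal (of_bool (f p = 0) / 2 + of_bool (f t = 0) / 2 + real (card (?N p t)))
       + ennreal (of_bool (f t = 0) / 2 + of_bool (f q = 0) / 2 + real (card (?N t q)))"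
        unfolding sp using I1 I2 by (intro tendsto_add) auto
      also have "ennreal (of_bool (f p = 0) / 2 + of_bool (f t = 0) / 2 + real (card (?N p t)))
       + ennreal (of_bool (f t = 0) / 2 + of_bool (f q = 0) / 2 + real (card (?N t q)))
       = ennreal (of_bool (f p = 0) / 2 + of_bool (f q = 0) / 2 + real (card (?N p q)))"
        unfolding cN by (subst ennreal_plus[symmetric]) (auto simp: of_bool_def)
      finally show "(\<lambda>j. kac_integral f f' p q (e j)) \<longlonglongrightarrow>
        ennreal (of_bool (f p = 0) / 2 + of_bool (f q = 0) / 2 + real (card (?N p q)))" .
      fix j
      have "kac_integral f f' p q (e j) \<le> of_nat (card (?Z p t) + 1) + of_nat (card (?Z t q) + 1)"
        unfolding sp using I1 I2 by (intro add_mono) auto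
      also have "\<dots> = of_nat (card (?Z p q) + 1)" unfolding cZ by (simp add: algebra_simps)
      finally show "kac_integral f f' p q (e j) \<le> of_nat (card (?Z p q) + 1)" .
    qed
  qed
qed

lemma kac_counting:
  fixes f f' :: "real \<Rightarrow> real"
  assumes deriv: "\<And>x. (f has_real_derivative f' x) (at x)" and cont: "continuous_on UNIV f'"
    and "p < q" and fin: "finite {x \<in> {p..q}. f x = 0 \<or> f' x = 0}"
    and ends: "f p \<noteq> 0" "f q \<noteq> 0"
    and e: "\<And>j. e j > 0" "e \<longlonglongrightarrow> 0"
  shows "(\<lambda>j. kac_integral f f' p q (e j)) \<longlonglongrightarrow> num_zeros f {p..q}"
    and "kac_integral f f' p q (e j) \<le> of_nat (card {x \<in> {p..q}. f x = 0 \<or> f' x = 0} + 1)"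
proof -
  have fin': "finite {x \<in> {p<..<q}. f x = 0 \<or> f' x = 0}"
    by (rule finite_subset[OF _ fin]) auto
  note K = kac_counting_aux[OF deriv cont \<open>p < q\<close> fin' e]
  have "{x \<in> {p..q}. f x = 0} = {x \<in> {p<..<q}. f x = 0}" using ends by (auto simp: less_le)
  moreover have "finite {x \<in> {p<..<q}. f x = 0}" by (rule finite_subset[OF _ fin']) auto
  ultimately have "num_zeros f {p..q} = ennreal (real (card {x \<in> {p<..<q}. f x = 0}))"
    unfolding num_zeros_def by (simp add: emeasure_count_space_finite ennreal_of_nat_eq_real_of_nat)
  then show "(\<lambda>j. kac_integral f f' p q (e j)) \<longlonglongrightarrow> num_zeros f {p..q}"
    using K ends by simp
  have "kac_integral f f' p q (e j) \<le> of_nat (card {x \<in> {p<..<q}. f x = 0 \<or> f' x = 0} + 1)" using K by blast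
  also have "\<dots> \<le> of_nat (card {x \<in> {p..q}. f x = 0 \<or> f' x = 0} + 1)"
    by (intro of_nat_mono add_mono card_mono fin) auto
  finally show "kac_integral f f' p q (e j) \<le> of_nat (card {x \<in> {p..q}. f x = 0 \<or> f' x = 0} + 1)" .
qed

section \<open>Zeros of trigonometric sums and complex polynomials\<close>

definition trig_sum :: "(nat \<Rightarrow> real) \<Rightarrow> (nat \<Rightarrow> real) \<Rightarrow> nat \<Rightarrow> real \<Rightarrow> real" where
  "trig_sum \<alpha> \<beta> n x = (\<Sum>k=1..n. \<alpha> k * cos (real k * x) + \<beta> k * sin (real k * x))"

lemma cis_inj_period:
  assumes "cis x = cis y" "0 \<le> x" "x < 2 * pi" "0 \<le> y" "y < 2 * pi"
  shows "x = y"
proof -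
  have "Arg2pi (cis t) = t" if "0 \<le> t" "t < 2 * pi" for t
    using that by (intro Arg2pi_unique[of 1]) (auto simp: cis_conv_exp)
  then show ?thesis using assms by metis
qed

text \<open>The polynomial \<open>P\<close> of degree at most \<open>2 n\<close> with \<open>P(e\<^sup>i\<^sup>x) = e\<^sup>i\<^sup>n\<^sup>x T(x)\<close> for the trigonometric
  sum \<open>T\<close>.\<close>
definition complexified :: "(nat \<Rightarrow> real) \<Rightarrow> (nat \<Rightarrow> real) \<Rightarrow> nat \<Rightarrow> complex poly" where
  "complexified \<alpha> \<beta> n = (\<Sum>k=1..n. monom (Complex (\<alpha> k) (- \<beta> k) / 2) (n + k) + monom (Complex (\<alpha> k) (\<beta> k) / 2) (n - k))"

lemma poly_complexified:
  "poly (complexified \<alpha> \<beta> n) (cis x) = cis (real n * x) * complex_of_real (trig_sum \<alpha> \<beta> n x)"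
proof -
  have "poly (complexified \<alpha> \<beta> n) (cis x)
      = (\<Sum>k=1..n. Complex (\<alpha> k) (- \<beta> k) / 2 * cis x ^ (n + k) + Complex (\<alpha> k) (\<beta> k) / 2 * cis x ^ (n - k))"
    unfolding complexified_def by (simp add: poly_sum poly_monom)
  also have "\<dots> = (\<Sum>k=1..n. cis (real n * x) * complex_of_real (\<alpha> k * cos (real k * x) + \<beta> k * sin (real k * x)))"
  proof (rule sum.cong[OF refl])
    fix k assume "k \<in> {1..n}"
    then have k: "k \<le> n" by simp
    have "cis x ^ (n + k) = cis (real n * x) * cis (real k * x)"
      by (simp only: power_add Complex.DeMoivre)
    moreover have "cis x ^ (n - k) = cis (real n * x) * cis (- (real k * x))"
      using k by (simp add: Complex.DeMoivre cis_mult) (simp add: of_nat_diff algebra_simps)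
    ultimately have "Complex (\<alpha> k) (- \<beta> k) / 2 * cis x ^ (n + k) + Complex (\<alpha> k) (\<beta> k) / 2 * cis x ^ (n - k)
       = cis (real n * x) * (Complex (\<alpha> k) (- \<beta> k) / 2 * cis (real k * x) + Complex (\<alpha> k) (\<beta> k) / 2 * cis (- (real k * x)))"
      by (simp add: algebra_simps)
    also have "Complex (\<alpha> k) (- \<beta> k) / 2 * cis (real k * x) + Complex (\<alpha> k) (\<beta> k) / 2 * cis (- (real k * x))
      = complex_of_real (\<alpha> k * cos (real k * x) + \<beta> k * sin (real k * x))"
      by (simp add: complex_eq_iff field_simps)
    finally show "Complex (\<alpha> k) (- \<beta> k) / 2 * cis x ^ (n + k) + Complex (\<alpha> k) (\<beta> k) / 2 * cis x ^ (n - k)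
      = cis (real n * x) * complex_of_real (\<alpha> k * cos (real k * x) + \<beta> k * sin (real k * x))" .
  qed
  also have "\<dots> = cis (real n * x) * complex_of_real (trig_sum \<alpha> \<beta> n x)"
    by (simp add: trig_sum_def sum_distrib_left)
  finally show ?thesis .
qed

lemma norm_poly_complexified: "norm (poly (complexified \<alpha> \<beta> n) (cis x)) = \<bar>trig_sum \<alpha> \<beta> n x\<bar>"
  by (simp add: poly_complexified norm_mult)

lemma complexified_root: "poly (complexified \<alpha> \<beta> n) (cis x) = 0 \<longleftrightarrow> trig_sum \<alpha> \<beta> n x = 0"
  by (simp add: poly_complexified)

lemma degree_complexified: "degree (complexified \<alpha> \<beta> n) \<le> 2 * n"
  unfolding complexified_def
  by (intro degree_sum_le degree_add_le order_trans[OF degree_monom_le]) auto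

lemma coeff_complexified:
  assumes "k \<in> {1..n}"
  shows "coeff (complexified \<alpha> \<beta> n) (n + k) = Complex (\<alpha> k) (- \<beta> k) / 2"
proof -
  have "coeff (complexified \<alpha> \<beta> n) (n + k) = (\<Sum>l=1..n. if l = k then Complex (\<alpha> l) (- \<beta> l) / 2 else 0)"
    unfolding complexified_def coeff_sum coeff_add coeff_monom
    by (intro sum.cong) (use assms in auto)
  then show ?thesis using assms by simp
qed

lemma complexified_nonzero:
  assumes "k \<in> {1..n}" "\<alpha> k \<noteq> 0 \<or> \<beta> k \<noteq> 0"
  shows "complexified \<alpha> \<beta> n \<noteq> 0"
proof
  assume "complexified \<alpha> \<beta> n = 0"
  then show False using coeff_complexified[OF assms(1), of \<alpha> \<beta>] assms(2)
    by (auto simp: Complex_eq_0)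
qed

lemma card_zeros_trig_sum_le:
  assumes "k \<in> {1..n}" "\<alpha> k \<noteq> 0 \<or> \<beta> k \<noteq> 0"
  shows "finite {x \<in> {0..2 * pi}. trig_sum \<alpha> \<beta> n x = 0}"
    and "card {x \<in> {0..2 * pi}. trig_sum \<alpha> \<beta> n x = 0} \<le> 2 * n + 1"
proof -
  let ?P = "complexified \<alpha> \<beta> n" and ?Z = "{x \<in> {0..<2 * pi}. trig_sum \<alpha> \<beta> n x = 0}"
  have P: "?P \<noteq> 0" using assms by (rule complexified_nonzero)
  have inj: "inj_on cis ?Z"
  proof (rule inj_onI)
    fix x y assume "x \<in> ?Z" "y \<in> ?Z" and eq: "cis x = cis y"
    then show "x = y"
      by (auto dest: cis_inj_period)
  qed
  have sub: "cis ` ?Z \<subseteq> {z. poly ?P z = 0}" by (auto simp: complexified_root)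
  have fin: "finite {z. poly ?P z = 0}" by (rule poly_roots_finite[OF P])
  have finZ: "finite ?Z" using finite_imageD[OF finite_subset[OF sub fin] inj] .
  have "card ?Z = card (cis ` ?Z)" using inj by (simp add: card_image)
  also have "\<dots> \<le> card {z. poly ?P z = 0}" by (rule card_mono[OF fin sub])
  also have "\<dots> \<le> degree ?P" by (rule card_poly_roots_bound[OF P])
  also have "\<dots> \<le> 2 * n" by (rule degree_complexified)
  finally have card: "card ?Z \<le> 2 * n" .
  have sub': "{x \<in> {0..2 * pi}. trig_sum \<alpha> \<beta> n x = 0} \<subseteq> insert (2 * pi) ?Z" by auto
  show "finite {x \<in> {0..2 * pi}. trig_sum \<alpha> \<beta> n x = 0}" using finite_subset[OF sub'] finZ by simp
  have "card {x \<in> {0..2 * pi}. trig_sum \<alpha> \<beta> n x = 0} \<le> card (insert (2 * pi) ?Z)"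
    using finZ by (intro card_mono sub') simp
  also have "\<dots> \<le> 2 * n + 1" using card finZ by (simp add: card_insert_if)
  finally show "card {x \<in> {0..2 * pi}. trig_sum \<alpha> \<beta> n x = 0} \<le> 2 * n + 1" .
qed

lemma norm_poly_complexified_le:
  assumes "norm z \<le> R" "1 \<le> R"
  shows "norm (poly (complexified \<alpha> \<beta> n) z) \<le> (\<Sum>k=1..n. \<bar>\<alpha> k\<bar> + \<bar>\<beta> k\<bar>) * R ^ (2 * n)"
proof -
  have c: "norm (Complex u v / 2) \<le> (\<bar>u\<bar> + \<bar>v\<bar>) / 2" for u v
    using norm_triangle_ineq[of "complex_of_real u" "\<i> * v"]
    by (simp add: norm_divide norm_mult Complex_eq)
  have "poly (complexified \<alpha> \<beta> n) z = (\<Sum>k=1..n. Complex (\<alpha> k) (- \<beta> k) / 2 * z ^ (n + k) + Complex (\<alpha> k) (\<beta> k) / 2 * z ^ (n - k))"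
    unfolding complexified_def by (simp add: poly_sum poly_monom)
  also have "norm \<dots> \<le> (\<Sum>k=1..n. (\<bar>\<alpha> k\<bar> + \<bar>\<beta> k\<bar>) * R ^ (2 * n))"
  proof (rule sum_norm_le)
    fix k assume k: "k \<in> {1..n}"
    have zp: "norm z ^ m \<le> R ^ (2 * n)" if "m \<le> 2 * n" for m
      using that assms by (intro order_trans[OF power_mono[of _ R] power_increasing]) auto
    have "norm (Complex (\<alpha> k) (- \<beta> k) / 2 * z ^ (n + k) + Complex (\<alpha> k) (\<beta> k) / 2 * z ^ (n - k))
      \<le> (\<bar>\<alpha> k\<bar> + \<bar>- \<beta> k\<bar>) / 2 * R ^ (2 * n) + (\<bar>\<alpha> k\<bar> + \<bar>\<beta> k\<bar>) / 2 * R ^ (2 * n)"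
      using k unfolding norm_mult norm_power
      by (intro order_trans[OF norm_triangle_ineq] add_mono, unfold norm_mult norm_power)
        (intro mult_mono c zp; auto)+
    then show "norm (Complex (\<alpha> k) (- \<beta> k) / 2 * z ^ (n + k) + Complex (\<alpha> k) (\<beta> k) / 2 * z ^ (n - k)) \<le> (\<bar>\<alpha> k\<bar> + \<bar>\<beta> k\<bar>) * R ^ (2 * n)"
      by (simp add: algebra_simps)
  qed
  finally show ?thesis by (simp add: sum_distrib_right)
qed

lemma prod_roots_dvd:
  fixes P :: "complex poly"
  assumes "finite Z" "\<And>z. z \<in> Z \<Longrightarrow> poly P z = 0"
  shows "(\<Prod>z\<in>Z. [:- z, 1:]) dvd P"
  using assms
proof (induction Z rule: finite_induct)
  case (insert z Z)
  then obtain Q where Q: "P = (\<Prod>z\<in>Z. [:- z, 1:]) * Q" by (auto elim: dvdE)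
  have "poly P z = 0" using insert.prems by simp
  then have "(\<Prod>w\<in>Z. z - w) * poly Q z = 0" by (simp add: Q poly_prod)
  then have "poly Q z = 0" using insert.hyps by auto
  then have "[:- z, 1:] dvd Q" by (simp add: poly_eq_0_iff_dvd)
  then have "[:- z, 1:] * (\<Prod>z\<in>Z. [:- z, 1:]) dvd Q * (\<Prod>z\<in>Z. [:- z, 1:])"
    by (intro mult_dvd_mono) auto
  moreover have "(\<Prod>w\<in>insert z Z. [:- w, 1:]) = [:- z, 1:] * (\<Prod>z\<in>Z. [:- z, 1:])"
    using insert.hyps by (intro prod.insert) auto
  ultimately show ?case unfolding Q by (simp only: mult.commute)
qed simp

text \<open>A form of Jensen's inequality. After division by the product of the \<open>w - z\<close> over the zeros \<open>z\<close>,
  each factor of which has modulus at least \<open>2 \<delta>\<close> on the circle of radius \<open>3 \<delta>\<close>, the maximum principle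
  bounds the quotient at the centre, where each factor has modulus at most \<open>\<delta>\<close>.\<close>
lemma polynomial_jensen:
  fixes P :: "complex poly"
  assumes "finite Z" "\<And>z. z \<in> Z \<Longrightarrow> poly P z = 0 \<and> norm (z - z0) \<le> \<delta>" "\<delta> > 0"
    and B: "\<And>z. norm (z - z0) = 3 * \<delta> \<Longrightarrow> norm (poly P z) \<le> B"
  shows "norm (poly P z0) * 2 ^ card Z \<le> B"
proof -
  obtain Q where Q: "P = (\<Prod>z\<in>Z. [:- z, 1:]) * Q"
    using prod_roots_dvd[of Z P] assms by (auto elim: dvdE)
  have PQ: "poly P w = (\<Prod>z\<in>Z. w - z) * poly Q w" for w by (simp add: Q poly_prod)
  have bound: "norm (poly Q w) \<le> B / (2 * \<delta>) ^ card Z" if w: "norm (w - z0) = 3 * \<delta>" for w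
  proof -
    have "(2 * \<delta>) ^ card Z = (\<Prod>z\<in>Z. 2 * \<delta>)" by simp
    also have "\<dots> \<le> (\<Prod>z\<in>Z. norm (w - z))"
    proof (intro prod_mono conjI)
      fix z assume "z \<in> Z"
      then have "norm (z - z0) \<le> \<delta>" using assms by blast
      then show "2 * \<delta> \<le> norm (w - z)"
        using w norm_triangle_ineq[of "w - z" "z - z0"] by simp
    qed (use assms in auto)
    finally have "(2 * \<delta>) ^ card Z * norm (poly Q w) \<le> (\<Prod>z\<in>Z. norm (w - z)) * norm (poly Q w)"
      by (intro mult_right_mono) auto
    also have "\<dots> = norm (poly P w)" by (simp add: PQ norm_mult prod_norm)
    also have "\<dots> \<le> B" by (rule B[OF w])
    finally show ?thesis using assms(3) by (simp add: field_simps)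
  qed
  have "norm (poly Q z0) \<le> B / (2 * \<delta>) ^ card Z"
  proof (rule maximum_modulus_frontier[of "poly Q" "cball z0 (3 * \<delta>)"])
    show "norm (poly Q w) \<le> B / (2 * \<delta>) ^ card Z" if "w \<in> frontier (cball z0 (3 * \<delta>))" for w
      using that by (intro bound) (auto simp: dist_norm norm_minus_commute)
  qed (use assms(3) in \<open>auto intro!: holomorphic_intros continuous_intros\<close>)
  moreover have "(\<Prod>z\<in>Z. norm (z0 - z)) \<le> (\<Prod>z\<in>Z. \<delta>)"
    using assms(2) by (intro prod_mono) (auto simp: norm_minus_commute)
  ultimately have "norm (poly P z0) \<le> \<delta> ^ card Z * (B / (2 * \<delta>) ^ card Z)"
    unfolding PQ norm_mult prod_norm[symmetric]
    by (intro mult_mono) (use assms(3) in \<open>auto\<close>)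
  also have "\<dots> = B / 2 ^ card Z" using assms(3) by (simp add: power_mult_distrib)
  finally show ?thesis by (simp add: field_simps)
qed

text \<open>The points \<open>e\<^sup>i\<^sup>t\<close> with \<open>t \<in> [p, q]\<close> lie within \<open>\<delta> = q - p\<close> of \<open>e\<^sup>i\<^sup>p\<close>, and on the circle of radius
  \<open>3 \<delta>\<close> around this point the polynomial is at most \<open>(1 + 3 \<delta>)\<^sup>2\<^sup>n \<le> exp (6 n \<delta>)\<close> times the sum of the
  absolute values of the coefficients.\<close>
lemma trig_sum_zeros_interval:
  assumes "0 \<le> p" "p < q" "q \<le> 2 * pi" "k \<in> {1..n}" "\<alpha> k \<noteq> 0 \<or> \<beta> k \<noteq> 0" "q - p < 2 * pi"
  shows "\<bar>trig_sum \<alpha> \<beta> n p\<bar> * 2 ^ card {x \<in> {p..q}. trig_sum \<alpha> \<beta> n x = 0}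
     \<le> (\<Sum>k=1..n. \<bar>\<alpha> k\<bar> + \<bar>\<beta> k\<bar>) * exp (6 * real n * (q - p))"
proof -
  let ?P = "complexified \<alpha> \<beta> n" and ?Z = "{x \<in> {p..q}. trig_sum \<alpha> \<beta> n x = 0}"
  define S where "S = (\<Sum>k=1..n. \<bar>\<alpha> k\<bar> + \<bar>\<beta> k\<bar>)"
  have S: "S \<ge> 0" unfolding S_def by (intro sum_nonneg) auto
  have fin: "finite ?Z"
    using assms by (intro finite_subset[OF _ card_zeros_trig_sum_le(1)[of k n \<alpha> \<beta>]]) auto
  have inj: "inj_on cis ?Z"
  proof (rule inj_onI)
    fix x y assume "x \<in> ?Z" "y \<in> ?Z" and eq: "cis x = cis y"
    then have xy: "x \<in> {p..q}" "y \<in> {p..q}" by auto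
    have "cis (x - p) = cis (y - p)" using eq by (simp flip: cis_divide)
    then have "x - p = y - p"
      using xy assms by (intro cis_inj_period) auto
    then show "x = y" by simp
  qed
  have "norm (poly ?P (cis p)) * 2 ^ card (cis ` ?Z) \<le> S * exp (6 * real n * (q - p))"
  proof (rule polynomial_jensen)
    show "finite (cis ` ?Z)" using fin by simp
    show "q - p > 0" using assms by simp
    show "poly ?P z = 0 \<and> norm (z - cis p) \<le> q - p" if z: "z \<in> cis ` ?Z" for z
    proof -
      obtain x where x: "x \<in> {p..q}" "trig_sum \<alpha> \<beta> n x = 0" "z = cis x" using z by auto
      have "norm (cis x - cis p) = norm (cis p * (cis (x - p) - 1))"
        by (simp add: right_diff_distrib cis_mult)
      also have "\<dots> = norm (exp (\<i> * complex_of_real (x - p)) - 1)"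
        by (simp add: norm_mult cis_conv_exp)
      also have "\<dots> = 2 * \<bar>sin ((x - p) / 2)\<bar>" by (rule dist_exp_i_1)
      also have "\<dots> \<le> q - p" using abs_sin_x_le_abs_x[of "(x - p) / 2"] x by auto
      finally show ?thesis using x by (simp add: complexified_root)
    qed
    fix z assume z: "norm (z - cis p) = 3 * (q - p)"
    have "norm z \<le> 1 + 3 * (q - p)" using norm_triangle_ineq[of "z - cis p" "cis p"] z by simp
    then have "norm (poly ?P z) \<le> S * (1 + 3 * (q - p)) ^ (2 * n)"
      unfolding S_def using assms by (intro norm_poly_complexified_le) auto
    also have "\<dots> \<le> S * exp (3 * (q - p)) ^ (2 * n)"
      using assms S by (intro mult_left_mono power_mono exp_ge_add_one_self) auto
    also have "exp (3 * (q - p)) ^ (2 * n) = exp (6 * real n * (q - p))"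
      by (simp flip: exp_of_nat_mult)
    finally show "norm (poly ?P z) \<le> S * exp (6 * real n * (q - p))" .
  qed
  then show ?thesis unfolding norm_poly_complexified card_image[OF inj] S_def .
qed

section \<open>The circle and the Riemann--Lebesgue lemma\<close>

definition circle :: "real measure" where
  "circle = restrict_space lborel {- pi..pi}"

lemma space_circle [simp]: "space circle = {- pi..pi}"
  by (simp add: circle_def space_restrict_space)

lemma measurable_circle [measurable (raw)]: "f \<in> borel_measurable borel \<Longrightarrow> f \<in> borel_measurable circle"
  unfolding circle_def by (rule measurable_restrict_space1) simp

lemma nn_integral_circle: "(\<integral>\<^sup>+t. f t \<partial>circle) = (\<integral>\<^sup>+t. f t * indicator {- pi..pi} t \<partial>lborel)"
  unfolding circle_def by (subst nn_integral_restrict_space) auto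

lemma emeasure_circle: "emeasure circle (space circle) = ennreal (2 * pi)"
  unfolding circle_def by (simp add: emeasure_restrict_space space_restrict_space)

interpretation circle: finite_measure circle
  by standard (use emeasure_circle in simp)

lemma measure_circle: "measure circle (space circle) = 2 * pi"
  using emeasure_circle by (simp add: measure_def)

lemma AE_circle: "(AE t in lborel. P t) \<Longrightarrow> AE t in circle. P t"
  unfolding circle_def by (subst AE_restrict_space_iff) auto

lemma AE_circle_nonzero: "AE t in circle. t \<noteq> 0"
  by (rule AE_circle[OF AE_lborel_singleton])

lemma integrable_circle_mult_bounded:
  fixes f g :: "real \<Rightarrow> real"
  assumes "integrable circle f" "g \<in> borel_measurable borel" "\<And>t. t \<in> {- pi..pi} \<Longrightarrow> \<bar>g t\<bar> \<le> B"
  shows "integrable circle (\<lambda>t. g t * f t)"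
proof (rule Bochner_Integration.integrable_bound)
  show "integrable circle (\<lambda>t. B * \<bar>f t\<bar>)" using assms(1) by simp
  show "(\<lambda>t. g t * f t) \<in> borel_measurable circle"     using assms(1) by (intro borel_measurable_times[OF measurable_circle[OF assms(2)]]) auto
  have "\<bar>g t\<bar> * \<bar>f t\<bar> \<le> \<bar>B\<bar> * \<bar>f t\<bar>" if "t \<in> {- pi..pi}" for t
    using assms(3)[OF that] by (intro mult_right_mono) auto
  then show "AE t in circle. norm (g t * f t) \<le> norm (B * \<bar>f t\<bar>)"
    by (intro AE_I2) (simp add: abs_mult)
qed

lemma integrable_circle_mult_continuous:
  fixes f g :: "real \<Rightarrow> real"
  assumes "integrable circle f" "continuous_on UNIV g"
  shows "integrable circle (\<lambda>t. g t * f t)"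
proof -
  have "compact (g ` {- pi..pi})"
    by (intro compact_continuous_image continuous_on_subset[OF assms(2)]) auto
  then obtain B where "\<forall>y\<in>g ` {- pi..pi}. norm y \<le> B"
    using compact_imp_bounded bounded_iff by blast
  then show ?thesis
    by (intro integrable_circle_mult_bounded[where B=B] assms(1) borel_measurable_continuous_onI assms(2)) auto
qed

lemma integrable_circle_continuous:
  fixes g :: "real \<Rightarrow> real"
  assumes "continuous_on UNIV g"
  shows "integrable circle g"
  using integrable_circle_mult_continuous[OF circle.integrable_const[of 1] assms] by simp

lemma integral_circle_cos: "(\<integral>t. cos (of_int m * t) \<partial>circle) = (if m = 0 then 2 * pi else 0)"
proof -
  have "set_integrable lborel {- pi..pi} (\<lambda>t. cos (of_int m * t))"
    by (intro borel_integrable_atLeastAtMost') (auto intro!: continuous_intros)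
  then have "(LINT t:{- pi..pi}|lborel. cos (of_int m * t)) = integral {- pi..pi} (\<lambda>t. cos (of_int m * t))"
    by (rule set_borel_integral_eq_integral)
  then show ?thesis
    using has_integral_cos_nx[of m] unfolding circle_def set_lebesgue_integral_def
    by (subst integral_restrict_space) (auto dest: integral_unique)
qed

lemma integral_circle_odd:
  fixes g :: "real \<Rightarrow> real"
  assumes "\<And>t. g (- t) = - g t"
  shows "(\<integral>t. g t \<partial>circle) = 0"
proof -
  have ie: "(\<integral>t. g t \<partial>circle) = (\<integral>t. indicator {- pi..pi} t *\<^sub>R g t \<partial>lborel)"
    unfolding circle_def by (subst integral_restrict_space) auto
  also have "\<dots> = \<bar>- 1\<bar> *\<^sub>R (\<integral>t. indicator {- pi..pi} (0 + (- 1) * t) *\<^sub>R g (0 + (- 1) * t) \<partial>lborel)"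
    by (rule lborel_integral_real_affine) simp
  also have "\<dots> = (\<integral>t. - (indicator {- pi..pi} t *\<^sub>R g t) \<partial>lborel)"
    by (simp add: assms) (intro Bochner_Integration.integral_cong, auto simp: indicator_def)
  also have "\<dots> = - (\<integral>t. g t \<partial>circle)" by (simp add: ie)
  finally show ?thesis by simp
qed

text \<open>Integrals of a periodic function over windows of length \<open>2 \<pi>\<close> agree: shift the window by
  multiples of \<open>2 \<pi>\<close> until its left end lies in \<open>[0, 2 \<pi>]\<close>, then move the part beyond \<open>2 \<pi>\<close> back by
  one period.\<close>
lemma nn_integral_period_window:
  fixes g :: "real \<Rightarrow> ennreal"
  assumes [measurable]: "g \<in> borel_measurable borel" and per: "\<And>u. g (u + 2 * pi) = g u"
  shows "(\<integral>\<^sup>+u. g u * indicator {a..a + 2 * pi} u \<partial>lborel) = (\<integral>\<^sup>+u. g u * indicator {0..2 * pi} u \<partial>lborel)"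
proof -
  define F where "F a b = (\<integral>\<^sup>+u. g u * indicator {a..b} u \<partial>lborel)" for a b
  have split: "F a c = F a b + F b c" if "a \<le> b" "b \<le> c" for a b c
    unfolding F_def
    by (subst nn_integral_add[symmetric], simp, simp, intro nn_integral_cong_AE eventually_mono[OF AE_lborel_singleton[of b]])
      (use that in \<open>auto simp: indicator_def\<close>)
  have shift1: "F (a + 2 * pi) (b + 2 * pi) = F a b" for a b
  proof -
    have "F (a + 2 * pi) (b + 2 * pi) = ennreal \<bar>1\<bar> * (\<integral>\<^sup>+u. g (2 * pi + 1 * u) * indicator {a + 2 * pi..b + 2 * pi} (2 * pi + 1 * u) \<partial>lborel)"
      unfolding F_def by (rule nn_integral_real_affine) auto
    also have "\<dots> = F a b"
      unfolding F_def using per by (auto intro!: nn_integral_cong simp: indicator_def add.commute)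
    finally show ?thesis .
  qed
  have shiftn: "F (a + 2 * pi * real n) (b + 2 * pi * real n) = F a b" for a b n
  proof (induction n)
    case (Suc n)
    have "F (a + 2 * pi * real (Suc n)) (b + 2 * pi * real (Suc n)) = F ((a + 2 * pi * real n) + 2 * pi) ((b + 2 * pi * real n) + 2 * pi)"
      by (simp add: algebra_simps)
    then show ?case using Suc shift1 by simp
  qed simp
  have shifti: "F (a + 2 * pi * of_int k) (b + 2 * pi * of_int k) = F a b" for a b k
  proof (cases "k \<ge> 0")
    case True then show ?thesis using shiftn[of a "nat k" b] by simp
  next
    case False
    then show ?thesis using shiftn[of "a + 2 * pi * of_int k" "nat (- k)" "b + 2 * pi * of_int k"] by simp
  qed
  define k where "k = \<lfloor>a / (2 * pi)\<rfloor>"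
  define r where "r = a - 2 * pi * of_int k"
  have r: "0 \<le> r" "r \<le> 2 * pi" 
  proof -
    have "of_int k \<le> a / (2 * pi)" "a / (2 * pi) \<le> of_int k + 1" unfolding k_def by linarith+
    then show "0 \<le> r" "r \<le> 2 * pi" unfolding r_def by (simp_all add: field_simps)
  qed
  have "F a (a + 2 * pi) = F (r + 2 * pi * of_int k) (r + 2 * pi + 2 * pi * of_int k)"
    by (simp add: r_def)
  also have "\<dots> = F r (r + 2 * pi)" by (rule shifti)
  also have "\<dots> = F r (2 * pi) + F (0 + 2 * pi) (r + 2 * pi)" using r split[of r "2 * pi" "r + 2 * pi"] by simp
  also have "\<dots> = F 0 r + F r (2 * pi)" unfolding shift1 by (rule add.commute)
  also have "\<dots> = F 0 (2 * pi)" using r split[of 0 r "2 * pi"] by simp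
  finally show ?thesis by (simp add: F_def)
qed

lemma nn_integral_circle_shift:
  fixes g :: "real \<Rightarrow> ennreal"
  assumes [measurable]: "g \<in> borel_measurable borel" and per: "\<And>u. g (u + 2 * pi) = g u"
  shows "(\<integral>\<^sup>+t. g (x - t) \<partial>circle) = (\<integral>\<^sup>+t. g t \<partial>circle)"
proof -
  have "(\<integral>\<^sup>+u. g u * indicator {x - pi..x + pi} u \<partial>lborel)
      = ennreal \<bar>- 1\<bar> * (\<integral>\<^sup>+t. g (x + (- 1) * t) * indicator {x - pi..x + pi} (x + (- 1) * t) \<partial>lborel)"
    by (rule nn_integral_real_affine) auto
  also have "\<dots> = (\<integral>\<^sup>+t. g (x - t) \<partial>circle)"
    unfolding nn_integral_circle by (auto intro!: nn_integral_cong simp: indicator_def)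
  finally show ?thesis
    using nn_integral_period_window[of g "x - pi", OF assms] nn_integral_period_window[of g "- pi", OF assms]
    unfolding nn_integral_circle by (simp add: add.commute)
qed

lemma integral_circle_shift:
  fixes g :: "real \<Rightarrow> real"
  assumes g [measurable]: "g \<in> borel_measurable borel" and per: "\<And>u. g (u + 2 * pi) = g u" and int: "integrable circle g"
  shows "integrable circle (\<lambda>t. g (x - t))" "(\<integral>t. g (x - t) \<partial>circle) = (\<integral>t. g t \<partial>circle)"
proof -
  have nn: "(\<integral>\<^sup>+t. ennreal (norm (g (x - t))) \<partial>circle) = (\<integral>\<^sup>+t. ennreal (norm (g t)) \<partial>circle)"
    by (rule nn_integral_circle_shift) (auto simp: per)
  show 1: "integrable circle (\<lambda>t. g (x - t))"
    unfolding integrable_iff_bounded nn using int by (auto simp: integrable_iff_bounded intro!: measurable_circle)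
  have "(\<integral>\<^sup>+t. ennreal (g (x - t)) \<partial>circle) = (\<integral>\<^sup>+t. ennreal (g t) \<partial>circle)"
    by (rule nn_integral_circle_shift) (auto simp: per)
  moreover have "(\<integral>\<^sup>+t. ennreal (- g (x - t)) \<partial>circle) = (\<integral>\<^sup>+t. ennreal (- g t) \<partial>circle)"
    by (rule nn_integral_circle_shift[of "\<lambda>u. ennreal (- g u)"]) (auto simp: per)
  ultimately show "(\<integral>t. g (x - t) \<partial>circle) = (\<integral>t. g t \<partial>circle)"
    using real_lebesgue_integral_def[OF 1] real_lebesgue_integral_def[OF int] by simp
qed

text \<open>For bounded \<open>h\<close> Bessel's inequality makes the squares of the coefficients summable; the general
  case follows by truncation, since the \<open>e k\<close> are uniformly bounded.\<close>
lemma (in finite_measure) orthogonal_coefficients_tendsto_0: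
  fixes e :: "nat \<Rightarrow> 'a \<Rightarrow> real"
  assumes e [measurable]: "\<And>k. e k \<in> borel_measurable M" and bound: "\<And>k t. \<bar>e k t\<bar> \<le> 1"
    and orth: "\<And>k l. k \<noteq> l \<Longrightarrow> (\<integral>t. e k t * e l t \<partial>M) = 0"
    and h: "integrable M h"
  shows "(\<lambda>k. \<integral>t. h t * e k t \<partial>M) \<longlonglongrightarrow> 0"
proof -
  have [measurable]: "h \<in> borel_measurable M" using h by simp
  have bounded: "(\<lambda>k. \<integral>t. g t * e k t \<partial>M) \<longlonglongrightarrow> 0"
    if [measurable]: "g \<in> borel_measurable M" and gB: "\<And>t. \<bar>g t\<bar> \<le> B" for g B
  proof -
    define c where "c k = (\<integral>t. g t * e k t \<partial>M)" for k
    define V where "V = measure M (space M) + 1"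
    have V: "V > 0" "measure M (space M) \<le> V" by (auto simp: V_def add_nonneg_pos)
    have B: "B \<ge> 0" using gB[of undefined] by simp
    have int1: "integrable M (\<lambda>t. g t * e k t)" for k
      by (rule integrable_const_bound[where B=B]) (use gB bound B in \<open>auto simp: abs_mult intro!: AE_I2 order_trans[OF mult_mono[OF gB bound]]\<close>)
    have int2: "integrable M (\<lambda>t. e k t * e l t)" for k l
      by (rule integrable_const_bound[where B=1]) (auto simp: abs_mult intro!: AE_I2 mult_le_one bound)
    have int3: "integrable M (\<lambda>t. (g t)\<^sup>2)"
      by (rule integrable_const_bound[where B="B\<^sup>2"])
        (use gB in \<open>auto intro!: AE_I2 simp: abs_le_square_iff[symmetric] abs_of_nonneg[OF B]\<close>)
    have sq: "(\<integral>t. e k t * e k t \<partial>M) \<le> V" for k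
    proof -
      have "(\<integral>t. e k t * e k t \<partial>M) \<le> (\<integral>t. 1 \<partial>M)"
      proof (rule integral_mono[OF int2])
        fix t
        have "\<bar>e k t * e k t\<bar> \<le> 1" unfolding abs_mult by (intro mult_le_one bound) auto
        then show "e k t * e k t \<le> 1" by simp
      qed simp
      then show ?thesis using V by simp
    qed
    \<comment> \<open>\<open>V\<close> bounds the squared norms of the \<open>e k\<close>. Dividing by it makes the cross term outweigh the
      square of the projection without normalising the \<open>e k\<close>.\<close>
    have bessel: "(\<Sum>k<N. (c k)\<^sup>2) \<le> V * (\<integral>t. (g t)\<^sup>2 \<partial>M)" for N
    proof -
      have eq: "(g t - (\<Sum>k<N. c k * e k t) / V)\<^sup>2
          = (g t)\<^sup>2 - 2 / V * (\<Sum>k<N. c k * (g t * e k t)) + (\<Sum>k<N. \<Sum>l<N. c k * c l * (e k t * e l t)) / V\<^sup>2" for t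
      proof -
        have "(\<Sum>k<N. c k * e k t)\<^sup>2 = (\<Sum>k<N. \<Sum>l<N. c k * c l * (e k t * e l t))"
          by (simp add: power2_eq_square sum_product mult_ac)
        moreover have "g t * (\<Sum>k<N. c k * e k t) = (\<Sum>k<N. c k * (g t * e k t))"
          by (simp add: sum_distrib_left mult_ac)
        ultimately show ?thesis by (simp add: power2_diff power_divide)
      qed
      have "0 \<le> (\<integral>t. (g t - (\<Sum>k<N. c k * e k t) / V)\<^sup>2 \<partial>M)" by simp
      also have "\<dots> = (\<integral>t. (g t)\<^sup>2 \<partial>M) - 2 / V * (\<Sum>k<N. c k * c k) + (\<Sum>k<N. \<Sum>l<N. c k * c l * (\<integral>t. e k t * e l t \<partial>M)) / V\<^sup>2"
        unfolding eq using int1 int2 int3 by (simp add: c_def)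
      also have "(\<Sum>k<N. \<Sum>l<N. c k * c l * (\<integral>t. e k t * e l t \<partial>M)) = (\<Sum>k<N. c k * c k * (\<integral>t. e k t * e k t \<partial>M))"
      proof (rule sum.cong[OF refl])
        fix k assume "k \<in> {..<N}"
        then have "(\<Sum>l<N. c k * c l * (\<integral>t. e k t * e l t \<partial>M)) = (\<Sum>l\<in>{k}. c k * c l * (\<integral>t. e k t * e l t \<partial>M))"
          by (intro sum.mono_neutral_right) (auto simp: orth)
        then show "(\<Sum>l<N. c k * c l * (\<integral>t. e k t * e l t \<partial>M)) = c k * c k * (\<integral>t. e k t * e k t \<partial>M)" by simp
      qed
      also have "(\<Sum>k<N. c k * c k * (\<integral>t. e k t * e k t \<partial>M)) \<le> (\<Sum>k<N. c k * c k * V)"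
        by (intro sum_mono mult_left_mono sq) auto
      finally have "0 \<le> (\<integral>t. (g t)\<^sup>2 \<partial>M) - 2 / V * (\<Sum>k<N. c k * c k) + (\<Sum>k<N. c k * c k * V) / V\<^sup>2"
        using V by (simp add: divide_right_mono)
      also have "(\<Sum>k<N. c k * c k * V) / V\<^sup>2 = (\<Sum>k<N. c k * c k) / V"
        using V by (simp add: sum_distrib_right[symmetric] power2_eq_square)
      finally show ?thesis using V by (simp add: field_simps power2_eq_square)
    qed
    have "summable (\<lambda>k. (c k)\<^sup>2)"
      by (rule summableI_nonneg_bounded[where x="V * (\<integral>t. (g t)\<^sup>2 \<partial>M)"]) (use bessel in auto)
    then have "(\<lambda>k. (c k)\<^sup>2) \<longlonglongrightarrow> 0" by (rule summable_LIMSEQ_zero)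
    then have "(\<lambda>k. sqrt ((c k)\<^sup>2)) \<longlonglongrightarrow> sqrt 0" by (intro tendsto_intros)
    then have "(\<lambda>k. \<bar>c k\<bar>) \<longlonglongrightarrow> 0" by simp
    then show ?thesis unfolding c_def by (rule tendsto_rabs_zero_cancel)
  qed
  define g where "g m t = (if \<bar>h t\<bar> \<le> real m then h t else 0)" for m t
  have [measurable]: "g m \<in> borel_measurable M" for m unfolding g_def by measurable
  have g_le: "\<bar>h t - g m t\<bar> \<le> \<bar>h t\<bar>" for m t by (simp add: g_def)
  have int_g: "integrable M (g m)" for m
    by (rule Bochner_Integration.integrable_bound[OF h]) (auto simp: g_def)
  have "(\<lambda>m. \<integral>t. \<bar>h t - g m t\<bar> \<partial>M) \<longlonglongrightarrow> (\<integral>t. 0 \<partial>M)"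
  proof (rule integral_dominated_convergence[where w="\<lambda>t. \<bar>h t\<bar>"])
    show "AE t in M. (\<lambda>m. \<bar>h t - g m t\<bar>) \<longlonglongrightarrow> 0"
    proof (intro AE_I2 tendsto_eventually)
      fix t
      show "\<forall>\<^sub>F m in sequentially. \<bar>h t - g m t\<bar> = 0"
        using eventually_ge_at_top[of "nat \<lceil>\<bar>h t\<bar>\<rceil>"]
      proof eventually_elim
        case (elim m)
        have "\<bar>h t\<bar> \<le> real (nat \<lceil>\<bar>h t\<bar>\<rceil>)" by (rule real_nat_ceiling_ge)
        also have "\<dots> \<le> real m" using elim by (simp only: of_nat_le_iff)
        finally show ?case by (simp add: g_def)
      qed
    qed
  qed (use h g_le in auto)
  then have gap: "(\<lambda>m. \<integral>t. \<bar>h t - g m t\<bar> \<partial>M) \<longlonglongrightarrow> 0" by simp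
  show ?thesis
  proof (rule LIMSEQ_I)
    fix r :: real assume "r > 0"
    obtain m where m: "(\<integral>t. \<bar>h t - g m t\<bar> \<partial>M) < r / 2"
      using order_tendstoD(2)[OF gap, of "r / 2"] \<open>r > 0\<close> by (auto dest: eventually_happens)
    have "\<forall>\<^sub>F k in sequentially. \<bar>\<integral>t. g m t * e k t \<partial>M\<bar> < r / 2"
      using order_tendstoD(2)[OF tendsto_rabs_zero[OF bounded[of "g m" "real m"]], of "r / 2"] \<open>r > 0\<close>
      by (auto simp: g_def)
    then obtain N where N: "\<And>k. k \<ge> N \<Longrightarrow> \<bar>\<integral>t. g m t * e k t \<partial>M\<bar> < r / 2"
      by (auto simp: eventually_sequentially)
    have inth: "integrable M (\<lambda>t. f t * e k t)" if "integrable M f" for f k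
      by (rule Bochner_Integration.integrable_bound[OF that]) (use bound that in \<open>auto simp: abs_mult mult_left_le\<close>)
    have "norm ((\<integral>t. h t * e k t \<partial>M) - 0) < r" if "k \<ge> N" for k
    proof -
      have "(\<integral>t. h t * e k t \<partial>M) = (\<integral>t. g m t * e k t \<partial>M) + (\<integral>t. (h t - g m t) * e k t \<partial>M)"
        using h int_g by (subst Bochner_Integration.integral_add[symmetric])
          (auto intro!: inth Bochner_Integration.integrable_diff Bochner_Integration.integral_cong simp: left_diff_distrib)
      moreover have "\<bar>\<integral>t. (h t - g m t) * e k t \<partial>M\<bar> \<le> (\<integral>t. \<bar>h t - g m t\<bar> \<partial>M)"
      proof (rule order_trans[OF integral_abs_bound integral_mono])
        show "integrable M (\<lambda>t. \<bar>(h t - g m t) * e k t\<bar>)"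
          using h int_g by (intro integrable_abs inth) auto
      qed (use h int_g bound in \<open>auto simp: abs_mult mult_left_le\<close>)
      ultimately show ?thesis using N[OF that] m by simp
    qed
    then show "\<exists>N. \<forall>k\<ge>N. norm ((\<integral>t. h t * e k t \<partial>M) - 0) < r" by blast
  qed
qed

lemma riemann_lebesgue:
  assumes h: "integrable circle h"
  shows "(\<lambda>n. \<integral>t. h t * cos (real n * t) \<partial>circle) \<longlonglongrightarrow> 0"
    and "(\<lambda>n. \<integral>t. h t * sin (real n * t) \<partial>circle) \<longlonglongrightarrow> 0"
proof -
  have intc: "integrable circle (\<lambda>t. cos (of_int m * t))" for m :: int
    by (intro integrable_circle_continuous continuous_intros)
  have "(\<lambda>n. \<integral>t. h t * cos (real (Suc n) * t) \<partial>circle) \<longlonglongrightarrow> 0"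
  proof (rule circle.orthogonal_coefficients_tendsto_0[OF _ _ _ h])
    fix k l :: nat assume "k \<noteq> l"
    have "(\<integral>t. cos (real (Suc k) * t) * cos (real (Suc l) * t) \<partial>circle)
        = (\<integral>t. (cos (of_int (int k - int l) * t) + cos (of_int (int k + int l + 2) * t)) / 2 \<partial>circle)"
      by (intro Bochner_Integration.integral_cong) (auto simp: cos_times_cos algebra_simps)
    also have "\<dots> = 0" using \<open>k \<noteq> l\<close>
      by (subst integral_divide_zero, subst Bochner_Integration.integral_add[OF intc intc], simp only: integral_circle_cos) auto
    finally show "(\<integral>t. cos (real (Suc k) * t) * cos (real (Suc l) * t) \<partial>circle) = 0" .
  qed (auto intro!: measurable_circle)
  then show "(\<lambda>n. \<integral>t. h t * cos (real n * t) \<partial>circle) \<longlonglongrightarrow> 0" by (rule LIMSEQ_imp_Suc)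
  have "(\<lambda>n. \<integral>t. h t * sin (real (Suc n) * t) \<partial>circle) \<longlonglongrightarrow> 0"
  proof (rule circle.orthogonal_coefficients_tendsto_0[OF _ _ _ h])
    fix k l :: nat assume "k \<noteq> l"
    have "(\<integral>t. sin (real (Suc k) * t) * sin (real (Suc l) * t) \<partial>circle)
        = (\<integral>t. (cos (of_int (int k - int l) * t) - cos (of_int (int k + int l + 2) * t)) / 2 \<partial>circle)"
      by (intro Bochner_Integration.integral_cong) (auto simp: sin_times_sin algebra_simps)
    also have "\<dots> = 0" using \<open>k \<noteq> l\<close>
      by (subst integral_divide_zero, subst Bochner_Integration.integral_diff[OF intc intc], simp only: integral_circle_cos) auto
    finally show "(\<integral>t. sin (real (Suc k) * t) * sin (real (Suc l) * t) \<partial>circle) = 0" .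
  qed (auto intro!: measurable_circle)
  then show "(\<lambda>n. \<integral>t. h t * sin (real n * t) \<partial>circle) \<longlonglongrightarrow> 0" by (rule LIMSEQ_imp_Suc)
qed

section \<open>The centred Dirichlet kernel\<close>

text \<open>The mean of the frequencies \<open>1, \<dots>, n\<close>. Subtracting it turns \<open>\<Sum> e\<^sup>i\<^sup>k\<^sup>t\<close> into a real even function,
  the Dirichlet kernel \<open>sin (n t / 2) / sin (t / 2)\<close>.\<close>
definition mid :: "nat \<Rightarrow> real" where "mid n = (real n + 1) / 2"

definition dirichlet :: "nat \<Rightarrow> real \<Rightarrow> real" where
  "dirichlet n t = (\<Sum>k=1..n. cos ((real k - mid n) * t))"

definition dirichlet' :: "nat \<Rightarrow> real \<Rightarrow> real" where
  "dirichlet' n t = - (\<Sum>k=1..n. (real k - mid n) * sin ((real k - mid n) * t))"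

lemma dirichlet_deriv: "(dirichlet n has_real_derivative dirichlet' n t) (at t)"
  unfolding dirichlet_def[abs_def] dirichlet'_def
  by (auto intro!: derivative_eq_intros simp: sum_negf[symmetric] mult.commute)

lemma dirichlet_measurable [measurable]:
  "dirichlet n \<in> borel_measurable borel" "dirichlet' n \<in> borel_measurable borel"
  unfolding dirichlet_def[abs_def] dirichlet'_def[abs_def] by measurable

lemma dirichlet_even: "dirichlet n (- t) = dirichlet n t" and dirichlet'_odd: "dirichlet' n (- t) = - dirichlet' n t"
  by (simp_all add: dirichlet_def dirichlet'_def sum_negf)

lemma sum_mid_reflect: "(\<Sum>k=1..n. g (real k - mid n)) = (\<Sum>k=1..n. g (- (real k - mid n)))"
  by (rule sum.reindex_bij_witness[of _ "\<lambda>k. n + 1 - k" "\<lambda>k. n + 1 - k"])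
    (auto simp: mid_def of_nat_diff intro!: arg_cong[of _ _ g] simp: field_simps)

lemma sum_mid_odd:
  fixes g :: "real \<Rightarrow> real"
  assumes "\<And>x. g (- x) = - g x"
  shows "(\<Sum>k=1..n. g (real k - mid n)) = 0"
  using sum_mid_reflect[of g n] unfolding assms sum_negf by simp

lemma sum_mid_square: "(\<Sum>k=1..n. (real k - mid n)\<^sup>2) = real n * ((real n)\<^sup>2 - 1) / 12"
proof -
  have 1: "(\<Sum>k=1..n. real k) = real n * (real n + 1) / 2"
    by (induction n) (auto simp: field_simps)
  have 2: "(\<Sum>k=1..n. (real k)\<^sup>2) = real n * (real n + 1) * (2 * real n + 1) / 6"
    by (induction n) (auto simp: field_simps power2_eq_square)
  have "(\<Sum>k=1..n. (real k - mid n)\<^sup>2) = (\<Sum>k=1..n. (real k)\<^sup>2 - 2 * mid n * real k + (mid n)\<^sup>2)"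
    by (intro sum.cong) (auto simp: power2_diff)
  also have "\<dots> = (\<Sum>k=1..n. (real k)\<^sup>2) - 2 * mid n * (\<Sum>k=1..n. real k) + real n * (mid n)\<^sup>2"
    by (simp add: sum.distrib sum_subtractf sum_distrib_left)
  also have "\<dots> = real n * ((real n)\<^sup>2 - 1) / 12"
    unfolding 1 2 by (simp add: mid_def field_simps power2_eq_square)
  finally show ?thesis .
qed

lemma dirichlet_square: "(dirichlet n t)\<^sup>2 = (\<Sum>k=1..n. \<Sum>l=1..n. cos ((real k - real l) * t))"
proof -
  have z: "(\<Sum>k=1..n. sin ((real k - mid n) * t)) = 0"
    by (rule sum_mid_odd[of "\<lambda>x. sin (x * t)"]) simp
  have "(\<Sum>k=1..n. \<Sum>l=1..n. cos ((real k - real l) * t))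
     = (\<Sum>k=1..n. \<Sum>l=1..n. cos ((real k - mid n) * t) * cos ((real l - mid n) * t) + sin ((real k - mid n) * t) * sin ((real l - mid n) * t))"
    by (intro sum.cong refl, subst cos_diff[symmetric]) (simp add: algebra_simps)
  also have "\<dots> = (dirichlet n t)\<^sup>2 + (\<Sum>k=1..n. sin ((real k - mid n) * t))\<^sup>2"
    by (simp add: sum.distrib dirichlet_def power2_eq_square sum_product)
  finally show ?thesis using z by simp
qed

lemma dirichlet'_square:
  "(dirichlet' n t)\<^sup>2 = (\<Sum>k=1..n. \<Sum>l=1..n. (real k - mid n) * (real l - mid n) * cos ((real k - real l) * t))"
proof -
  have z: "(\<Sum>k=1..n. (real k - mid n) * cos ((real k - mid n) * t)) = 0"
    by (rule sum_mid_odd[of "\<lambda>x. x * cos (x * t)"]) simp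
  have "(\<Sum>k=1..n. \<Sum>l=1..n. (real k - mid n) * (real l - mid n) * cos ((real k - real l) * t))
     = (\<Sum>k=1..n. \<Sum>l=1..n. ((real k - mid n) * cos ((real k - mid n) * t)) * ((real l - mid n) * cos ((real l - mid n) * t))
         + ((real k - mid n) * sin ((real k - mid n) * t)) * ((real l - mid n) * sin ((real l - mid n) * t)))"
  proof (intro sum.cong refl)
    fix k l
    have "cos ((real k - real l) * t) = cos ((real k - mid n) * t) * cos ((real l - mid n) * t) + sin ((real k - mid n) * t) * sin ((real l - mid n) * t)"
      by (subst cos_diff[symmetric]) (simp add: algebra_simps)
    then show "(real k - mid n) * (real l - mid n) * cos ((real k - real l) * t)
      = ((real k - mid n) * cos ((real k - mid n) * t)) * ((real l - mid n) * cos ((real l - mid n) * t))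
         + ((real k - mid n) * sin ((real k - mid n) * t)) * ((real l - mid n) * sin ((real l - mid n) * t))"
      by (simp only:) (simp only: distrib_left mult_ac)
  qed
  also have "\<dots> = (\<Sum>k=1..n. (real k - mid n) * cos ((real k - mid n) * t))\<^sup>2 + (dirichlet' n t)\<^sup>2"
    by (simp add: sum.distrib dirichlet'_def power2_eq_square sum_product)
  finally show ?thesis using z by simp
qed

text \<open>Only the diagonal of a double cosine sum has a nonzero mean.\<close>
lemma integral_double_sum_cos:
  fixes w :: "nat \<Rightarrow> nat \<Rightarrow> real"
  shows "(\<integral>t. (\<Sum>k=1..n. \<Sum>l=1..n. w k l * cos ((real k - real l) * t)) \<partial>circle) = 2 * pi * (\<Sum>k=1..n. w k k)"
proof -
  have c: "cos ((real k - real l) * t) = cos (of_int (int k - int l) * t)" for k l t by simp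
  have int: "integrable circle (\<lambda>t. w k l * cos (of_int (int k - int l) * t))" for k l
    by (intro integrable_circle_continuous continuous_intros)
  have "(\<integral>t. (\<Sum>k=1..n. \<Sum>l=1..n. w k l * cos ((real k - real l) * t)) \<partial>circle)
     = (\<Sum>k=1..n. \<Sum>l=1..n. w k l * (\<integral>t. cos (of_int (int k - int l) * t) \<partial>circle))"
    unfolding c using int
    by (simp only: Bochner_Integration.integral_sum Bochner_Integration.integrable_sum integral_mult_right_zero)
  also have "\<dots> = (\<Sum>k=1..n. \<Sum>l=1..n. if k = l then 2 * pi * w k k else 0)"
    unfolding integral_circle_cos by (intro sum.cong refl) auto
  also have "\<dots> = 2 * pi * (\<Sum>k=1..n. w k k)"
    by (simp add: sum_distrib_left)
  finally show ?thesis .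
qed

lemma integral_dirichlet_square: "(\<integral>t. (dirichlet n t)\<^sup>2 \<partial>circle) = 2 * pi * real n"
  using integral_double_sum_cos[of "\<lambda>k l. 1" n] by (simp add: dirichlet_square)

lemma integral_dirichlet'_square: "(\<integral>t. (dirichlet' n t)\<^sup>2 \<partial>circle) = 2 * pi * (real n * ((real n)\<^sup>2 - 1) / 12)"
  using integral_double_sum_cos[of "\<lambda>k l. (real k - mid n) * (real l - mid n)" n]
  unfolding dirichlet'_square power2_eq_square[symmetric] sum_mid_square .

lemma dirichlet_times_sin: "dirichlet n t * sin (t / 2) = sin (real n * t / 2)"
proof -
  have *: "2 * sin (t / 2) * (\<Sum>k=1..m. cos ((real k - c) * t)) = sin ((real m - c + 1 / 2) * t) - sin ((1 / 2 - c) * t)"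
    for m :: nat and c :: real
  proof (induction m)
    case (Suc m)
    have "2 * sin (t / 2) * cos ((real (Suc m) - c) * t) = sin ((real (Suc m) - c + 1 / 2) * t) - sin ((real m - c + 1 / 2) * t)"
      using sin_times_cos[of "t/2" "(real (Suc m) - c) * t"] sin_minus[of "(real m - c + 1 / 2) * t"]
      by (simp add: algebra_simps)
    then show ?case using Suc by (simp add: algebra_simps)
  qed simp
  have e: "(real n - mid n + 1 / 2) * t = real n * t / 2" "(1 / 2 - mid n) * t = - (real n * t / 2)"
    by (simp_all add: mid_def field_simps)
  show ?thesis
    using *[of "mid n" n] unfolding e by (simp add: dirichlet_def mult.commute)
qed

lemma dirichlet'_times_sin:
  "dirichlet' n t * sin (t / 2) = real n / 2 * cos (real n * t / 2) - dirichlet n t * cos (t / 2) / 2"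
proof -
  have "((\<lambda>t. dirichlet n t * sin (t / 2)) has_real_derivative dirichlet' n t * sin (t / 2) + dirichlet n t * (cos (t / 2) / 2)) (at t)"
    by (auto intro!: derivative_eq_intros dirichlet_deriv)
  moreover have "((\<lambda>t. sin (real n * t / 2)) has_real_derivative cos (real n * t / 2) * (real n / 2)) (at t)"
    by (auto intro!: derivative_eq_intros)
  ultimately have "dirichlet' n t * sin (t / 2) + dirichlet n t * (cos (t / 2) / 2) = cos (real n * t / 2) * (real n / 2)"
    unfolding dirichlet_times_sin by (rule DERIV_unique)
  then show ?thesis by (simp add: algebra_simps)
qed

lemma abs_mid_le: "k \<in> {1..n} \<Longrightarrow> \<bar>real k - mid n\<bar> \<le> real n"
  unfolding mid_def by (auto simp: abs_le_iff field_simps)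

lemma abs_dirichlet_le: "\<bar>dirichlet n t\<bar> \<le> real n"
  unfolding dirichlet_def by (rule order_trans[OF sum_abs order_trans[OF sum_bounded_above[where K=1]]]) auto

lemma abs_dirichlet'_le: "\<bar>dirichlet' n t\<bar> \<le> real n * real n"
proof -
  have "\<bar>dirichlet' n t\<bar> \<le> (\<Sum>k=1..n. \<bar>(real k - mid n) * sin ((real k - mid n) * t)\<bar>)"
    unfolding dirichlet'_def abs_minus_cancel by (rule sum_abs)
  also have "\<dots> \<le> (\<Sum>k=1..n. real n)"
    unfolding abs_mult by (intro sum_mono order_trans[OF mult_left_le abs_mid_le]) auto
  finally show ?thesis by simp
qed

text \<open>Concavity of the sine on \<open>[0, \<pi> / 2]\<close>.\<close>
lemma abs_le_pi_sin:
  assumes "t \<in> {- pi..pi}"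
  shows "\<bar>t\<bar> \<le> pi * \<bar>sin (t / 2)\<bar>"
proof -
  have pos: "t \<le> pi * sin (t / 2)" if "0 \<le> t" "t \<le> pi" for t :: real
  proof -
    have "concave_on {0..pi / 2} sin"
    proof (rule f''_le0_imp_concave)
      show "\<And>x. x \<in> {0..pi/2} \<Longrightarrow> (sin has_real_derivative cos x) (at x)" by (rule DERIV_sin)
      show "\<And>x. x \<in> {0..pi/2} \<Longrightarrow> (cos has_real_derivative - sin x) (at x)" by (rule DERIV_cos)
      show "- sin x \<le> 0" if "x \<in> {0..pi/2}" for x using that pi_ge_zero by (auto intro!: sin_ge_zero, linarith?)
    qed simp
    then have "(1 - t / pi) * sin 0 + (t / pi) * sin (pi / 2) \<le> sin ((1 - t / pi) *\<^sub>R 0 + (t / pi) *\<^sub>R (pi / 2))"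
      using that by (intro concave_onD) auto
    then show ?thesis using that by (simp add: field_simps)
  qed
  show ?thesis
  proof (cases "t \<ge> 0")
    case True
    then show ?thesis using assms pos[of t] by (auto intro: order_trans[OF _ mult_left_mono[OF abs_ge_self]])
  next
    case False
    then show ?thesis using assms pos[of "-t"] mult_left_mono[OF abs_ge_minus_self[of "sin (t/2)"], of pi] by auto
  qed
qed

lemma sin_half_nonzero: "t \<in> {- pi..pi} \<Longrightarrow> t \<noteq> 0 \<Longrightarrow> sin (t / 2) \<noteq> 0"
  using abs_le_pi_sin[of t] by auto

text \<open>An integrable majorant of all kernels below, at most \<open>n\<close> and at most \<open>1 / (n t\<^sup>2)\<close>, with total mass
  \<open>\<pi>\<close> on the line for every \<open>n \<ge> 1\<close>.\<close>
definition lorentz :: "nat \<Rightarrow> real \<Rightarrow> real" where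
  "lorentz n t = real n / (1 + (real n * t)\<^sup>2)"

lemma lorentz_nonneg: "0 \<le> lorentz n t"
  by (simp add: lorentz_def add_nonneg_nonneg)

lemma lorentz_measurable [measurable]: "lorentz n \<in> borel_measurable borel"
  unfolding lorentz_def[abs_def] by measurable

lemma lorentz_tail:
  assumes "n \<ge> 1" "t \<noteq> 0"
  shows "lorentz n t \<le> 1 / (real n * t\<^sup>2)"
proof -
  have "real n / (1 + (real n * t)\<^sup>2) \<le> real n / (real n * t)\<^sup>2"
    using assms by (intro divide_left_mono mult_pos_pos add_pos_nonneg) auto
  also have "real n / (real n * t)\<^sup>2 = 1 / (real n * t\<^sup>2)"
    using assms by (simp add: power_mult_distrib power2_eq_square[of "real n"])
  finally show ?thesis unfolding lorentz_def .
qed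

definition kernel_const :: real where "kernel_const = 1 + pi\<^sup>2"

lemma kernel_const_pos: "kernel_const > 0" by (simp add: kernel_const_def add_pos_nonneg)

lemma lorentz_bound:
  assumes "n \<ge> 1" "\<bar>g\<bar> \<le> m" "\<bar>g\<bar> * \<bar>t\<bar> * real n \<le> pi * m"
  shows "g\<^sup>2 / real n \<le> kernel_const * m\<^sup>2 / (real n)\<^sup>2 * lorentz n t"
proof -
  have m: "m \<ge> 0" using assms by simp
  have 1: "g\<^sup>2 \<le> m\<^sup>2" using assms m by (simp add: abs_le_square_iff[symmetric])
  have "(g * t * real n)\<^sup>2 \<le> (pi * m)\<^sup>2" using assms m by (simp add: abs_le_square_iff[symmetric] abs_mult)
  then have 2: "g\<^sup>2 * (real n * t)\<^sup>2 \<le> pi\<^sup>2 * m\<^sup>2" by (simp add: power_mult_distrib mult_ac)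
  have "g\<^sup>2 * (1 + (real n * t)\<^sup>2) \<le> kernel_const * m\<^sup>2" using 1 2 by (simp add: kernel_const_def algebra_simps)
  moreover have "0 < 1 + (real n * t)\<^sup>2" by (simp add: add_pos_nonneg)
  ultimately have "g\<^sup>2 \<le> kernel_const * m\<^sup>2 / (1 + (real n * t)\<^sup>2)" by (simp add: pos_le_divide_eq)
  then have "g\<^sup>2 / real n \<le> kernel_const * m\<^sup>2 / (1 + (real n * t)\<^sup>2) / real n" by (intro divide_right_mono) auto
  also have "\<dots> = kernel_const * m\<^sup>2 / (real n)\<^sup>2 * lorentz n t" using assms(1) by (simp add: lorentz_def power2_eq_square)
  finally show ?thesis .
qed

lemma dirichlet_square_le_lorentz:
  assumes "n \<ge> 1" "t \<in> {- pi..pi}"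
  shows "(dirichlet n t)\<^sup>2 / real n \<le> kernel_const * lorentz n t"
proof -
  have "\<bar>dirichlet n t\<bar> * \<bar>t\<bar> \<le> \<bar>dirichlet n t\<bar> * (pi * \<bar>sin (t / 2)\<bar>)"
    by (intro mult_left_mono abs_le_pi_sin assms) auto
  also have "\<dots> = pi * \<bar>dirichlet n t * sin (t / 2)\<bar>" by (simp add: abs_mult)
  also have "\<dots> \<le> pi * 1" unfolding dirichlet_times_sin by (intro mult_left_mono) auto
  finally have "\<bar>dirichlet n t\<bar> * \<bar>t\<bar> * real n \<le> pi * real n" by (intro mult_right_mono) auto
  from lorentz_bound[OF assms(1) abs_dirichlet_le this]
  show ?thesis using assms(1) by simp
qed

lemma dirichlet'_square_le_lorentz:
  assumes "n \<ge> 1" "t \<in> {- pi..pi}"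
  shows "(dirichlet' n t)\<^sup>2 / real n ^ 3 \<le> kernel_const * lorentz n t"
proof -
  have "\<bar>dirichlet' n t * sin (t / 2)\<bar> \<le> \<bar>real n / 2 * cos (real n * t / 2)\<bar> + \<bar>dirichlet n t * cos (t / 2) / 2\<bar>"
    unfolding dirichlet'_times_sin by (rule abs_triangle_ineq4)
  also have "\<dots> \<le> real n / 2 + real n / 2"
    unfolding abs_mult abs_divide
    using order_trans[OF mult_left_le[of "\<bar>cos (t / 2)\<bar>" "\<bar>dirichlet n t\<bar>"] abs_dirichlet_le]
    by (intro add_mono divide_right_mono) (auto intro: mult_left_le)
  finally have sn: "\<bar>dirichlet' n t * sin (t / 2)\<bar> \<le> real n" by simp
  have "\<bar>dirichlet' n t\<bar> * \<bar>t\<bar> \<le> \<bar>dirichlet' n t\<bar> * (pi * \<bar>sin (t / 2)\<bar>)"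
    by (intro mult_left_mono abs_le_pi_sin assms) auto
  also have "\<dots> = pi * \<bar>dirichlet' n t * sin (t / 2)\<bar>" by (simp add: abs_mult)
  also have "\<dots> \<le> pi * real n" by (intro mult_left_mono sn) auto
  finally have "\<bar>dirichlet' n t\<bar> * \<bar>t\<bar> * real n \<le> pi * (real n * real n)"
    using mult_right_mono[of "\<bar>dirichlet' n t\<bar> * \<bar>t\<bar>" "pi * real n" "real n"] by (simp add: mult.assoc)
  from lorentz_bound[OF assms(1) abs_dirichlet'_le this]
  have "(dirichlet' n t)\<^sup>2 / real n \<le> kernel_const * (real n)\<^sup>2 * lorentz n t"
    using assms(1) by (simp add: power2_eq_square)
  then have "(dirichlet' n t)\<^sup>2 / real n / (real n)\<^sup>2 \<le> kernel_const * (real n)\<^sup>2 * lorentz n t / (real n)\<^sup>2"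
    by (intro divide_right_mono) auto
  then show ?thesis using assms(1) by (simp add: power2_eq_square power3_eq_cube mult.assoc)
qed

lemma dirichlet_product_le_lorentz:
  assumes "n \<ge> 1" "t \<in> {- pi..pi}"
  shows "\<bar>dirichlet n t * dirichlet' n t / (real n)\<^sup>2\<bar> \<le> kernel_const * lorentz n t"
proof -
  have n: "real n > 0" using assms by simp
  have "2 * \<bar>real n * dirichlet n t\<bar> * \<bar>dirichlet' n t\<bar> \<le> (real n * dirichlet n t)\<^sup>2 + (dirichlet' n t)\<^sup>2"
    using sum_squares_bound[of "\<bar>real n * dirichlet n t\<bar>" "\<bar>dirichlet' n t\<bar>"] by simp
  then have "2 * \<bar>real n * dirichlet n t\<bar> * \<bar>dirichlet' n t\<bar> / real n ^ 3 \<le> ((real n * dirichlet n t)\<^sup>2 + (dirichlet' n t)\<^sup>2) / real n ^ 3"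
    using n by (intro divide_right_mono) auto
  moreover have "2 * \<bar>real n * dirichlet n t\<bar> * \<bar>dirichlet' n t\<bar> / real n ^ 3 = 2 * \<bar>dirichlet n t * dirichlet' n t / (real n)\<^sup>2\<bar>"
    using n by (simp add: abs_mult power3_eq_cube power2_eq_square)
  moreover have "((real n * dirichlet n t)\<^sup>2 + (dirichlet' n t)\<^sup>2) / real n ^ 3 = (dirichlet n t)\<^sup>2 / real n + (dirichlet' n t)\<^sup>2 / real n ^ 3"
    using n by (simp add: add_divide_distrib power_mult_distrib power3_eq_cube power2_eq_square[of "real n"])
  ultimately show ?thesis
    using dirichlet_square_le_lorentz[OF assms] dirichlet'_square_le_lorentz[OF assms] by linarith
qed

lemma integrable_lorentz_const:
  "integrable lborel (\<lambda>s::real. inverse (1 + s\<^sup>2))"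
  using integrable_inverse_1_plus_square by (simp add: set_integrable_def)

lemma integral_circle_lorentz_le:
  assumes "n \<ge> 1"
  shows "integrable circle (lorentz n)" "(\<integral>t. lorentz n t \<partial>circle) \<le> pi"
proof -
  have L: "lorentz n t = real n * inverse (1 + (0 + real n * t)\<^sup>2)" for t by (simp add: lorentz_def divide_inverse)
  have int: "integrable lborel (lorentz n)"
    unfolding L[abs_def] using assms by (intro integrable_mult_right lborel_integrable_real_affine integrable_lorentz_const) auto
  show "integrable circle (lorentz n)"
    unfolding circle_def using integrable_mult_indicator[OF _ int, of "{- pi..pi}"]
    by (subst integrable_restrict_space) auto
  have "(\<integral>t. lorentz n t \<partial>circle) = (\<integral>t. indicator {- pi..pi} t *\<^sub>R lorentz n t \<partial>lborel)"
    unfolding circle_def by (subst integral_restrict_space) auto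
  also have "\<dots> \<le> (\<integral>t. lorentz n t \<partial>lborel)"
    using int by (intro integral_mono integrable_mult_indicator) (auto simp: indicator_def lorentz_nonneg)
  also have "\<dots> = (\<integral>s. inverse (1 + s\<^sup>2) \<partial>lborel)"
    using lborel_integral_real_affine[of "real n" "\<lambda>s. inverse (1 + s\<^sup>2)" 0] assms by (simp add: L)
  also have "\<dots> = pi"
    using LBINT_inverse_1_plus_square by (simp add: interval_lebesgue_integral_def set_lebesgue_integral_def)
  finally show "(\<integral>t. lorentz n t \<partial>circle) \<le> pi" .
qed

text \<open>The usual argument: near \<open>0\<close> continuity of \<open>g\<close> and the bounded mass of the majorant, away from
  \<open>0\<close> its decay like \<open>1 / n\<close>. The limit \<open>\<kappa>\<close> of the masses may have any value; it is \<open>0\<close> for the odd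
  kernel.\<close>
lemma approximate_identity:
  fixes k :: "nat \<Rightarrow> real \<Rightarrow> real" and g :: "real \<Rightarrow> real"
  assumes k [measurable]: "\<And>n. k n \<in> borel_measurable borel"
    and k_le: "\<And>n t. n \<ge> 1 \<Longrightarrow> t \<in> {- pi..pi} \<Longrightarrow> \<bar>k n t\<bar> \<le> K * lorentz n t"
    and mass: "(\<lambda>n. \<integral>t. k n t \<partial>circle) \<longlonglongrightarrow> \<kappa>"
    and g: "integrable circle g" and cont: "isCont g 0"
  shows "(\<lambda>n. \<integral>t. k n t * g t \<partial>circle) \<longlonglongrightarrow> \<kappa> * g 0"
proof -
  have K: "K \<ge> 0"
  proof -
    have "0 \<le> \<bar>k 1 0\<bar>" by simp
    also have "\<dots> \<le> K * lorentz 1 0" by (rule k_le) auto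
    finally show ?thesis by (simp add: lorentz_def)
  qed
  have intk: "integrable circle (k n)" if "n \<ge> 1" for n
    by (rule Bochner_Integration.integrable_bound[OF integrable_mult_right[OF integral_circle_lorentz_le(1)[OF that], of K]])
      (use k_le[OF that] in \<open>auto intro!: AE_I2 measurable_circle order_trans[OF _ abs_ge_self]\<close>)
  have k_bdd: "\<bar>k n t\<bar> \<le> K * real n" if "n \<ge> 1" "t \<in> {- pi..pi}" for n t
  proof -
    have "lorentz n t \<le> real n / 1" unfolding lorentz_def by (intro divide_left_mono) (auto simp: add_pos_nonneg)
    then show ?thesis using k_le[OF that] mult_left_mono[of "lorentz n t" "real n" K] K by simp
  qed
  have intkg: "integrable circle (\<lambda>t. k n t * g t)" if "n \<ge> 1" for n
    using integrable_circle_mult_bounded[OF g k k_bdd[OF that]] by simp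
  define d where "d n = (\<integral>t. k n t * (g t - g 0) \<partial>circle)" for n
  have gint: "integrable circle (\<lambda>t. \<bar>g t - g 0\<bar>)" using g by (intro integrable_abs Bochner_Integration.integrable_diff) auto
  have "d \<longlonglongrightarrow> 0"
  proof (rule LIMSEQ_I)
    fix r :: real assume r: "r > 0"
    define \<eta> where "\<eta> = r / (2 * (K * pi + 1))"
    have \<eta>: "\<eta> > 0" using r K unfolding \<eta>_def by (intro divide_pos_pos) (auto intro!: add_nonneg_pos mult_nonneg_nonneg)
    obtain \<delta> where \<delta>: "\<delta> > 0" "\<And>t. \<bar>t\<bar> < \<delta> \<Longrightarrow> \<bar>g t - g 0\<bar> < \<eta>"
      using cont \<eta> unfolding continuous_at_eps_delta by (auto simp: dist_real_def)
    define G where "G = (\<integral>t. \<bar>g t - g 0\<bar> \<partial>circle)"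
    have "(\<lambda>n. K / \<delta>\<^sup>2 * G * (1 / real n)) \<longlonglongrightarrow> K / \<delta>\<^sup>2 * G * 0"
      by (intro tendsto_intros lim_1_over_n)
    then have "\<forall>\<^sub>F n in sequentially. K / \<delta>\<^sup>2 * G * (1 / real n) < r / 2"
      using r by (intro order_tendstoD) auto
    then obtain N where N: "\<And>n. n \<ge> N \<Longrightarrow> K / \<delta>\<^sup>2 * G * (1 / real n) < r / 2"
      by (auto simp: eventually_sequentially)
    have "norm (d n - 0) < r" if n: "n \<ge> max N 1" for n
    proof -
      have n1: "n \<ge> 1" using n by simp
      have pt: "\<bar>k n t * (g t - g 0)\<bar> \<le> \<eta> * (K * lorentz n t) + K / \<delta>\<^sup>2 * (1 / real n) * \<bar>g t - g 0\<bar>" if t: "t \<in> {- pi..pi}" for t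
      proof (cases "\<bar>t\<bar> < \<delta>")
        case True
        have "\<bar>k n t * (g t - g 0)\<bar> \<le> (K * lorentz n t) * \<eta>"
          unfolding abs_mult using k_le[OF n1 t] \<delta>(2)[OF True] by (intro mult_mono) auto
        moreover have "0 \<le> K / \<delta>\<^sup>2 * (1 / real n) * \<bar>g t - g 0\<bar>" using K by simp
        ultimately show ?thesis by (simp add: mult.commute)
      next
        case False
        then have t0: "t \<noteq> 0" "\<delta>\<^sup>2 \<le> t\<^sup>2" using \<delta>(1) by (auto simp: abs_le_square_iff[symmetric])
        have "lorentz n t \<le> 1 / (real n * t\<^sup>2)" by (rule lorentz_tail) fact+
        also have "\<dots> \<le> 1 / (real n * \<delta>\<^sup>2)" using n1 t0 \<delta>(1) by (intro divide_left_mono mult_left_mono) auto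
        finally have "\<bar>k n t\<bar> \<le> K * (1 / (real n * \<delta>\<^sup>2))"
          using k_le[OF n1 t] K by (meson mult_left_mono order_trans)
        then have "\<bar>k n t * (g t - g 0)\<bar> \<le> K * (1 / (real n * \<delta>\<^sup>2)) * \<bar>g t - g 0\<bar>"
          unfolding abs_mult by (intro mult_right_mono) auto
        moreover have "0 \<le> \<eta> * (K * lorentz n t)" using \<eta> K lorentz_nonneg by simp
        ultimately show ?thesis by (simp add: field_simps)
      qed
      have "\<bar>d n\<bar> \<le> (\<integral>t. \<bar>k n t * (g t - g 0)\<bar> \<partial>circle)" unfolding d_def by (rule integral_abs_bound)
      also have "\<dots> \<le> (\<integral>t. \<eta> * (K * lorentz n t) + K / \<delta>\<^sup>2 * (1 / real n) * \<bar>g t - g 0\<bar> \<partial>circle)"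
        using pt integrable_circle_mult_bounded[OF _ k k_bdd[OF n1], of "\<lambda>t. g t - g 0"] g integral_circle_lorentz_le(1)[OF n1]
        by (intro integral_mono) (auto intro!: integrable_abs)
      also have "\<dots> = \<eta> * (K * (\<integral>t. lorentz n t \<partial>circle)) + K / \<delta>\<^sup>2 * (1 / real n) * G"
        unfolding G_def using integral_circle_lorentz_le(1)[OF n1] gint by simp
      also have "\<dots> \<le> \<eta> * (K * pi) + K / \<delta>\<^sup>2 * (1 / real n) * G"
        using \<eta> K integral_circle_lorentz_le(2)[OF n1] by (intro add_right_mono mult_left_mono) auto
      also have "\<eta> * (K * pi) \<le> r / 2"
      proof -
        have "K * pi / (K * pi + 1) \<le> 1" using K by (simp add: divide_le_eq_1 add_nonneg_pos)
        then have "r / 2 * (K * pi / (K * pi + 1)) \<le> r / 2 * 1" using r by (intro mult_left_mono) auto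
        then show ?thesis unfolding \<eta>_def by simp
      qed
      also have "K / \<delta>\<^sup>2 * (1 / real n) * G < r / 2" using N[of n] n by (simp add: mult_ac)
      finally show ?thesis by simp
    qed
    then show "\<exists>no. \<forall>n\<ge>no. norm (d n - 0) < r" by blast
  qed
  moreover have "\<forall>\<^sub>F n in sequentially. d n + (\<integral>t. k n t \<partial>circle) * g 0 = (\<integral>t. k n t * g t \<partial>circle)"
    using eventually_ge_at_top[of 1]
  proof eventually_elim
    case (elim n)
    have "d n = (\<integral>t. k n t * g t - k n t * g 0 \<partial>circle)" by (simp add: d_def right_diff_distrib)
    also have "\<dots> = (\<integral>t. k n t * g t \<partial>circle) - (\<integral>t. k n t \<partial>circle) * g 0"
      using intkg[OF elim] intk[OF elim] by simp
    finally show ?case by simp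
  qed
  moreover have "(\<lambda>n. d n + (\<integral>t. k n t \<partial>circle) * g 0) \<longlonglongrightarrow> 0 + \<kappa> * g 0"
    by (intro tendsto_add tendsto_mult_right mass \<open>d \<longlonglongrightarrow> 0\<close>)
  ultimately show ?thesis
    by (auto intro: Lim_transform_eventually)
qed

section \<open>Pointwise limits of the zero density\<close>

locale circle_density =
  fixes \<psi> :: "real \<Rightarrow> real"
  assumes \<psi>_measurable [measurable]: "\<psi> \<in> borel_measurable borel"
    and \<psi>_nonneg: "\<And>x. 0 \<le> \<psi> x"
    and \<psi>_periodic: "\<And>x. \<psi> (x + 2 * pi) = \<psi> x"
    and \<psi>_integrable: "integrable circle \<psi>"
    and \<psi>_integral: "(\<integral>t. \<psi> t \<partial>circle) = 1"
begin

lemma \<psi>_shift: "integrable circle (\<lambda>t. \<psi> (x - t))" "(\<integral>t. \<psi> (x - t) \<partial>circle) = 1"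
  using integral_circle_shift[of \<psi> x, OF \<psi>_measurable \<psi>_periodic \<psi>_integrable] \<psi>_integral by auto

lemma integrable_mult_\<psi>:
  assumes "continuous_on UNIV g"
  shows "integrable circle (\<lambda>t. g t * \<psi> (x - t))"
  by (rule integrable_circle_mult_continuous[OF \<psi>_shift(1) assms])

text \<open>With \<open>s\<close> the centred Dirichlet kernel, \<open>mass\<close>, \<open>mass'\<close> and \<open>cross\<close> are the integrals of
  \<open>s\<^sup>2\<close>, \<open>s'\<^sup>2\<close> and \<open>s s'\<close> against \<open>\<psi>(x - t)\<close>. In terms of the covariances of \<open>f\<^sub>n(x)\<close> and \<open>f\<^sub>n'(x)\<close>
  they are \<open>n A\<close>, \<open>n C - ((n + 1) / 2)\<^sup>2 n A\<close> and \<open>n B\<close>, so \<open>intensity\<close> is the Kac--Rice density.\<close>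
definition mass where "mass n x = (\<integral>t. (dirichlet n t)\<^sup>2 * \<psi> (x - t) \<partial>circle)"
definition mass' where "mass' n x = (\<integral>t. (dirichlet' n t)\<^sup>2 * \<psi> (x - t) \<partial>circle)"
definition cross where "cross n x = (\<integral>t. dirichlet n t * dirichlet' n t * \<psi> (x - t) \<partial>circle)"

definition intensity where
  "intensity n x = sqrt ((mid n)\<^sup>2 + mass' n x / mass n x - (cross n x / mass n x)\<^sup>2) / pi"

lemma continuous_dirichlet [continuous_intros]:
  "continuous_on S (dirichlet n)" "continuous_on S (dirichlet' n)"
  unfolding dirichlet_def[abs_def] dirichlet'_def[abs_def] by (intro continuous_intros)+

text \<open>Because \<open>s\<^sup>2 \<ge> s\<^sup>2 sin\<^sup>2 (t / 2) = sin\<^sup>2 (n t / 2)\<close>.\<close>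
lemma mass_ge: "1 / 2 - (\<integral>t. cos (real n * t) * \<psi> (x - t) \<partial>circle) / 2 \<le> mass n x"
proof -
  have "1 / 2 - (\<integral>t. cos (real n * t) * \<psi> (x - t) \<partial>circle) / 2 = (\<integral>t. (\<psi> (x - t) - cos (real n * t) * \<psi> (x - t)) / 2 \<partial>circle)"
    by (subst integral_divide_zero, subst Bochner_Integration.integral_diff)
      (auto intro!: \<psi>_shift integrable_mult_\<psi> continuous_intros simp: \<psi>_shift diff_divide_distrib)
  also have "\<dots> \<le> mass n x"
    unfolding mass_def
  proof (rule integral_mono)
    show "integrable circle (\<lambda>t. (\<psi> (x - t) - cos (real n * t) * \<psi> (x - t)) / 2)"
      by (intro integrable_divide_zero Bochner_Integration.integrable_diff \<psi>_shift integrable_mult_\<psi> continuous_intros)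
    show "integrable circle (\<lambda>t. (dirichlet n t)\<^sup>2 * \<psi> (x - t))"
      by (intro integrable_mult_\<psi> continuous_intros)
    fix t
    have "(1 - cos (real n * t)) / 2 = (sin (real n * t / 2))\<^sup>2"
      using cos_double_sin[of "real n * t / 2"] by simp
    also have "\<dots> = (dirichlet n t)\<^sup>2 * (sin (t / 2))\<^sup>2"
      by (simp add: dirichlet_times_sin[symmetric] power_mult_distrib)
    also have "\<dots> \<le> (dirichlet n t)\<^sup>2"
      by (intro mult_left_le) (auto simp: abs_square_le_1)
    finally have "(1 - cos (real n * t)) / 2 * \<psi> (x - t) \<le> (dirichlet n t)\<^sup>2 * \<psi> (x - t)"
      by (intro mult_right_mono \<psi>_nonneg)
    then show "(\<psi> (x - t) - cos (real n * t) * \<psi> (x - t)) / 2 \<le> (dirichlet n t)\<^sup>2 * \<psi> (x - t)"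
      by (simp add: algebra_simps diff_divide_distrib)
  qed
  finally show ?thesis .
qed

lemma fourier_coefficient_shift:
  "(\<integral>t. cos (real n * t) * \<psi> (x - t) \<partial>circle)
     = cos (real n * x) * (\<integral>t. \<psi> t * cos (real n * t) \<partial>circle) + sin (real n * x) * (\<integral>t. \<psi> t * sin (real n * t) \<partial>circle)"
proof -
  have int: "integrable circle (\<lambda>t. g t * \<psi> t)" if "g \<in> borel_measurable borel" "\<And>t. \<bar>g t\<bar> \<le> 1" for g
    using integrable_circle_mult_bounded[OF \<psi>_integrable that(1)] that(2) by blast
  define g where "g u = cos (real n * (x - u)) * \<psi> u" for u
  have per: "g (u + 2 * pi) = g u" for u
  proof -
    have "real n * (x - (u + 2 * pi)) = real n * (x - u) - 2 * pi * of_nat n" by (simp add: algebra_simps)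
    then have "cos (real n * (x - (u + 2 * pi))) = cos (real n * (x - u))"
      using cos_2npi[of n] sin_2npi[of n] by (simp add: cos_diff mult_ac)
    then show ?thesis by (simp add: g_def \<psi>_periodic)
  qed
  have [measurable]: "g \<in> borel_measurable borel" unfolding g_def[abs_def] by measurable
  have "integrable circle g" unfolding g_def by (rule int) auto
  from integral_circle_shift(2)[of g x, OF _ per this]
  have "(\<integral>t. cos (real n * t) * \<psi> (x - t) \<partial>circle) = (\<integral>t. cos (real n * (x - t)) * \<psi> t \<partial>circle)" by (simp add: g_def)
  also have "\<dots> = (\<integral>t. cos (real n * x) * (cos (real n * t) * \<psi> t) + sin (real n * x) * (sin (real n * t) * \<psi> t) \<partial>circle)"
    by (intro Bochner_Integration.integral_cong) (auto simp: right_diff_distrib cos_diff distrib_left distrib_right mult_ac)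
  also have "\<dots> = cos (real n * x) * (\<integral>t. cos (real n * t) * \<psi> t \<partial>circle) + sin (real n * x) * (\<integral>t. sin (real n * t) * \<psi> t \<partial>circle)"
    by (subst Bochner_Integration.integral_add) (auto intro!: int integrable_mult_right)
  finally show ?thesis by (simp add: mult.commute)
qed

text \<open>The bound is uniform in \<open>x\<close>, since a translation only rotates the \<open>n\<close>-th Fourier coefficient
  of \<open>\<psi>\<close>.\<close>
lemma mass_bounded_below: "\<forall>\<^sub>F n in sequentially. \<forall>x. 1 / 3 \<le> mass n x"
proof -
  have "(\<lambda>n. \<bar>\<integral>t. \<psi> t * cos (real n * t) \<partial>circle\<bar> + \<bar>\<integral>t. \<psi> t * sin (real n * t) \<partial>circle\<bar>) \<longlonglongrightarrow> \<bar>0\<bar> + \<bar>0\<bar>"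
    by (intro tendsto_intros riemann_lebesgue \<psi>_integrable)
  then have "\<forall>\<^sub>F n in sequentially. \<bar>\<integral>t. \<psi> t * cos (real n * t) \<partial>circle\<bar> + \<bar>\<integral>t. \<psi> t * sin (real n * t) \<partial>circle\<bar> < 1 / 3"
    by (intro order_tendstoD) auto
  then show ?thesis
  proof eventually_elim
    case (elim n)
    show ?case
    proof
      fix x
      have arith: "1 / 3 \<le> m" if "p \<le> a" "q \<le> b" "a + b < 1 / 3" "1 / 2 - (p + q) / 2 \<le> m" for p q a b m :: real
      proof -
        have "p + q < 1 / 3" using that by linarith
        then have "(p + q) / 2 < 1 / 6" by simp
        then show ?thesis using that(4) by linarith
      qed
      have "cos (real n * x) * (\<integral>t. \<psi> t * cos (real n * t) \<partial>circle) \<le> \<bar>\<integral>t. \<psi> t * cos (real n * t) \<partial>circle\<bar>"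
        by (rule order_trans[OF abs_ge_self]) (simp add: abs_mult mult_left_le_one_le)
      moreover have "sin (real n * x) * (\<integral>t. \<psi> t * sin (real n * t) \<partial>circle) \<le> \<bar>\<integral>t. \<psi> t * sin (real n * t) \<partial>circle\<bar>"
        by (rule order_trans[OF abs_ge_self]) (simp add: abs_mult mult_left_le_one_le)
      ultimately show "1 / 3 \<le> mass n x"
        using elim mass_ge[of n x] arith unfolding fourier_coefficient_shift by blast
    qed
  qed
qed

lemma mass'_nonneg: "0 \<le> mass' n x"
  unfolding mass'_def by (auto intro!: integral_nonneg_AE AE_I2 mult_nonneg_nonneg \<psi>_nonneg)

lemma intensity_limitI:
  assumes r: "(\<lambda>n. mass' n x / (real n)\<^sup>2 / mass n x) \<longlonglongrightarrow> r" and q: "(\<lambda>n. cross n x / real n / mass n x) \<longlonglongrightarrow> 0"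
  shows "(\<lambda>n. intensity n x / real n) \<longlonglongrightarrow> sqrt (1 / 4 + r) / pi"
proof -
  have "(\<lambda>n. (1 + 1 / real n) / 2) \<longlonglongrightarrow> (1 + 0) / 2"
    by (intro tendsto_intros lim_1_over_n) auto
  then have "(\<lambda>n. sqrt (((1 + 1 / real n) / 2)\<^sup>2 + mass' n x / (real n)\<^sup>2 / mass n x - (cross n x / real n / mass n x)\<^sup>2) / pi)
     \<longlonglongrightarrow> sqrt (((1 + 0) / 2)\<^sup>2 + r - 0\<^sup>2) / pi"
    using r q by (intro tendsto_intros) auto
  moreover have "\<forall>\<^sub>F n in sequentially. sqrt (((1 + 1 / real n) / 2)\<^sup>2 + mass' n x / (real n)\<^sup>2 / mass n x - (cross n x / real n / mass n x)\<^sup>2) / pi = intensity n x / real n"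
    using eventually_ge_at_top[of 1]
  proof eventually_elim
    case (elim n)
    have "((1 + 1 / real n) / 2)\<^sup>2 = (mid n)\<^sup>2 / (real n)\<^sup>2"
      using elim by (simp add: mid_def power_divide[symmetric] add_divide_distrib)
    then have "((1 + 1 / real n) / 2)\<^sup>2 + mass' n x / (real n)\<^sup>2 / mass n x - (cross n x / real n / mass n x)\<^sup>2
        = ((mid n)\<^sup>2 + mass' n x / mass n x - (cross n x / mass n x)\<^sup>2) / (real n)\<^sup>2"
      by (simp add: add_divide_distrib diff_divide_distrib power_divide power_mult_distrib mult.commute)
    then show ?case by (simp add: intensity_def real_sqrt_divide)
  qed
  ultimately show ?thesis by (auto intro: Lim_transform_eventually simp: power2_eq_square)
qed

text \<open>The kernels \<open>s\<^sup>2 / n\<close>, \<open>s'\<^sup>2 / n\<^sup>3\<close> and \<open>s s' / n\<^sup>2\<close> have masses tending to \<open>2 \<pi>\<close>, \<open>2 \<pi> / 12\<close> and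
  \<open>0\<close>, so \<open>\<psi>(x)\<close> cancels and \<open>1 / 4 + 1 / 12 = 1 / 3\<close> remains under the root.\<close>
lemma intensity_limit_positive:
  assumes "\<psi> x > 0" "isCont \<psi> x"
  shows "(\<lambda>n. intensity n x / real n) \<longlonglongrightarrow> 1 / (pi * sqrt 3)"
proof -
  have cont: "isCont (\<lambda>t. \<psi> (x - t)) 0"
    by (rule isCont_o2[where f="\<lambda>t. x - t"]) (use assms in \<open>auto intro!: continuous_intros\<close>)
  have ev: "\<forall>\<^sub>F n::nat in sequentially. n \<ge> 1" by (rule eventually_ge_at_top)
  have "(\<lambda>n. \<integral>t. (dirichlet n t)\<^sup>2 / real n \<partial>circle) \<longlonglongrightarrow> 2 * pi"
    by (rule tendsto_eventually, rule eventually_mono[OF ev]) (simp add: integral_dirichlet_square)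
  from approximate_identity[OF _ _ this \<psi>_shift(1) cont, of kernel_const]
  have "(\<lambda>n. \<integral>t. (dirichlet n t)\<^sup>2 / real n * \<psi> (x - t) \<partial>circle) \<longlonglongrightarrow> 2 * pi * \<psi> (x - 0)"
    using dirichlet_square_le_lorentz by simp
  then have A: "(\<lambda>n. mass n x / real n) \<longlonglongrightarrow> 2 * pi * \<psi> x" by (simp add: mass_def)
  have "(\<lambda>n. 2 * pi / 12 * (1 - 1 / (real n)\<^sup>2)) \<longlonglongrightarrow> 2 * pi / 12 * (1 - 0)"
    by (intro tendsto_intros tendsto_divide_0[OF tendsto_const] filterlim_at_top_imp_at_infinity
        filterlim_pow_at_top filterlim_real_sequentially) auto
  moreover have "\<forall>\<^sub>F n in sequentially. 2 * pi / 12 * (1 - 1 / (real n)\<^sup>2) = (\<integral>t. (dirichlet' n t)\<^sup>2 / real n ^ 3 \<partial>circle)"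
    using ev
  proof eventually_elim
    case (elim n)
    have "(\<integral>t. (dirichlet' n t)\<^sup>2 / real n ^ 3 \<partial>circle) = 2 * pi * (real n * ((real n)\<^sup>2 - 1) / 12) / real n ^ 3"
      by (simp add: integral_dirichlet'_square)
    also have "\<dots> = 2 * pi / 12 * (((real n)\<^sup>2 - 1) / (real n)\<^sup>2)"
      using elim by (simp add: power3_eq_cube power2_eq_square)
    also have "((real n)\<^sup>2 - 1) / (real n)\<^sup>2 = 1 - 1 / (real n)\<^sup>2"
      using elim by (simp add: diff_divide_distrib)
    finally show ?case by simp
  qed
  ultimately have "(\<lambda>n. \<integral>t. (dirichlet' n t)\<^sup>2 / real n ^ 3 \<partial>circle) \<longlonglongrightarrow> 2 * pi / 12"
    by (auto intro: Lim_transform_eventually)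
  from approximate_identity[OF _ _ this \<psi>_shift(1) cont, of kernel_const]
  have "(\<lambda>n. \<integral>t. (dirichlet' n t)\<^sup>2 / real n ^ 3 * \<psi> (x - t) \<partial>circle) \<longlonglongrightarrow> 2 * pi / 12 * \<psi> (x - 0)"
    using dirichlet'_square_le_lorentz by simp
  then have D: "(\<lambda>n. mass' n x / real n ^ 3) \<longlonglongrightarrow> 2 * pi / 12 * \<psi> x" by (simp add: mass'_def)
  have z: "(\<integral>t. dirichlet n t * dirichlet' n t / (real n)\<^sup>2 \<partial>circle) = 0" for n
    by (rule integral_circle_odd) (simp add: dirichlet_even dirichlet'_odd)
  have "(\<lambda>n. \<integral>t. dirichlet n t * dirichlet' n t / (real n)\<^sup>2 \<partial>circle) \<longlonglongrightarrow> 0"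
    unfolding z by (rule tendsto_const)
  from approximate_identity[OF _ _ this \<psi>_shift(1) cont, of kernel_const]
  have "(\<lambda>n. \<integral>t. dirichlet n t * dirichlet' n t / (real n)\<^sup>2 * \<psi> (x - t) \<partial>circle) \<longlonglongrightarrow> 0 * \<psi> (x - 0)"
    using dirichlet_product_le_lorentz by simp
  then have B: "(\<lambda>n. cross n x / (real n)\<^sup>2) \<longlonglongrightarrow> 0" by (simp add: cross_def)
  have nz: "2 * pi * \<psi> x \<noteq> 0" using assms by simp
  have "(\<lambda>n. (mass' n x / real n ^ 3) / (mass n x / real n)) \<longlonglongrightarrow> (2 * pi / 12 * \<psi> x) / (2 * pi * \<psi> x)"
    by (rule tendsto_divide[OF D A nz])
  moreover have "\<forall>\<^sub>F n in sequentially. (mass' n x / real n ^ 3) / (mass n x / real n) = mass' n x / (real n)\<^sup>2 / mass n x"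
    using ev by eventually_elim (simp add: power3_eq_cube power2_eq_square)
  ultimately have r: "(\<lambda>n. mass' n x / (real n)\<^sup>2 / mass n x) \<longlonglongrightarrow> (2 * pi / 12 * \<psi> x) / (2 * pi * \<psi> x)"
    by (rule Lim_transform_eventually)
  have "(\<lambda>n. (cross n x / (real n)\<^sup>2) / (mass n x / real n)) \<longlonglongrightarrow> 0 / (2 * pi * \<psi> x)"
    by (rule tendsto_divide[OF B A nz])
  moreover have "\<forall>\<^sub>F n in sequentially. (cross n x / (real n)\<^sup>2) / (mass n x / real n) = cross n x / real n / mass n x"
    using ev by eventually_elim (simp add: power2_eq_square)
  ultimately have q: "(\<lambda>n. cross n x / real n / mass n x) \<longlonglongrightarrow> 0"
    by (auto intro: Lim_transform_eventually)
  have e: "(2 * pi / 12 * \<psi> x) / (2 * pi * \<psi> x) = 1 / 12" using assms by simp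
  have "sqrt (1 / 4 + (2 * pi / 12 * \<psi> x) / (2 * pi * \<psi> x)) / pi = 1 / (pi * sqrt 3)"
    unfolding e by (simp add: real_sqrt_divide)
  then show ?thesis using intensity_limitI[OF r q] by simp
qed

lemma dirichlet_over_n_tendsto_0:
  assumes "t \<in> {- pi..pi}" "t \<noteq> 0"
  shows "(\<lambda>n. dirichlet n t / real n) \<longlonglongrightarrow> 0"
proof (rule Lim_null_comparison)
  have s: "sin (t / 2) \<noteq> 0" by (rule sin_half_nonzero) fact+
  have "\<bar>dirichlet n t / real n\<bar> \<le> 1 / \<bar>sin (t / 2)\<bar> * (1 / real n)" for n
  proof -
    have "\<bar>dirichlet n t\<bar> * \<bar>sin (t / 2)\<bar> \<le> 1" by (simp add: abs_mult[symmetric] dirichlet_times_sin)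
    then have "\<bar>dirichlet n t\<bar> \<le> 1 / \<bar>sin (t / 2)\<bar>" using s by (simp add: field_simps)
    then show ?thesis using mult_right_mono[of "\<bar>dirichlet n t\<bar>" "1 / \<bar>sin (t / 2)\<bar>" "1 / real n"] by simp
  qed
  then show "\<forall>\<^sub>F n in sequentially. norm (dirichlet n t / real n) \<le> 1 / \<bar>sin (t / 2)\<bar> * (1 / real n)" by simp
  have "(\<lambda>n. 1 / \<bar>sin (t / 2)\<bar> * (1 / real n)) \<longlonglongrightarrow> 1 / \<bar>sin (t / 2)\<bar> * 0"
    by (intro tendsto_intros lim_1_over_n)
  then show "(\<lambda>n. 1 / \<bar>sin (t / 2)\<bar> * (1 / real n)) \<longlonglongrightarrow> 0" by simp
qed

text \<open>Put \<open>w(t) = \<psi>(x - t) / sin\<^sup>2 (t / 2)\<close>, which is integrable. Then \<open>mass\<close> is the integral of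
  \<open>sin\<^sup>2 (n t / 2) w\<close>, and \<open>s' sin (t / 2) / n = cos (n t / 2) / 2 - \<rho>\<^sub>n(t)\<close> with a bounded remainder
  \<open>\<rho>\<^sub>n\<close> that tends to \<open>0\<close> pointwise off \<open>0\<close>. By dominated convergence and the Riemann--Lebesgue lemma
  \<open>mass\<close>, \<open>mass' / n\<^sup>2\<close> and \<open>cross / n\<close> tend to \<open>W / 2\<close>, \<open>W / 8\<close> and \<open>0\<close>, where \<open>W = \<integral> w\<close>.\<close>
lemma intensity_limit_zero:
  assumes int: "integrable circle (\<lambda>t. \<psi> (x - t) / t\<^sup>2)"
  shows "(\<lambda>n. intensity n x / real n) \<longlonglongrightarrow> 1 / (pi * sqrt 2)"
proof -
  define w where "w t = \<psi> (x - t) / (sin (t / 2))\<^sup>2" for t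
  have [measurable]: "w \<in> borel_measurable borel" unfolding w_def[abs_def] by measurable
  have w0: "0 \<le> w t" for t unfolding w_def by (simp add: \<psi>_nonneg)
  have wle: "w t \<le> pi\<^sup>2 * (\<psi> (x - t) / t\<^sup>2)" if t: "t \<in> {- pi..pi}" "t \<noteq> 0" for t
  proof -
    have "t\<^sup>2 \<le> (pi * sin (t / 2))\<^sup>2"
      using abs_le_pi_sin[OF t(1)] by (simp add: abs_le_square_iff[symmetric] abs_mult)
    then have "t\<^sup>2 \<le> pi\<^sup>2 * (sin (t / 2))\<^sup>2" by (simp add: power_mult_distrib)
    then have "\<psi> (x - t) * t\<^sup>2 \<le> \<psi> (x - t) * (pi\<^sup>2 * (sin (t / 2))\<^sup>2)" by (intro mult_left_mono \<psi>_nonneg)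
    then show ?thesis using t sin_half_nonzero[OF t] by (simp add: w_def field_simps)
  qed
  have w: "integrable circle w"
  proof (rule Bochner_Integration.integrable_bound[OF integrable_mult_right[OF int, of "pi\<^sup>2"]])
    show "AE t in circle. norm (w t) \<le> norm (pi\<^sup>2 * (\<psi> (x - t) / t\<^sup>2))"
      using AE_circle_nonzero AE_space
    proof eventually_elim
      case (elim t)
      then show ?case using wle[of t] w0[of t] \<psi>_nonneg[of "x - t"] by simp
    qed
  qed (auto intro!: measurable_circle)
  define W where "W = (\<integral>t. w t \<partial>circle)"
  have "1 \<le> W"
  proof -
    have "(\<integral>t. \<psi> (x - t) \<partial>circle) \<le> W" unfolding W_def
    proof (rule integral_mono_AE[OF \<psi>_shift(1) w])
      show "AE t in circle. \<psi> (x - t) \<le> w t"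
        using AE_circle_nonzero AE_space
      proof eventually_elim
        case (elim t)
        then have s: "sin (t / 2) \<noteq> 0" by (intro sin_half_nonzero) auto
        have "(sin (t / 2))\<^sup>2 \<le> 1" by (simp add: abs_square_le_1)
        then have "\<psi> (x - t) * (sin (t / 2))\<^sup>2 \<le> \<psi> (x - t)" using \<psi>_nonneg by (intro mult_left_le)
        then show ?case using s by (simp add: w_def field_simps)
      qed
    qed
    then show ?thesis by (simp add: \<psi>_shift)
  qed
  have intw: "integrable circle (\<lambda>t. g t * w t)" if "g \<in> borel_measurable borel" "\<And>t. t \<in> {- pi..pi} \<Longrightarrow> \<bar>g t\<bar> \<le> C" for g C
    by (rule integrable_circle_mult_bounded[OF w that])
  have wc: "(\<lambda>n. \<integral>t. w t * cos (real n * t) \<partial>circle) \<longlonglongrightarrow> 0" and ws: "(\<lambda>n. \<integral>t. w t * sin (real n * t) \<partial>circle) \<longlonglongrightarrow> 0"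
    by (intro riemann_lebesgue w)+
  have icos: "integrable circle (\<lambda>t. w t * cos (real n * t))" and isin: "integrable circle (\<lambda>t. w t * sin (real n * t))" for n
    using intw[of "\<lambda>t. cos (real n * t)" 1] intw[of "\<lambda>t. sin (real n * t)" 1] by (simp_all add: mult.commute)
  have cdbl: "(sin (real n * t / 2))\<^sup>2 = (1 - cos (real n * t)) / 2" "(cos (real n * t / 2))\<^sup>2 = (1 + cos (real n * t)) / 2"
    "sin (real n * t / 2) * cos (real n * t / 2) = sin (real n * t) / 2" for n t
    using cos_double_sin[of "real n * t / 2"] cos_double_cos[of "real n * t / 2"] sin_double[of "real n * t / 2"] by simp_all
  have "mass n x = W / 2 - (\<integral>t. w t * cos (real n * t) \<partial>circle) / 2" for n
  proof -
    have "mass n x = (\<integral>t. (w t - w t * cos (real n * t)) / 2 \<partial>circle)"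
      unfolding mass_def
    proof (rule integral_cong_AE)
      show "AE t in circle. (dirichlet n t)\<^sup>2 * \<psi> (x - t) = (w t - w t * cos (real n * t)) / 2"
        using AE_circle_nonzero AE_space
      proof eventually_elim
        case (elim t)
        then have s: "sin (t / 2) \<noteq> 0" by (intro sin_half_nonzero) auto
        have "(dirichlet n t)\<^sup>2 * \<psi> (x - t) = (dirichlet n t * sin (t / 2))\<^sup>2 * w t"
          using s by (simp add: w_def power_mult_distrib)
        then show ?case unfolding dirichlet_times_sin cdbl by (simp add: algebra_simps diff_divide_distrib)
      qed
    qed (auto intro!: measurable_circle)
    then show ?thesis using w icos by (simp add: W_def diff_divide_distrib)
  qed
  then have "(\<lambda>n. mass n x) \<longlonglongrightarrow> W / 2 - 0 / 2"
    using tendsto_diff[OF tendsto_const tendsto_divide[OF wc tendsto_const[of 2]], of "W / 2"] by simp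
  then have A: "(\<lambda>n. mass n x) \<longlonglongrightarrow> W / 2" by simp
  define \<rho> where "\<rho> n t = dirichlet n t / real n * cos (t / 2) / 2" for n t
  have \<rho>_meas [measurable]: "\<rho> n \<in> borel_measurable borel" for n unfolding \<rho>_def[abs_def] by measurable
  have \<rho>_le: "\<bar>\<rho> n t\<bar> \<le> 1 / 2" for n t
  proof -
    have "\<bar>dirichlet n t / real n\<bar> \<le> 1"
      using abs_dirichlet_le[of n t] by (cases "n = 0") (simp_all add: divide_le_eq_1)
    then have "\<bar>dirichlet n t / real n\<bar> * \<bar>cos (t / 2)\<bar> \<le> 1" by (intro mult_le_one) auto
    then show ?thesis by (simp add: \<rho>_def abs_mult)
  qed
  have \<rho>_lim: "(\<lambda>n. \<rho> n t) \<longlonglongrightarrow> 0" if "t \<in> {- pi..pi}" "t \<noteq> 0" for t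
    using tendsto_mult_right[OF dirichlet_over_n_tendsto_0[OF that], of "cos (t / 2) / 2"] by (simp add: \<rho>_def)
  have d': "dirichlet' n t / real n * sin (t / 2) = cos (real n * t / 2) / 2 - \<rho> n t" if "n \<ge> 1" for n t
    using that dirichlet'_times_sin[of n t] by (simp add: \<rho>_def diff_divide_distrib)
  have small: "(\<lambda>n. \<integral>t. e n t * \<rho> n t * w t \<partial>circle) \<longlonglongrightarrow> 0"
    if e [measurable]: "\<And>n. e n \<in> borel_measurable borel" and e_le: "\<And>n t. \<bar>e n t\<bar> \<le> 2" for e :: "nat \<Rightarrow> real \<Rightarrow> real"
  proof -
    have "(\<lambda>n. \<integral>t. e n t * \<rho> n t * w t \<partial>circle) \<longlonglongrightarrow> (\<integral>t. 0 \<partial>circle)"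
    proof (rule integral_dominated_convergence[OF _ _ w])
      show "AE t in circle. (\<lambda>n. e n t * \<rho> n t * w t) \<longlonglongrightarrow> 0"
        using AE_circle_nonzero AE_space
      proof eventually_elim
        case (elim t)
        have "(\<lambda>n. e n t * \<rho> n t) \<longlonglongrightarrow> 0"
        proof (rule Lim_null_comparison)
          show "\<forall>\<^sub>F n in sequentially. norm (e n t * \<rho> n t) \<le> 2 * \<bar>\<rho> n t\<bar>"
            by (auto simp: abs_mult intro!: always_eventually mult_right_mono e_le)
          show "(\<lambda>n. 2 * \<bar>\<rho> n t\<bar>) \<longlonglongrightarrow> 0"
            using tendsto_mult_left[OF tendsto_rabs_zero[OF \<rho>_lim[of t]], of 2] elim by simp
        qed
        then show ?case using tendsto_mult_right[of "\<lambda>n. e n t * \<rho> n t" 0 sequentially "w t"] by simp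
      qed
      show "AE t in circle. norm (e n t * \<rho> n t * w t) \<le> w t" for n
      proof (rule AE_I2)
        fix t
        have "\<bar>e n t\<bar> * \<bar>\<rho> n t\<bar> \<le> 2 * (1 / 2)" by (intro mult_mono e_le \<rho>_le) auto
        then show "norm (e n t * \<rho> n t * w t) \<le> w t" using w0[of t] by (simp add: abs_mult mult_left_le_one_le)
      qed
    qed (auto intro!: measurable_circle)
    then show ?thesis by simp
  qed
  have ie\<rho>: "integrable circle (\<lambda>t. e t * \<rho> n t * w t)"
    if "e \<in> borel_measurable borel" "\<And>t. \<bar>e t\<bar> \<le> 2" for e n
  proof (rule intw)
    show "\<bar>e t * \<rho> n t\<bar> \<le> 2 * (1 / 2)" for t unfolding abs_mult by (intro mult_mono that \<rho>_le) auto
  qed (use that in measurable)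
  \<comment> \<open>\<open>(c / 2 - \<rho>)\<^sup>2 = c\<^sup>2 / 4 + (\<rho> - c) \<rho>\<close> with \<open>c = cos (n t / 2)\<close>, and \<open>e1\<close> is the factor of \<open>\<rho>\<close>.\<close>
  define e1 where "e1 n t = \<rho> n t - cos (real n * t / 2)" for n t
  have e1: "e1 n \<in> borel_measurable borel" "\<bar>e1 n t\<bar> \<le> 2" for n t
    unfolding e1_def[abs_def] using \<rho>_le[of n t] abs_cos_le_one[of "real n * t / 2"] by (measurable, linarith)
  have D': "mass' n x / (real n)\<^sup>2 = (W / 8 + (\<integral>t. w t * cos (real n * t) \<partial>circle) / 8) + (\<integral>t. e1 n t * \<rho> n t * w t \<partial>circle)"
    if n: "n \<ge> 1" for n
  proof -
    have "mass' n x / (real n)\<^sup>2 = (\<integral>t. (dirichlet' n t)\<^sup>2 * \<psi> (x - t) / (real n)\<^sup>2 \<partial>circle)"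
      unfolding mass'_def by simp
    also have "\<dots> = (\<integral>t. (w t / 8 + w t * cos (real n * t) / 8) + e1 n t * \<rho> n t * w t \<partial>circle)"
    proof (rule integral_cong_AE)
      show "AE t in circle. (dirichlet' n t)\<^sup>2 * \<psi> (x - t) / (real n)\<^sup>2 = (w t / 8 + w t * cos (real n * t) / 8) + e1 n t * \<rho> n t * w t"
        using AE_circle_nonzero AE_space
      proof eventually_elim
        case (elim t)
        then have s: "sin (t / 2) \<noteq> 0" by (intro sin_half_nonzero) auto
        have "(dirichlet' n t)\<^sup>2 * \<psi> (x - t) / (real n)\<^sup>2 = (dirichlet' n t / real n * sin (t / 2))\<^sup>2 * w t"
          using s by (simp add: w_def power_mult_distrib power_divide)
        also have "\<dots> = ((cos (real n * t / 2))\<^sup>2 / 4 + e1 n t * \<rho> n t) * w t"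
          unfolding d'[OF n] by (simp add: e1_def power2_diff power_divide) (simp add: power2_eq_square algebra_simps)
        also have "\<dots> = (w t / 8 + w t * cos (real n * t) / 8) + e1 n t * \<rho> n t * w t"
          unfolding cdbl by (simp add: algebra_simps add_divide_distrib)
        finally show ?case .
      qed
    qed (use e1 in \<open>auto intro!: measurable_circle\<close>)
    also have "\<dots> = (W / 8 + (\<integral>t. w t * cos (real n * t) \<partial>circle) / 8) + (\<integral>t. e1 n t * \<rho> n t * w t \<partial>circle)"
      using w icos ie\<rho>[OF e1] by (simp add: W_def)
    finally show ?thesis .
  qed
  have "(\<lambda>n. (W / 8 + (\<integral>t. w t * cos (real n * t) \<partial>circle) / 8) + (\<integral>t. e1 n t * \<rho> n t * w t \<partial>circle)) \<longlonglongrightarrow> (W / 8 + 0 / 8) + 0"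
    by (intro tendsto_add tendsto_const tendsto_divide wc small e1) auto
  moreover have "\<forall>\<^sub>F n in sequentially. (W / 8 + (\<integral>t. w t * cos (real n * t) \<partial>circle) / 8) + (\<integral>t. e1 n t * \<rho> n t * w t \<partial>circle) = mass' n x / (real n)\<^sup>2"
    using eventually_ge_at_top[of 1] by eventually_elim (simp add: D')
  ultimately have D: "(\<lambda>n. mass' n x / (real n)\<^sup>2) \<longlonglongrightarrow> W / 8"
    by (auto intro: Lim_transform_eventually)
  \<comment> \<open>The product of \<open>s sin (t / 2) = sin (n t / 2)\<close> with \<open>c / 2 - \<rho>\<close>.\<close>
  define e2 where "e2 n t = - sin (real n * t / 2)" for n t
  have e2: "e2 n \<in> borel_measurable borel" "\<bar>e2 n t\<bar> \<le> 2" for n t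
    unfolding e2_def[abs_def] using abs_sin_le_one[of "real n * t / 2"] by (measurable, linarith)
  have B': "cross n x / real n = (\<integral>t. w t * sin (real n * t) \<partial>circle) / 4 + (\<integral>t. e2 n t * \<rho> n t * w t \<partial>circle)"
    if n: "n \<ge> 1" for n
  proof -
    have "cross n x / real n = (\<integral>t. dirichlet n t * dirichlet' n t * \<psi> (x - t) / real n \<partial>circle)"
      unfolding cross_def by simp
    also have "\<dots> = (\<integral>t. w t * sin (real n * t) / 4 + e2 n t * \<rho> n t * w t \<partial>circle)"
    proof (rule integral_cong_AE)
      show "AE t in circle. dirichlet n t * dirichlet' n t * \<psi> (x - t) / real n = w t * sin (real n * t) / 4 + e2 n t * \<rho> n t * w t"
        using AE_circle_nonzero AE_space
      proof eventually_elim
        case (elim t)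
        then have s: "sin (t / 2) \<noteq> 0" by (intro sin_half_nonzero) auto
        have "dirichlet n t * dirichlet' n t * \<psi> (x - t) / real n = (dirichlet n t * sin (t / 2)) * (dirichlet' n t / real n * sin (t / 2)) * w t"
          using s by (simp add: w_def power2_eq_square)
        also have "\<dots> = ((sin (real n * t / 2) * cos (real n * t / 2)) / 2 + e2 n t * \<rho> n t) * w t"
          unfolding d'[OF n] dirichlet_times_sin by (simp add: e2_def algebra_simps)
        also have "\<dots> = w t * sin (real n * t) / 4 + e2 n t * \<rho> n t * w t"
          unfolding cdbl by (simp add: algebra_simps)
        finally show ?case .
      qed
    qed (use e2 in \<open>auto intro!: measurable_circle\<close>)
    also have "\<dots> = (\<integral>t. w t * sin (real n * t) \<partial>circle) / 4 + (\<integral>t. e2 n t * \<rho> n t * w t \<partial>circle)"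
      using isin ie\<rho>[OF e2] by simp
    finally show ?thesis .
  qed
  have "(\<lambda>n. (\<integral>t. w t * sin (real n * t) \<partial>circle) / 4 + (\<integral>t. e2 n t * \<rho> n t * w t \<partial>circle)) \<longlonglongrightarrow> 0 / 4 + 0"
    by (intro tendsto_add tendsto_const tendsto_divide ws small e2) auto
  moreover have "\<forall>\<^sub>F n in sequentially. (\<integral>t. w t * sin (real n * t) \<partial>circle) / 4 + (\<integral>t. e2 n t * \<rho> n t * w t \<partial>circle) = cross n x / real n"
    using eventually_ge_at_top[of 1] by eventually_elim (simp add: B')
  ultimately have B: "(\<lambda>n. cross n x / real n) \<longlonglongrightarrow> 0"
    by (auto intro: Lim_transform_eventually)
  have nz: "W / 2 \<noteq> 0" using \<open>1 \<le> W\<close> by simp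
  have "(\<lambda>n. cross n x / real n / mass n x) \<longlonglongrightarrow> 0 / (W / 2)" by (rule tendsto_divide[OF B A nz])
  then have q: "(\<lambda>n. cross n x / real n / mass n x) \<longlonglongrightarrow> 0" by simp
  have e: "W / 8 / (W / 2) = 1 / 4" using \<open>1 \<le> W\<close> by simp
  have "sqrt (1 / 4 + W / 8 / (W / 2)) / pi = 1 / (pi * sqrt 2)" unfolding e by (simp add: real_sqrt_divide)
  with intensity_limitI[OF tendsto_divide[OF D A nz] q] show ?thesis by simp
qed

end

section \<open>Local bounds for the zero density\<close>

lemma integrable_circle_powr:
  assumes "\<alpha> > 0"
  shows "integrable circle (\<lambda>t. \<bar>t\<bar> powr (\<alpha> - 1))"
proof -
  define h where "h t = indicator {0..pi} t * t powr (\<alpha> - 1)" for t :: real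
  have [measurable]: "h \<in> borel_measurable borel" unfolding h_def[abs_def] by measurable
  have h0: "0 \<le> h t" for t by (simp add: h_def)
  have "((\<lambda>t. t powr (\<alpha> - 1)) has_integral (pi powr (\<alpha> - 1 + 1) / (\<alpha> - 1 + 1))) {0..pi}"
    using assms by (intro has_integral_powr_from_0) auto
  then have "(h has_integral (pi powr (\<alpha> - 1 + 1) / (\<alpha> - 1 + 1))) UNIV"
    unfolding h_def by (subst (asm) has_integral_restrict_UNIV[symmetric])
      (auto elim!: has_integral_eq[rotated] simp: indicator_def)
  from nn_integral_has_integral_lborel[OF _ h0 this]
  have "(\<integral>\<^sup>+t. ennreal (h t) \<partial>lborel) < \<infinity>" by simp
  then have h: "integrable lborel h"
    using h0 by (intro integrableI_nonneg) auto
  have h': "integrable lborel (\<lambda>t. h (0 + (- 1) * t))"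
    by (rule lborel_integrable_real_affine[OF h]) simp
  have "integrable lborel (\<lambda>t. indicator {- pi..pi} t *\<^sub>R \<bar>t\<bar> powr (\<alpha> - 1))"
  proof (rule Bochner_Integration.integrable_bound[OF Bochner_Integration.integrable_add[OF h h']])
    show "AE t in lborel. norm (indicator {- pi..pi} t *\<^sub>R \<bar>t\<bar> powr (\<alpha> - 1)) \<le> norm (h t + h (0 + - 1 * t))"
      by (rule AE_I2) (auto simp: h_def indicator_def)
  qed measurable
  then show ?thesis unfolding circle_def by (subst integrable_restrict_space) auto
qed

context circle_density
begin

text \<open>The remainder of the first order expansion of \<open>\<psi>\<close> at \<open>x\<close> with slope \<open>\<sigma>\<close>, divided by \<open>t\<^sup>2\<close>. It is
  divided by \<open>t\<^sup>2\<close> because the kernels decay like \<open>1 / (n t\<^sup>2)\<close>, and it is integrable because a Hoelder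
  derivative makes the remainder \<open>O(\<bar>t\<bar>\<^sup>1\<^sup>+\<^sup>\<alpha>)\<close>.\<close>
definition excess where
  "excess x \<sigma> t = \<bar>\<psi> (x - t) - \<psi> x + \<sigma> * t\<bar> / t\<^sup>2"

lemma excess_measurable [measurable]: "excess x \<sigma> \<in> borel_measurable borel"
  unfolding excess_def[abs_def] by measurable

lemma excess_nonneg: "0 \<le> excess x \<sigma> t" by (simp add: excess_def)

text \<open>The linear term \<open>\<sigma> t\<close> integrates to \<open>0\<close> against an even kernel, so it may be inserted to form
  the excess.\<close>
lemma even_kernel_estimate:
  assumes n: "n \<ge> 1" and int: "integrable circle (excess x \<sigma>)"
    and k: "continuous_on UNIV k" "\<And>t. k (- t) = k t" "\<And>t. t \<in> {- pi..pi} \<Longrightarrow> \<bar>k t\<bar> \<le> K * lorentz n t" and K: "K \<ge> 0"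
  shows "\<bar>(\<integral>t. k t * \<psi> (x - t) \<partial>circle) - \<psi> x * (\<integral>t. k t \<partial>circle)\<bar> \<le> K / real n * (\<integral>t. excess x \<sigma> t \<partial>circle)"
proof -
  have ik: "integrable circle k" by (rule integrable_circle_continuous[OF k(1)])
  have ikt: "integrable circle (\<lambda>t. k t * t)" by (intro integrable_circle_continuous continuous_intros k)
  have odd: "(\<integral>t. k t * t \<partial>circle) = 0" by (rule integral_circle_odd) (simp add: k)
  have ik\<psi>: "integrable circle (\<lambda>t. k t * \<psi> (x - t))" by (rule integrable_mult_\<psi>[OF k(1)])
  have "(\<integral>t. k t * (\<psi> (x - t) - \<psi> x + \<sigma> * t) \<partial>circle) = (\<integral>t. k t * \<psi> (x - t) - \<psi> x * k t + \<sigma> * (k t * t) \<partial>circle)"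
    by (intro Bochner_Integration.integral_cong) (auto simp: algebra_simps)
  also have "\<dots> = (\<integral>t. k t * \<psi> (x - t) \<partial>circle) - \<psi> x * (\<integral>t. k t \<partial>circle)"
    using ik ikt ik\<psi> odd by simp
  finally have eq: "(\<integral>t. k t * \<psi> (x - t) \<partial>circle) - \<psi> x * (\<integral>t. k t \<partial>circle) = (\<integral>t. k t * (\<psi> (x - t) - \<psi> x + \<sigma> * t) \<partial>circle)" ..
  have "\<bar>\<integral>t. k t * (\<psi> (x - t) - \<psi> x + \<sigma> * t) \<partial>circle\<bar> \<le> (\<integral>t. \<bar>k t * (\<psi> (x - t) - \<psi> x + \<sigma> * t)\<bar> \<partial>circle)"
    by (rule integral_abs_bound)
  also have "\<dots> \<le> (\<integral>t. K / real n * excess x \<sigma> t \<partial>circle)"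
  proof (rule integral_mono_AE)
    have "integrable circle (\<lambda>t. k t * \<psi> (x - t) - \<psi> x * k t + \<sigma> * (k t * t))"
      using ik ikt ik\<psi> by auto
    then show "integrable circle (\<lambda>t. \<bar>k t * (\<psi> (x - t) - \<psi> x + \<sigma> * t)\<bar>)"
      by (intro integrable_abs) (simp add: algebra_simps)
    show "integrable circle (\<lambda>t. K / real n * excess x \<sigma> t)" using int by simp
    show "AE t in circle. \<bar>k t * (\<psi> (x - t) - \<psi> x + \<sigma> * t)\<bar> \<le> K / real n * excess x \<sigma> t"
      using AE_circle_nonzero AE_space
    proof eventually_elim
      case (elim t)
      have "\<bar>k t\<bar> \<le> K * (1 / (real n * t\<^sup>2))"
        using k(3)[of t] elim mult_left_mono[OF lorentz_tail[OF n, of t] K] by simp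
      then have "\<bar>k t\<bar> * \<bar>\<psi> (x - t) - \<psi> x + \<sigma> * t\<bar> \<le> K * (1 / (real n * t\<^sup>2)) * \<bar>\<psi> (x - t) - \<psi> x + \<sigma> * t\<bar>"
        by (intro mult_right_mono) auto
      then show ?case by (simp add: abs_mult excess_def)
    qed
  qed
  finally show ?thesis unfolding eq by simp
qed

text \<open>The second bound uses that the mass of \<open>s'\<^sup>2 / n\<^sup>3\<close> is at most \<open>2 \<pi> / 12 \<le> 1\<close>.\<close>
lemma mass_estimates:
  assumes n: "n \<ge> 1" and int: "integrable circle (excess x \<sigma>)" and E: "(\<integral>t. excess x \<sigma> t \<partial>circle) \<le> E"
  shows "\<bar>mass n x - 2 * pi * real n * \<psi> x\<bar> \<le> kernel_const * E"
    and "mass' n x \<le> real n ^ 3 * \<psi> x + kernel_const * E * (real n)\<^sup>2"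
proof -
  have n0: "real n > 0" using n by simp
  have KE: "kernel_const / real n * (\<integral>t. excess x \<sigma> t \<partial>circle) \<le> kernel_const / real n * E"
    using E kernel_const_pos by (intro mult_left_mono) auto
  have "\<bar>(\<integral>t. (dirichlet n t)\<^sup>2 / real n * \<psi> (x - t) \<partial>circle) - \<psi> x * (\<integral>t. (dirichlet n t)\<^sup>2 / real n \<partial>circle)\<bar>
      \<le> kernel_const / real n * (\<integral>t. excess x \<sigma> t \<partial>circle)"
    using n kernel_const_pos dirichlet_square_le_lorentz[OF n]
    by (intro even_kernel_estimate[OF n int]) (auto intro!: continuous_intros simp: dirichlet_even)
  then have "\<bar>mass n x / real n - \<psi> x * (2 * pi)\<bar> \<le> kernel_const / real n * E"
    using KE n0 by (simp add: mass_def integral_dirichlet_square)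
  then have "real n * \<bar>mass n x / real n - \<psi> x * (2 * pi)\<bar> \<le> real n * (kernel_const / real n * E)"
    using n0 by (intro mult_left_mono) auto
  moreover have "real n * \<bar>mass n x / real n - \<psi> x * (2 * pi)\<bar> = \<bar>mass n x - 2 * pi * real n * \<psi> x\<bar>"
  proof -
    have "real n * (mass n x / real n - \<psi> x * (2 * pi)) = mass n x - 2 * pi * real n * \<psi> x"
      using n0 by (simp add: right_diff_distrib)
    then show ?thesis using n0 by (metis abs_mult abs_of_pos)
  qed
  ultimately show "\<bar>mass n x - 2 * pi * real n * \<psi> x\<bar> \<le> kernel_const * E" using n0 by simp
  have "\<bar>(\<integral>t. (dirichlet' n t)\<^sup>2 / real n ^ 3 * \<psi> (x - t) \<partial>circle) - \<psi> x * (\<integral>t. (dirichlet' n t)\<^sup>2 / real n ^ 3 \<partial>circle)\<bar>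
      \<le> kernel_const / real n * (\<integral>t. excess x \<sigma> t \<partial>circle)"
    using n kernel_const_pos dirichlet'_square_le_lorentz[OF n]
    by (intro even_kernel_estimate[OF n int]) (auto intro!: continuous_intros simp: dirichlet'_odd)
  then have "mass' n x / real n ^ 3 \<le> \<psi> x * (\<integral>t. (dirichlet' n t)\<^sup>2 / real n ^ 3 \<partial>circle) + kernel_const / real n * E"
    using KE by (simp add: mass'_def)
  also have "(\<integral>t. (dirichlet' n t)\<^sup>2 / real n ^ 3 \<partial>circle) \<le> 1"
  proof -
    have "2 * pi \<le> 12" using pi_less_4 by simp
    then have "2 * pi * (real n * ((real n)\<^sup>2 - 1) / 12) \<le> 12 * (real n * ((real n)\<^sup>2 - 1) / 12)"
      using n by (intro mult_right_mono divide_nonneg_nonneg mult_nonneg_nonneg) auto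
    also have "\<dots> \<le> real n ^ 3" by (simp add: power3_eq_cube power2_eq_square algebra_simps)
    finally show ?thesis using n0 by (simp add: integral_dirichlet'_square)
  qed
  then have "\<psi> x * (\<integral>t. (dirichlet' n t)\<^sup>2 / real n ^ 3 \<partial>circle) + kernel_const / real n * E \<le> \<psi> x + kernel_const / real n * E"
    using mult_left_mono[of "\<integral>t. (dirichlet' n t)\<^sup>2 / real n ^ 3 \<partial>circle" 1 "\<psi> x"] \<psi>_nonneg[of x] by simp
  finally have "real n ^ 3 * (mass' n x / real n ^ 3) \<le> real n ^ 3 * (\<psi> x + kernel_const / real n * E)"
    using n0 by (intro mult_left_mono) auto
  then show "mass' n x \<le> real n ^ 3 * \<psi> x + kernel_const * E * (real n)\<^sup>2"
    using n0 by (simp add: distrib_left power3_eq_cube power2_eq_square mult_ac)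
qed

text \<open>By the preceding estimates \<open>mass\<close> differs from \<open>2 \<pi> n \<psi>(x)\<close> by a bounded amount, and \<open>mass' / n\<^sup>2\<close>
  exceeds \<open>n \<psi>(x)\<close> by a bounded amount at most. The lower bound on \<open>mass\<close> absorbs these amounts where
  \<open>\<psi>(x)\<close> is small or zero.\<close>
lemma mass'_le_mass:
  assumes n: "n \<ge> 1" and int: "integrable circle (excess x \<sigma>)" and E: "(\<integral>t. excess x \<sigma> t \<partial>circle) \<le> E"
    and low: "1 / 3 \<le> mass n x"
  shows "mass' n x \<le> (1 + 6 * kernel_const * E) * (real n)\<^sup>2 * mass n x"
proof -
  note est = mass_estimates[OF n int E]
  have "0 \<le> (\<integral>t. excess x \<sigma> t \<partial>circle)" by (intro integral_nonneg_AE AE_I2 excess_nonneg)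
  then have KE: "0 \<le> kernel_const * E" using E kernel_const_pos by simp
  have 1: "kernel_const * E \<le> 3 * (kernel_const * E) * mass n x"
    using mult_left_mono[OF low, of "3 * (kernel_const * E)"] KE by simp
  have "real n * \<psi> x \<le> 2 * pi * (real n * \<psi> x)"
    using pi_gt3 \<psi>_nonneg[of x] mult_right_mono[of 1 "2 * pi" "real n * \<psi> x"] by simp
  then have "real n * \<psi> x + kernel_const * E \<le> (1 + 6 * (kernel_const * E)) * mass n x"
    using est(1) 1 by (simp add: abs_le_iff algebra_simps)
  then have "(real n)\<^sup>2 * (real n * \<psi> x + kernel_const * E) \<le> (real n)\<^sup>2 * ((1 + 6 * (kernel_const * E)) * mass n x)"
    by (intro mult_left_mono) auto
  then show ?thesis using est(2) by (simp add: power3_eq_cube power2_eq_square algebra_simps)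
qed

lemma intensity_le:
  assumes "n \<ge> 1" "0 < mass n x" "0 \<le> H" "mass' n x \<le> H * (real n)\<^sup>2 * mass n x"
  shows "intensity n x \<le> sqrt (1 + H) * real n"
proof -
  have "mid n \<le> real n" using assms(1) by (simp add: mid_def)
  then have "(mid n)\<^sup>2 \<le> (real n)\<^sup>2" by (intro power_mono) (auto simp: mid_def)
  moreover have "mass' n x / mass n x \<le> H * (real n)\<^sup>2" using assms by (simp add: divide_le_eq)
  ultimately have "(mid n)\<^sup>2 + mass' n x / mass n x - (cross n x / mass n x)\<^sup>2 \<le> (1 + H) * (real n)\<^sup>2"
    by (simp add: algebra_simps) (smt (verit) zero_le_power2)
  then have "sqrt ((mid n)\<^sup>2 + mass' n x / mass n x - (cross n x / mass n x)\<^sup>2) \<le> sqrt (1 + H) * real n"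
    using real_sqrt_le_mono by (fastforce simp: real_sqrt_mult)
  moreover have "sqrt ((mid n)\<^sup>2 + mass' n x / mass n x - (cross n x / mass n x)\<^sup>2) / pi \<le> sqrt (1 + H) * real n" 
    if "sqrt ((mid n)\<^sup>2 + mass' n x / mass n x - (cross n x / mass n x)\<^sup>2) \<le> sqrt (1 + H) * real n"
  proof -
    have "sqrt (1 + H) * real n * 1 \<le> sqrt (1 + H) * real n * pi"
      using pi_gt3 assms by (intro mult_left_mono) auto
    then show ?thesis using that by (simp add: divide_le_eq)
  qed
  ultimately show ?thesis by (simp add: intensity_def)
qed

text \<open>For \<open>\<bar>t\<bar> < \<delta>\<close> the mean value inequality and the Hoelder condition bound the excess by a multiple
  of \<open>\<bar>t\<bar>\<^sup>\<alpha>\<^sup>-\<^sup>1\<close>; for \<open>\<bar>t\<bar> \<ge> \<delta>\<close> the denominator is harmless and \<open>\<psi>\<close> is integrable. All constants are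
  uniform on a ball that is three times smaller than the one given by the hypotheses.\<close>
lemma excess_locally_bounded:
  assumes U: "open U" and f': "\<And>x. x \<in> U \<Longrightarrow> (\<psi> has_real_derivative f' x) (at x)"
    and cont: "continuous_on U f'" and hoelder: "locally_hoelder_on U f'" and x0: "x0 \<in> U"
  obtains \<delta> E where "\<delta> > 0" "ball x0 \<delta> \<subseteq> U"
    "\<And>x. x \<in> ball x0 \<delta> \<Longrightarrow> integrable circle (excess x (f' x)) \<and> (\<integral>t. excess x (f' x) t \<partial>circle) \<le> E"
proof -
  obtain e \<alpha> C where e: "e > 0" and \<alpha>: "0 < \<alpha>" "\<alpha> \<le> 1"
    and C: "\<And>y z. y \<in> U \<inter> ball x0 e \<Longrightarrow> z \<in> U \<inter> ball x0 e \<Longrightarrow> \<bar>f' y - f' z\<bar> \<le> C * \<bar>y - z\<bar> powr \<alpha>"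
    using hoelder x0 unfolding locally_hoelder_on_def by fastforce
  obtain r where r: "r > 0" "ball x0 r \<subseteq> U" using U x0 by (auto simp: open_contains_ball)
  define \<delta> where "\<delta> = min e r / 3"
  have \<delta>: "\<delta> > 0" "ball x0 (2 * \<delta>) \<subseteq> U \<inter> ball x0 e"
    using e r by (auto simp: \<delta>_def subset_iff)
  have sub: "cball x0 \<delta> \<subseteq> U" using \<delta> by (auto simp: subset_iff)
  have "continuous_on (cball x0 \<delta>) f'" by (rule continuous_on_subset[OF cont sub])
  then have "compact (f' ` cball x0 \<delta>)" by (intro compact_continuous_image) auto
  then obtain M1 where M1: "\<And>x. x \<in> cball x0 \<delta> \<Longrightarrow> \<bar>f' x\<bar> \<le> M1"
    using compact_imp_bounded bounded_iff by (metis image_eqI real_norm_def)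
  have "continuous_on (cball x0 \<delta>) \<psi>"
    using sub by (intro continuous_at_imp_continuous_on ballI DERIV_isCont[OF f']) auto
  then have "compact (\<psi> ` cball x0 \<delta>)" by (intro compact_continuous_image) auto
  then obtain M2 where M2: "\<And>x. x \<in> cball x0 \<delta> \<Longrightarrow> \<bar>\<psi> x\<bar> \<le> M2"
    using compact_imp_bounded bounded_iff by (metis image_eqI real_norm_def)
  have M: "0 \<le> M1" "0 \<le> M2" using M1[of x0] M2[of x0] \<delta> by auto
  \<comment> \<open>Sum of the bounds for \<open>\<bar>t\<bar> < \<delta>\<close> and \<open>\<bar>t\<bar> \<ge> \<delta>\<close>; its integral \<open>E\<close> does not depend on \<open>x\<close>.\<close>
  define G where "G x t = \<bar>C\<bar> * \<bar>t\<bar> powr (\<alpha> - 1) + (\<psi> (x - t) + (M2 + M1 * pi)) / \<delta>\<^sup>2" for x t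
  define E where "E = \<bar>C\<bar> * (\<integral>t. \<bar>t\<bar> powr (\<alpha> - 1) \<partial>circle) + (1 + 2 * pi * (M2 + M1 * pi)) / \<delta>\<^sup>2"
  have iG: "integrable circle (G x)" for x
    unfolding G_def by (intro Bochner_Integration.integrable_add integrable_divide_zero integrable_mult_right integrable_circle_powr \<psi>_shift \<alpha> circle.integrable_const)
  have EG: "(\<integral>t. G x t \<partial>circle) = E" for x
    unfolding G_def E_def using \<psi>_shift[of x] integrable_circle_powr[OF \<alpha>(1)] measure_circle
    by (simp add: mult.commute)
  have le: "excess x (f' x) t \<le> G x t" if x: "x \<in> ball x0 \<delta>" and t: "t \<in> {- pi..pi}" for x t
  proof (cases "\<bar>t\<bar> < \<delta>")
    case True
    have seg: "y \<in> U \<inter> ball x0 e" if "\<bar>y - x\<bar> \<le> \<bar>t\<bar>" for y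
    proof -
      have "dist x0 y \<le> dist x0 x + \<bar>y - x\<bar>" by (simp add: dist_real_def)
      also have "\<dots> < 2 * \<delta>" using x that True by simp
      finally show ?thesis using \<delta>(2) by auto
    qed
    have "\<bar>\<psi> (x - t) - \<psi> x + f' x * t\<bar> \<le> \<bar>C\<bar> * \<bar>t\<bar> powr \<alpha> * \<bar>t\<bar>"
    proof -
      \<comment> \<open>Subtracting the tangent at \<open>x\<close> leaves the derivative \<open>f' y - f' x\<close>, to which the Hoelder
        condition applies.\<close>
      define g where "g y = \<psi> y - f' x * y" for y
      have "norm (g (x - t) - g x) \<le> (\<bar>C\<bar> * \<bar>t\<bar> powr \<alpha>) * norm ((x - t) - x)"
      proof (rule field_differentiable_bound[where S="closed_segment x (x - t)"])
        fix y assume y: "y \<in> closed_segment x (x - t)"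
        then have yx: "\<bar>y - x\<bar> \<le> \<bar>t\<bar>" by (auto simp: closed_segment_eq_real_ivl split: if_splits)
        note yU = seg[OF yx]
        show "(g has_field_derivative f' y - f' x) (at y within closed_segment x (x - t))"
          unfolding g_def using yU by (auto intro!: derivative_eq_intros has_field_derivative_at_within[OF f'])
        have "\<bar>f' y - f' x\<bar> \<le> C * \<bar>y - x\<bar> powr \<alpha>" by (rule C[OF yU seg]) simp
        also have "\<dots> \<le> \<bar>C\<bar> * \<bar>t\<bar> powr \<alpha>"
          using yx \<alpha> by (intro mult_mono powr_mono2) auto
        finally show "norm (f' y - f' x) \<le> \<bar>C\<bar> * \<bar>t\<bar> powr \<alpha>" by simp
      qed auto
      then show ?thesis by (simp add: g_def algebra_simps)
    qed
    then have "excess x (f' x) t \<le> \<bar>C\<bar> * \<bar>t\<bar> powr \<alpha> * \<bar>t\<bar> / t\<^sup>2"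
      unfolding excess_def by (intro divide_right_mono) auto
    also have "\<dots> = \<bar>C\<bar> * \<bar>t\<bar> powr (\<alpha> - 1)"
    proof (cases "t = 0")
      case False
      then have "\<bar>t\<bar> powr (\<alpha> - 1) = \<bar>t\<bar> powr \<alpha> / \<bar>t\<bar>" by (simp add: powr_diff)
      moreover have "c * p * \<tau> / \<tau>\<^sup>2 = c * (p / \<tau>)" for c p \<tau> :: real by (simp add: power2_eq_square)
      from this[of "\<bar>C\<bar>" "\<bar>t\<bar> powr \<alpha>" "\<bar>t\<bar>"]
      have "\<bar>C\<bar> * \<bar>t\<bar> powr \<alpha> * \<bar>t\<bar> / t\<^sup>2 = \<bar>C\<bar> * (\<bar>t\<bar> powr \<alpha> / \<bar>t\<bar>)" by (simp only: power2_abs)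
      ultimately show ?thesis by simp
    qed simp
    also have "\<dots> \<le> G x t" unfolding G_def using \<psi>_nonneg[of "x - t"] M by simp
    finally show ?thesis .
  next
    case False
    have d: "\<delta>\<^sup>2 \<le> t\<^sup>2" using False \<delta>(1) by (auto simp: abs_le_square_iff[symmetric])
    have "\<bar>f' x * t\<bar> \<le> M1 * pi" unfolding abs_mult using M1[of x] x t M by (intro mult_mono) auto
    then have "\<bar>\<psi> (x - t) - \<psi> x + f' x * t\<bar> \<le> \<psi> (x - t) + (M2 + M1 * pi)"
      using M2[of x] x \<psi>_nonneg[of "x - t"] by simp
    then have "excess x (f' x) t \<le> (\<psi> (x - t) + (M2 + M1 * pi)) / \<delta>\<^sup>2"
      unfolding excess_def using d \<delta>(1) by (intro frac_le) auto
    also have "\<dots> \<le> G x t" unfolding G_def by simp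
    finally show ?thesis .
  qed
  show thesis
  proof (rule that[OF \<delta>(1)])
    show "ball x0 \<delta> \<subseteq> U" using sub by auto
    fix x assume x: "x \<in> ball x0 \<delta>"
    have int: "integrable circle (excess x (f' x))"
      by (rule Bochner_Integration.integrable_bound[OF iG[of x]])
        (use le[OF x] excess_nonneg[of x "f' x"] in \<open>auto intro!: AE_I2 measurable_circle intro: order_trans[OF _ abs_ge_self]\<close>)
    moreover have "(\<integral>t. excess x (f' x) t \<partial>circle) \<le> (\<integral>t. G x t \<partial>circle)"
      using le[OF x] by (intro integral_mono int iG) auto
    ultimately show "integrable circle (excess x (f' x)) \<and> (\<integral>t. excess x (f' x) t \<partial>circle) \<le> E" by (simp add: EG)
  qed
qed

definition limit_intensity where
  "limit_intensity x = (if \<psi> x = 0 then 1 / (pi * sqrt 2) else 1 / (pi * sqrt 3))"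

lemma
  assumes U: "open U" and C1: "C1_hoelder_on U \<psi>" and x0: "x0 \<in> U"
  shows intensity_limit: "(\<lambda>n. intensity n x0 / real n) \<longlonglongrightarrow> limit_intensity x0"
    and intensity_locally_bounded: "\<exists>\<delta>>0. \<exists>H. \<forall>\<^sub>F n in sequentially. \<forall>x\<in>ball x0 \<delta>. intensity n x \<le> H * real n"
proof -
  obtain f' where f': "\<And>x. x \<in> U \<Longrightarrow> (\<psi> has_real_derivative f' x) (at x)"
    and cont: "continuous_on U f'" and hoelder: "locally_hoelder_on U f'"
    using C1 unfolding C1_hoelder_on_def by blast
  obtain \<delta> E where \<delta>: "\<delta> > 0" and E: "\<And>x. x \<in> ball x0 \<delta> \<Longrightarrow> integrable circle (excess x (f' x)) \<and> (\<integral>t. excess x (f' x) t \<partial>circle) \<le> E"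
    using excess_locally_bounded[OF U f' cont hoelder x0] by metis
  show "(\<lambda>n. intensity n x0 / real n) \<longlonglongrightarrow> limit_intensity x0"
  proof (cases "\<psi> x0 = 0")
    case True
    have "f' x0 = 0"
      by (rule DERIV_local_min[OF f'[OF x0], of 1]) (use True \<psi>_nonneg in auto)
    moreover have "integrable circle (excess x0 (f' x0))" using E[of x0] \<delta> by simp
    ultimately have "integrable circle (\<lambda>t. \<psi> (x0 - t) / t\<^sup>2)"
      using True \<psi>_nonneg unfolding excess_def by simp
    then show ?thesis using True intensity_limit_zero by (simp add: limit_intensity_def)
  next
    case False
    then show ?thesis
      using intensity_limit_positive[of x0] \<psi>_nonneg[of x0] DERIV_isCont[OF f'[OF x0]]
      by (simp add: limit_intensity_def)
  qed
  have "\<forall>\<^sub>F n in sequentially. \<forall>x\<in>ball x0 \<delta>. intensity n x \<le> sqrt (1 + \<bar>1 + 6 * kernel_const * E\<bar>) * real n"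
    using mass_bounded_below eventually_ge_at_top[of 1]
  proof eventually_elim
    case (elim n)
    show ?case
    proof
      fix x assume x: "x \<in> ball x0 \<delta>"
      have pos: "0 < mass n x" using elim(1) by (meson less_le_trans zero_less_divide_1_iff zero_less_numeral)
      have "mass' n x \<le> (1 + 6 * kernel_const * E) * (real n)\<^sup>2 * mass n x"
        using elim E[OF x] by (intro mass'_le_mass[where \<sigma>="f' x"]) auto
      also have "\<dots> \<le> \<bar>1 + 6 * kernel_const * E\<bar> * (real n)\<^sup>2 * mass n x"
        using pos by (intro mult_right_mono) auto
      finally show "intensity n x \<le> sqrt (1 + \<bar>1 + 6 * kernel_const * E\<bar>) * real n"
        using elim pos by (intro intensity_le) auto
    qed
  qed
  then show "\<exists>\<delta>>0. \<exists>H. \<forall>\<^sub>F n in sequentially. \<forall>x\<in>ball x0 \<delta>. intensity n x \<le> H * real n"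
    using \<delta> by blast
qed

end

section \<open>Limits of integrals controlled on intervals\<close>

lemma nn_integral_Icc_split:
  fixes g :: "real \<Rightarrow> ennreal"
  assumes [measurable]: "g \<in> borel_measurable borel" and "a \<le> b" "b \<le> c"
  shows "(\<integral>\<^sup>+x. g x * indicator {a..c} x \<partial>lborel)
     = (\<integral>\<^sup>+x. g x * indicator {a..b} x \<partial>lborel) + (\<integral>\<^sup>+x. g x * indicator {b..c} x \<partial>lborel)"
  by (subst nn_integral_add[symmetric], simp, simp, intro nn_integral_cong_AE eventually_mono[OF AE_lborel_singleton[of b]])
    (use assms in \<open>auto simp: indicator_def\<close>)

lemma nn_integral_grid:
  fixes g :: "real \<Rightarrow> ennreal"
  assumes [measurable]: "g \<in> borel_measurable borel" and h: "h \<ge> 0"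
  shows "(\<integral>\<^sup>+x. g x * indicator {0..real m * h} x \<partial>lborel)
     = (\<Sum>i<m. \<integral>\<^sup>+x. g x * indicator {real i * h..real (Suc i) * h} x \<partial>lborel)"
proof (induction m)
  case 0
  have "(\<integral>\<^sup>+x. g x * indicator {0} x \<partial>lborel) = (\<integral>\<^sup>+(x::real). 0 \<partial>lborel)"
    by (rule nn_integral_cong_AE, rule eventually_mono[OF AE_lborel_singleton[of "0::real"]]) auto
  then show ?case by simp
next
  case (Suc m)
  have "(\<integral>\<^sup>+x. g x * indicator {0..real (Suc m) * h} x \<partial>lborel)
    = (\<integral>\<^sup>+x. g x * indicator {0..real m * h} x \<partial>lborel) + (\<integral>\<^sup>+x. g x * indicator {real m * h..real (Suc m) * h} x \<partial>lborel)"
    using h by (intro nn_integral_Icc_split) (auto intro!: mult_right_mono)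
  then show ?case using Suc by simp
qed

lemma tendsto_nn_integral_interval:
  fixes G :: "nat \<Rightarrow> real \<Rightarrow> ennreal" and L :: "real \<Rightarrow> ennreal"
  assumes G [measurable]: "\<And>n. G n \<in> borel_measurable borel" and L [measurable]: "L \<in> borel_measurable borel"
    and V: "AE x in lborel. x \<in> V"
    and lim: "\<And>x. x \<in> V \<Longrightarrow> (\<lambda>n. G n x) \<longlonglongrightarrow> L x"
    and dom: "\<forall>\<^sub>F n in sequentially. \<forall>y\<in>{a..b}. G n y \<le> ennreal H"
  shows "(\<lambda>n. \<integral>\<^sup>+x. G n x * indicator {a..b} x \<partial>lborel) \<longlonglongrightarrow> (\<integral>\<^sup>+x. L x * indicator {a..b} x \<partial>lborel)"
proof -
  obtain N where N: "\<And>n y. n \<ge> N \<Longrightarrow> y \<in> {a..b} \<Longrightarrow> G n y \<le> ennreal H"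
    using dom unfolding eventually_sequentially by blast
  have "(\<lambda>n. \<integral>\<^sup>+x. G (n + N) x * indicator {a..b} x \<partial>lborel) \<longlonglongrightarrow> (\<integral>\<^sup>+x. L x * indicator {a..b} x \<partial>lborel)"
  proof (rule nn_integral_dominated_convergence[where w="\<lambda>x. ennreal H * indicator {a..b} x"])
    show "AE x in lborel. G (j + N) x * indicator {a..b} x \<le> ennreal H * indicator {a..b} x" for j
      using N[of "j + N"] by (intro AE_I2) (auto simp: indicator_def)
    show "(\<integral>\<^sup>+x. ennreal H * indicator {a..b} x \<partial>lborel) < \<infinity>"
      by (cases "a \<le> b") (simp_all add: nn_integral_cmult_indicator ennreal_mult_less_top)
    show "AE x in lborel. (\<lambda>i. G (i + N) x * indicator {a..b} x) \<longlonglongrightarrow> L x * indicator {a..b} x"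
      using V
    proof eventually_elim
      case (elim x)
      then show ?case using LIMSEQ_ignore_initial_segment[OF lim, of x N] by (cases "x \<in> {a..b}") auto
    qed
  qed measurable
  then show ?thesis by (rule LIMSEQ_offset)
qed

text \<open>A substitute for dominated convergence. Fatou's lemma gives the lower bound. For the upper bound
  choose a compact \<open>K \<subseteq> V\<close> of almost full measure and a grid so fine that every cell which meets \<open>K\<close>
  lies in a set where the functions are uniformly bounded; dominated convergence applies on these
  cells. The other cells have small total length and are controlled by \<open>small\<close>, whose error \<open>r n\<close>
  occurs only as often as the fixed grid has cells.\<close>
lemma tendsto_nn_integral_by_intervals:
  fixes G :: "nat \<Rightarrow> real \<Rightarrow> ennreal" and L :: "real \<Rightarrow> ennreal" and T C :: real
  assumes G [measurable]: "\<And>n. G n \<in> borel_measurable borel" and L [measurable]: "L \<in> borel_measurable borel"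
    and V: "open V" "AE x in lborel. x \<in> V"
    and lim: "\<And>x. x \<in> V \<Longrightarrow> (\<lambda>n. G n x) \<longlonglongrightarrow> L x"
    and loc: "\<And>x. x \<in> V \<Longrightarrow> \<exists>\<delta>>0. \<exists>H. \<forall>\<^sub>F n in sequentially. \<forall>y\<in>ball x \<delta>. G n y \<le> ennreal H"
    and T: "T > 0" and C: "C \<ge> 0" and r: "r \<longlonglongrightarrow> 0"
    and small: "\<forall>\<^sub>F n in sequentially. \<forall>p q. 0 \<le> p \<longrightarrow> p < q \<longrightarrow> q \<le> T \<longrightarrow> q - p < T \<longrightarrow>
        (\<integral>\<^sup>+x. G n x * indicator {p..q} x \<partial>lborel) \<le> ennreal (C * (q - p) + r n)"
    and fin: "(\<integral>\<^sup>+x. L x * indicator {0..T} x \<partial>lborel) < \<infinity>"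
  shows "(\<lambda>n. \<integral>\<^sup>+x. G n x * indicator {0..T} x \<partial>lborel) \<longlonglongrightarrow> (\<integral>\<^sup>+x. L x * indicator {0..T} x \<partial>lborel)"
proof -
  define I where "I = (\<integral>\<^sup>+x. L x * indicator {0..T} x \<partial>lborel)"
  have "I = (\<integral>\<^sup>+x. liminf (\<lambda>n. G n x * indicator {0..T} x) \<partial>lborel)"
    unfolding I_def
  proof (intro nn_integral_cong_AE, use V(2) in eventually_elim)
    case (elim x)
    then have "(\<lambda>n. G n x * indicator {0..T} x) \<longlonglongrightarrow> L x * indicator {0..T} x"
      using lim[of x] by (cases "x \<in> {0..T}") auto
    then show ?case by (simp add: lim_imp_Liminf)
  qed
  also have "\<dots> \<le> liminf (\<lambda>n. \<integral>\<^sup>+x. G n x * indicator {0..T} x \<partial>lborel)"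
    by (rule nn_integral_liminf) measurable
  finally have lower: "I \<le> liminf (\<lambda>n. \<integral>\<^sup>+x. G n x * indicator {0..T} x \<partial>lborel)" .
  have upper: "\<forall>\<^sub>F n in sequentially. (\<integral>\<^sup>+x. G n x * indicator {0..T} x \<partial>lborel) \<le> I + ennreal ((C + 2) * \<epsilon>)"
    if \<epsilon>: "\<epsilon> > 0" for \<epsilon>
  proof -
    have [measurable]: "V \<in> sets borel" using V(1) by (rule borel_open)
    have "V \<inter> {0..T} \<in> sets lborel" by measurable
    then have VT: "V \<inter> {0..T} \<in> sets lebesgue" by (rule sets_completionI_sets)
    obtain K where K: "closed K" "K \<subseteq> V \<inter> {0..T}" "V \<inter> {0..T} - K \<in> lmeasurable"
      "emeasure lebesgue (V \<inter> {0..T} - K) < ennreal \<epsilon>"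
      by (rule sets_lebesgue_inner_closed[OF VT \<epsilon>])
    have "K \<subseteq> {0..T}" using K(2) by auto
    then have "bounded K" by (rule bounded_subset[OF bounded_closed_interval])
    then have cK: "compact K" using K(1) by (simp add: compact_eq_bounded_closed)
    have [measurable]: "K \<in> sets borel" using K(1) by simp
    have outside: "emeasure lborel ({0..T} - K) < ennreal \<epsilon>"
    proof -
      have "emeasure lborel ({0..T} - K) = emeasure lborel (V \<inter> {0..T} - K)"
        by (intro emeasure_eq_AE eventually_mono[OF V(2)]) auto
      also have "\<dots> = emeasure lebesgue (V \<inter> {0..T} - K)" by simp
      finally show ?thesis using K(4) by simp
    qed
    define good where "good B \<longleftrightarrow> (\<exists>H. \<forall>\<^sub>F n in sequentially. \<forall>y\<in>B. G n y \<le> ennreal H)" for B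
    have good_mono: "good B'" if "good B" "B' \<subseteq> B" for B B'
    proof -
      obtain H where "\<forall>\<^sub>F n in sequentially. \<forall>y\<in>B. G n y \<le> ennreal H"
        using \<open>good B\<close> unfolding good_def by blast
      then have "\<forall>\<^sub>F n in sequentially. \<forall>y\<in>B'. G n y \<le> ennreal H"
        by eventually_elim (use \<open>B' \<subseteq> B\<close> in blast)
      then show ?thesis unfolding good_def by blast
    qed
    obtain e where e: "e > 0" "\<And>x. x \<in> K \<Longrightarrow> good (ball x e)"
    proof -
      have "\<exists>\<delta>. \<forall>x\<in>K. \<delta> x > 0 \<and> good (ball x (\<delta> x))"
        using K(2) loc unfolding good_def by (intro bchoice) blast
      then obtain \<delta> where \<delta>: "\<And>x. x \<in> K \<Longrightarrow> \<delta> x > 0 \<and> good (ball x (\<delta> x))" by blast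
      have "K \<subseteq> (\<Union>x\<in>K. ball x (\<delta> x / 2))" using \<delta> by fastforce
      then obtain X where X: "X \<subseteq> K" "finite X" "K \<subseteq> (\<Union>x\<in>X. ball x (\<delta> x / 2))"
        using compactE_image[OF cK, of K "\<lambda>x. ball x (\<delta> x / 2)"] by auto
      define e where "e = Min (insert 1 ((\<lambda>x. \<delta> x / 2) ` X))"
      have "e > 0" using X \<delta> unfolding e_def by (subst Min_gr_iff) auto
      moreover have "good (ball y e)" if "y \<in> K" for y
      proof -
        obtain x where x: "x \<in> X" "y \<in> ball x (\<delta> x / 2)" using X(3) \<open>y \<in> K\<close> by auto
        have "e \<le> \<delta> x / 2" unfolding e_def using x X(2) by (intro Min_le) auto
        have "ball y e \<subseteq> ball x (\<delta> x)"
        proof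
          fix z assume "z \<in> ball y e"
          then show "z \<in> ball x (\<delta> x)"
            using dist_triangle[of x z y] x(2) \<open>e \<le> \<delta> x / 2\<close> by simp
        qed
        then show ?thesis using \<delta>[of x] x(1) X(1) good_mono by blast
      qed
      ultimately show thesis by (rule that)
    qed
    obtain m :: nat where "2 < m" and m_gt: "T / e < real m"
      using reals_Archimedean2[of "max 2 (T / e)"] by auto
    then have m: "m \<ge> 2" "T / e < real m" by auto
    define h where "h = T / real m"
    have h: "h > 0" "h < e" "h < T" "real m * h = T"
    proof -
      show "h > 0" "real m * h = T" using T m unfolding h_def by auto
      have "T < e * real m" using m e by (simp add: divide_less_eq mult.commute)
      then show "h < e" using m unfolding h_def by (simp add: divide_less_eq)
      have "T * 1 < T * real m" using T m by (intro mult_strict_left_mono) auto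
      then show "h < T" using m unfolding h_def by (simp add: divide_less_eq)
    qed
    define J where "J i = {real i * h..real (Suc i) * h}" for i
    define A where "A = {i. i < m \<and> J i \<inter> K \<noteq> {}}"
    define B where "B = {i. i < m \<and> J i \<inter> K = {}}"
    have AB: "finite A" "finite B" "A \<inter> B = {}" "{..<m} = A \<union> B" by (auto simp: A_def B_def)
    have J_sub: "0 \<le> real i * h" "real (Suc i) * h \<le> T" if "i < m" for i
    proof -
      show "0 \<le> real i * h" using h by simp
      have "real (Suc i) * h \<le> real m * h" using that h by (intro mult_right_mono) auto
      then show "real (Suc i) * h \<le> T" by (simp only: h)
    qed
    have J_len: "real (Suc i) * h - real i * h = h" for i by (simp add: algebra_simps)
    let ?u = "\<lambda>n i. \<integral>\<^sup>+x. G n x * indicator (J i) x \<partial>lborel"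
    let ?v = "\<lambda>i. \<integral>\<^sup>+x. L x * indicator (J i) x \<partial>lborel"
    have total: "(\<integral>\<^sup>+x. G n x * indicator {0..T} x \<partial>lborel) = (\<Sum>i\<in>A. ?u n i) + (\<Sum>i\<in>B. ?u n i)" for n
    proof -
      have "(\<integral>\<^sup>+x. G n x * indicator {0..T} x \<partial>lborel) = (\<Sum>i<m. ?u n i)"
        using nn_integral_grid[OF G, of h n m] h unfolding J_def by simp
      then show ?thesis using AB by (simp add: sum.union_disjoint)
    qed
    have totalL: "(\<Sum>i\<in>A. ?v i) \<le> I"
    proof -
      have "I = (\<Sum>i<m. ?v i)"
        using nn_integral_grid[OF L, of h m] h unfolding J_def I_def by simp
      moreover have "(\<Sum>i\<in>A. ?v i) \<le> (\<Sum>i<m. ?v i)" by (intro sum_mono2) (auto simp: A_def)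
      ultimately show ?thesis by simp
    qed
    have "(\<lambda>n. \<Sum>i\<in>A. ?u n i) \<longlonglongrightarrow> (\<Sum>i\<in>A. ?v i)"
    proof (intro tendsto_sum)
      fix i assume "i \<in> A"
      then obtain x where x: "x \<in> J i" "x \<in> K" by (auto simp: A_def)
      have "J i \<subseteq> ball x e"
        using x h J_len[of i] unfolding J_def by (auto simp: dist_real_def)
      then have "good (J i)" using good_mono e(2)[OF x(2)] by blast
      then obtain H where "\<forall>\<^sub>F n in sequentially. \<forall>y\<in>J i. G n y \<le> ennreal H" unfolding good_def by blast
      then show "(\<lambda>n. ?u n i) \<longlonglongrightarrow> ?v i"
        unfolding J_def using tendsto_nn_integral_interval[OF G L V(2) lim] by blast
    qed
    moreover have "(\<Sum>i\<in>A. ?v i) < I + ennreal \<epsilon>"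
    proof -
      have "I + 0 < I + ennreal \<epsilon>"
        using fin \<epsilon> unfolding I_def[symmetric] by (subst ennreal_add_left_cancel_less) auto
      then have "I < I + ennreal \<epsilon>" by simp
      with totalL show ?thesis by (rule order_le_less_trans)
    qed
    ultimately have evA: "\<forall>\<^sub>F n in sequentially. (\<Sum>i\<in>A. ?u n i) < I + ennreal \<epsilon>" by (rule order_tendstoD)
    \<comment> \<open>The bad cells avoid \<open>K\<close>, so their total length is at most the measure of \<open>[0, T] - K\<close>.\<close>
    have cardB: "real (card B) * h < \<epsilon>"
    proof -
      have "ennreal (real (card B) * h) = (\<Sum>i\<in>B. \<integral>\<^sup>+x. 1 * indicator (J i) x \<partial>lborel)"
      proof -
        have "(\<integral>\<^sup>+x. 1 * indicator (J i) x \<partial>lborel) = ennreal h" for i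
        proof -
          have "real i * h \<le> real (Suc i) * h" using h by (intro mult_right_mono) auto
          then have "emeasure lborel (J i) = ennreal (real (Suc i) * h - real i * h)"
            unfolding J_def by (rule emeasure_lborel_Icc)
          moreover have "J i \<in> sets lborel" unfolding J_def by simp
          ultimately show ?thesis unfolding J_len by simp
        qed
        then show ?thesis using h by (simp add: ennreal_mult ennreal_of_nat_eq_real_of_nat)
      qed
      also have "\<dots> \<le> (\<Sum>i\<in>B. \<integral>\<^sup>+x. indicator (- K) x * indicator (J i) x \<partial>lborel)"
        by (intro sum_mono nn_integral_mono) (auto simp: B_def indicator_def)
      also have "\<dots> \<le> (\<Sum>i<m. \<integral>\<^sup>+x. indicator (- K) x * indicator (J i) x \<partial>lborel)"
        by (intro sum_mono2) (auto simp: B_def)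
      also have "\<dots> = (\<integral>\<^sup>+x. indicator (- K) x * indicator {0..T} x \<partial>lborel)"
        using nn_integral_grid[of "indicator (- K)" h m] h unfolding J_def by simp
      also have "\<dots> = (\<integral>\<^sup>+x. indicator ({0..T} - K) x \<partial>lborel)"
        by (intro nn_integral_cong) (auto simp: indicator_def)
      also have "\<dots> < ennreal \<epsilon>" using outside by simp
      finally show ?thesis using h by (simp add: ennreal_less_iff)
    qed
    have "(\<lambda>n. real (card B) * r n) \<longlonglongrightarrow> real (card B) * 0" by (intro tendsto_intros r)
    then have evr: "\<forall>\<^sub>F n in sequentially. real (card B) * r n < \<epsilon>" using \<epsilon> by (intro order_tendstoD) auto
    show ?thesis
      using evA evr small
    proof eventually_elim
      case (elim n)
      have "(\<Sum>i\<in>B. ?u n i) \<le> (\<Sum>i\<in>B. ennreal (C * h + r n))"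
      proof (rule sum_mono)
        fix i assume "i \<in> B"
        then have i: "i < m" by (simp add: B_def)
        have "real i * h < real (Suc i) * h" using h by simp
        then have "?u n i \<le> ennreal (C * (real (Suc i) * h - real i * h) + r n)"
          unfolding J_def using J_sub[OF i] J_len[of i] h(3)
          by (intro elim(3)[rule_format]) auto
        then show "?u n i \<le> ennreal (C * h + r n)" unfolding J_len .
      qed
      also have "\<dots> = ennreal (real (card B) * (C * h + r n))"
        by (cases "C * h + r n \<ge> 0") (simp_all add: ennreal_mult ennreal_of_nat_eq_real_of_nat ennreal_neg mult_nonneg_nonpos)
      also have "\<dots> \<le> ennreal ((C + 1) * \<epsilon>)"
      proof (rule ennreal_leI)
        have "C * (real (card B) * h) \<le> C * \<epsilon>" using cardB C by (intro mult_left_mono) auto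
        then show "real (card B) * (C * h + r n) \<le> (C + 1) * \<epsilon>" using elim(2) by (simp add: algebra_simps)
      qed
      finally have "(\<integral>\<^sup>+x. G n x * indicator {0..T} x \<partial>lborel) \<le> (I + ennreal \<epsilon>) + ennreal ((C + 1) * \<epsilon>)"
        unfolding total using elim(1) by (intro add_mono) auto
      also have "\<dots> = I + ennreal ((C + 2) * \<epsilon>)"
        using \<epsilon> C by (simp add: add.assoc ennreal_plus[symmetric] algebra_simps del: ennreal_plus)
      finally show ?case .
    qed
  qed
  show ?thesis unfolding I_def[symmetric]
  proof (rule order_tendstoI)
    fix a assume "a < I"
    then show "\<forall>\<^sub>F n in sequentially. a < (\<integral>\<^sup>+x. G n x * indicator {0..T} x \<partial>lborel)"
      using lower by (intro less_LiminfD) auto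
  next
    fix a assume a: "I < a"
    obtain i where i: "I = ennreal i" "i \<ge> 0" using fin unfolding I_def[symmetric] by (cases I) auto
    have "\<exists>\<epsilon>>0. I + ennreal ((C + 2) * \<epsilon>) < a"
    proof (cases a)
      case (real a')
      then have lt: "i < a'" using a i by (simp add: ennreal_less_iff)
      define \<epsilon> where "\<epsilon> = (a' - i) / (2 * (C + 2))"
      have pos: "\<epsilon> > 0" and half: "(C + 2) * \<epsilon> = (a' - i) / 2" using lt C by (auto simp: \<epsilon>_def field_simps)
      have "I + ennreal ((a' - i) / 2) < a"
        using lt i real by (simp add: ennreal_plus[symmetric] ennreal_less_iff field_simps del: ennreal_plus)
      then show ?thesis using pos unfolding half[symmetric] by blast
    next
      case top
      then show ?thesis using i by (intro exI[of _ 1]) (auto simp: ennreal_plus[symmetric] simp del: ennreal_plus)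
    qed
    then obtain \<epsilon> where \<epsilon>: "\<epsilon> > 0" "I + ennreal ((C + 2) * \<epsilon>) < a" by blast
    from upper[OF \<epsilon>(1)] show "\<forall>\<^sub>F n in sequentially. (\<integral>\<^sup>+x. G n x * indicator {0..T} x \<partial>lborel) < a"
      by eventually_elim (use \<epsilon>(2) in auto)
  qed
qed

section \<open>Covariances of the random polynomial\<close>

definition trig_poly_deriv :: "(nat \<Rightarrow> real) \<Rightarrow> (nat \<Rightarrow> real) \<Rightarrow> nat \<Rightarrow> real \<Rightarrow> real" where
  "trig_poly_deriv a b n x = 1 / sqrt (real n) * (\<Sum>k=1..n. real k * (b k * cos (real k * x) - a k * sin (real k * x)))"

text \<open>The characteristic function at \<open>1\<close>, split into real and imaginary part. The almost surely
  constant variables are the case of variance \<open>0\<close>.\<close>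
lemma (in prob_space) gaussian_rv_cos_sin:
  assumes g: "gaussian_rv M X" and X: "integrable M X" "expectation X = 0"
  shows "expectation (\<lambda>\<omega>. cos (X \<omega>)) = exp (- expectation (\<lambda>\<omega>. (X \<omega>)\<^sup>2) / 2)"
    and "expectation (\<lambda>\<omega>. sin (X \<omega>)) = 0"
proof -
  have [measurable]: "X \<in> borel_measurable M" using X by auto
  have "(expectation (\<lambda>\<omega>. cos (X \<omega>)) = exp (- expectation (\<lambda>\<omega>. (X \<omega>)\<^sup>2) / 2)) \<and> expectation (\<lambda>\<omega>. sin (X \<omega>)) = 0"
    using g unfolding gaussian_rv_def
  proof (elim conjE disjE exE)
    fix m assume m: "AE \<omega> in M. X \<omega> = m"
    have "expectation X = (\<integral>\<omega>. m \<partial>M)" using m by (intro integral_cong_AE) auto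
    then have "m = 0" using X by (simp add: prob_space)
    then have 0: "AE \<omega> in M. X \<omega> = 0" using m by simp
    have "expectation (\<lambda>\<omega>. cos (X \<omega>)) = (\<integral>\<omega>. 1 \<partial>M)" "expectation (\<lambda>\<omega>. (X \<omega>)\<^sup>2) = (\<integral>\<omega>. 0 \<partial>M)"
      "expectation (\<lambda>\<omega>. sin (X \<omega>)) = (\<integral>\<omega>. 0 \<partial>M)"
      by (rule integral_cong_AE; use 0 in \<open>auto elim: eventually_mono\<close>)+
    then show ?thesis by (simp add: prob_space)
  next
    fix m \<sigma> :: real
    assume \<sigma>: "0 < \<sigma>" and D: "distributed M lborel X (\<lambda>x. ennreal (normal_density m \<sigma> x))"
    have m: "m = 0" using normal_distributed_expectation[OF \<sigma> D] X by simp
    have v: "expectation (\<lambda>\<omega>. (X \<omega>)\<^sup>2) = \<sigma>\<^sup>2"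
      using normal_distributed_variance[OF \<sigma> D] X by simp
    have D0: "distributed M lborel X (\<lambda>x. ennreal (normal_density 0 \<sigma> x))" using D m by simp
    have c: "expectation (\<lambda>\<omega>. cos (X \<omega>)) = (\<integral>x. normal_density 0 \<sigma> x * cos (1 * x) \<partial>lborel)"
      by (subst distributed_integral[OF D0]) auto
    have s: "expectation (\<lambda>\<omega>. sin (X \<omega>)) = (\<integral>x. normal_density 0 \<sigma> x * sin x \<partial>lborel)"
      by (subst distributed_integral[OF D0]) auto
    have "(\<integral>x. normal_density 0 \<sigma> x * sin x \<partial>lborel) = \<bar>- 1\<bar> *\<^sub>R (\<integral>x. normal_density 0 \<sigma> (0 + (- 1) * x) * sin (0 + (- 1) * x) \<partial>lborel)"
      by (rule lborel_integral_real_affine) simp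
    also have "\<dots> = - (\<integral>x. normal_density 0 \<sigma> x * sin x \<partial>lborel)"
      by (simp add: normal_density_def)
    finally have "(\<integral>x. normal_density 0 \<sigma> x * sin x \<partial>lborel) = 0" by simp
    then show ?thesis
      unfolding c s v integral_normal_density_cos(2)[OF \<sigma>] by simp
  qed
  then show "expectation (\<lambda>\<omega>. cos (X \<omega>)) = exp (- expectation (\<lambda>\<omega>. (X \<omega>)\<^sup>2) / 2)"
    and "expectation (\<lambda>\<omega>. sin (X \<omega>)) = 0" by auto
qed

lemma (in prob_space) expectation_cos_indep_sum:
  fixes P Q :: "'a \<Rightarrow> real"
  assumes ind: "indep_var borel P borel Q"
    and P: "expectation (\<lambda>\<omega>. cos (P \<omega>)) = exp (- v / 2)" "expectation (\<lambda>\<omega>. sin (P \<omega>)) = 0"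
    and Q: "expectation (\<lambda>\<omega>. cos (Q \<omega>)) = exp (- w / 2)" "expectation (\<lambda>\<omega>. sin (Q \<omega>)) = 0"
  shows "expectation (\<lambda>\<omega>. cos (P \<omega> + Q \<omega>)) = exp (- (v + w) / 2)"
proof -
  have [measurable]: "P \<in> borel_measurable M" "Q \<in> borel_measurable M"
    using indep_var_rv1[OF ind] indep_var_rv2[OF ind] by auto
  have int: "integrable M (\<lambda>\<omega>. f (P \<omega>))" "integrable M (\<lambda>\<omega>. f (Q \<omega>))"
    if [measurable]: "f \<in> borel_measurable borel" and "\<And>x. \<bar>f x\<bar> \<le> 1" for f :: "real \<Rightarrow> real"
    using that by (auto intro!: integrable_const_bound[where B=1])
  have prod: "expectation (\<lambda>\<omega>. f (P \<omega>) * f (Q \<omega>)) = expectation (\<lambda>\<omega>. f (P \<omega>)) * expectation (\<lambda>\<omega>. f (Q \<omega>))"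
    "integrable M (\<lambda>\<omega>. f (P \<omega>) * f (Q \<omega>))"
    if f: "f \<in> borel_measurable borel" "\<And>x. \<bar>f x\<bar> \<le> 1" for f :: "real \<Rightarrow> real"
    using indep_var_compose[unfolded comp_def, OF ind f(1) f(1)] int[OF f]
    by (auto intro!: indep_var_lebesgue_integral indep_var_integrable)
  have "expectation (\<lambda>\<omega>. cos (P \<omega> + Q \<omega>)) = expectation (\<lambda>\<omega>. cos (P \<omega>) * cos (Q \<omega>)) - expectation (\<lambda>\<omega>. sin (P \<omega>) * sin (Q \<omega>))"
    unfolding cos_add by (rule Bochner_Integration.integral_diff) (auto intro!: prod)
  also have "\<dots> = exp (- v / 2) * exp (- w / 2)"
    using prod(1)[of cos] prod(1)[of sin] P Q by simp
  finally show ?thesis by (simp add: exp_add[symmetric] add_divide_distrib diff_divide_distrib)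
qed

text \<open>Both sides are the squared modulus of \<open>\<Sum> (\<alpha> + i \<beta> k) e\<^sup>i\<^sup>k\<^sup>t\<close>: multiply by the phase
  \<open>e\<^sup>-\<^sup>i\<^sup>c\<^sup>t\<close> with \<open>c = (n + 1) / 2\<close>, and split \<open>k\<close> as \<open>c + (k - c)\<close>.\<close>
lemma double_sum_kernel:
  "(\<Sum>k=1..n. \<Sum>l=1..n. (\<alpha>\<^sup>2 + \<beta>\<^sup>2 * (real k * real l)) * cos ((real k - real l) * t) - \<alpha> * \<beta> * (real k - real l) * sin ((real k - real l) * t))
     = (\<alpha> * dirichlet n t + \<beta> * dirichlet' n t)\<^sup>2 + \<beta>\<^sup>2 * (mid n)\<^sup>2 * (dirichlet n t)\<^sup>2"
proof -
  define p where "p k = (real k - mid n) * t" for k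
  define u where "u k = \<alpha> * cos (p k) - \<beta> * real k * sin (p k)" for k
  define v where "v k = \<alpha> * sin (p k) + \<beta> * real k * cos (p k)" for k
  have s0: "(\<Sum>k=1..n. sin (p k)) = 0"
    unfolding p_def by (rule sum_mid_odd[of "\<lambda>x. sin (x * t)"]) simp
  have c0: "(\<Sum>k=1..n. (real k - mid n) * cos (p k)) = 0"
    unfolding p_def by (rule sum_mid_odd[of "\<lambda>x. x * cos (x * t)"]) simp
  have D: "(\<Sum>k=1..n. cos (p k)) = dirichlet n t" "(\<Sum>k=1..n. (real k - mid n) * sin (p k)) = - dirichlet' n t"
    by (simp_all add: dirichlet_def dirichlet'_def p_def)
  have "(\<Sum>k=1..n. u k) = (\<Sum>k=1..n. \<alpha> * cos (p k) - \<beta> * ((real k - mid n) * sin (p k)) - \<beta> * mid n * sin (p k))"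
    by (intro sum.cong) (auto simp: u_def algebra_simps)
  also have "\<dots> = \<alpha> * dirichlet n t + \<beta> * dirichlet' n t"
    unfolding sum_subtractf sum_distrib_left[symmetric] s0 D by simp
  finally have su: "(\<Sum>k=1..n. u k) = \<alpha> * dirichlet n t + \<beta> * dirichlet' n t" .
  have "(\<Sum>k=1..n. v k) = (\<Sum>k=1..n. \<alpha> * sin (p k) + \<beta> * ((real k - mid n) * cos (p k)) + \<beta> * mid n * cos (p k))"
    by (intro sum.cong) (auto simp: v_def algebra_simps)
  also have "\<dots> = \<beta> * mid n * dirichlet n t"
    unfolding sum.distrib sum_distrib_left[symmetric] s0 c0 D by simp
  finally have sv: "(\<Sum>k=1..n. v k) = \<beta> * mid n * dirichlet n t" .
  have "(\<Sum>k=1..n. \<Sum>l=1..n. (\<alpha>\<^sup>2 + \<beta>\<^sup>2 * (real k * real l)) * cos ((real k - real l) * t) - \<alpha> * \<beta> * (real k - real l) * sin ((real k - real l) * t))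
     = (\<Sum>k=1..n. \<Sum>l=1..n. u k * u l + v k * v l)"
  proof (intro sum.cong refl)
    fix k l
    have e: "(real k - real l) * t = p k - p l" by (simp add: p_def algebra_simps)
    show "(\<alpha>\<^sup>2 + \<beta>\<^sup>2 * (real k * real l)) * cos ((real k - real l) * t) - \<alpha> * \<beta> * (real k - real l) * sin ((real k - real l) * t) = u k * u l + v k * v l"
      unfolding e cos_diff sin_diff u_def v_def by (simp add: power2_eq_square algebra_simps)
  qed
  also have "\<dots> = (\<Sum>k=1..n. u k)\<^sup>2 + (\<Sum>k=1..n. v k)\<^sup>2"
    by (simp add: sum.distrib power2_eq_square sum_product)
  finally show ?thesis unfolding su sv by (simp add: power_mult_distrib)
qed

text \<open>The hypotheses of the theorem after the spectral measure has been replaced by its density.\<close>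
locale random_trig_poly = prob_space M + circle_density \<psi>
  for M :: "'a measure" and \<psi> :: "real \<Rightarrow> real" +
  fixes a b :: "nat \<Rightarrow> 'a \<Rightarrow> real"
  assumes gauss: "gaussian_sequence M a" "gaussian_sequence M b"
    and centered: "centered_sequence M a" "centered_sequence M b"
    and corr_a: "\<And>k l. k \<ge> 1 \<Longrightarrow> l \<ge> 1 \<Longrightarrow> integrable M (\<lambda>\<omega>. a k \<omega> * a l \<omega>) \<and>
      expectation (\<lambda>\<omega>. a k \<omega> * a l \<omega>) = (\<integral>u. cos ((real k - real l) * u) * \<psi> u \<partial>circle)"
    and corr_b: "\<And>k l. k \<ge> 1 \<Longrightarrow> l \<ge> 1 \<Longrightarrow> integrable M (\<lambda>\<omega>. b k \<omega> * b l \<omega>) \<and>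
      expectation (\<lambda>\<omega>. b k \<omega> * b l \<omega>) = (\<integral>u. cos ((real k - real l) * u) * \<psi> u \<partial>circle)"
    and no_sin: "\<And>k l. k \<ge> 1 \<Longrightarrow> l \<ge> 1 \<Longrightarrow> (\<integral>u. sin ((real k - real l) * u) * \<psi> u \<partial>circle) = 0"
    and indep: "indep_var path_space (sample_path a) path_space (sample_path b)"
begin

definition sample where "sample n x \<omega> = trig_poly (\<lambda>k. a k \<omega>) (\<lambda>k. b k \<omega>) n x"
definition sample_deriv where "sample_deriv n x \<omega> = trig_poly_deriv (\<lambda>k. a k \<omega>) (\<lambda>k. b k \<omega>) n x"

lemma coeff_measurable:
  "k \<ge> 1 \<Longrightarrow> a k \<in> borel_measurable M" "k \<ge> 1 \<Longrightarrow> b k \<in> borel_measurable M"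
  using centered unfolding centered_sequence_def by auto

lemma linear_combination:
  assumes g: "gaussian_sequence M X" and cen: "centered_sequence M X"
    and corr: "\<And>k l. k \<ge> 1 \<Longrightarrow> l \<ge> 1 \<Longrightarrow> integrable M (\<lambda>\<omega>. X k \<omega> * X l \<omega>) \<and>
      expectation (\<lambda>\<omega>. X k \<omega> * X l \<omega>) = (\<integral>u. cos ((real k - real l) * u) * \<psi> u \<partial>circle)"
  shows "expectation (\<lambda>\<omega>. cos (\<Sum>k=1..n. c k * X k \<omega>))
      = exp (- (\<Sum>k=1..n. \<Sum>l=1..n. c k * c l * (\<integral>u. cos ((real k - real l) * u) * \<psi> u \<partial>circle)) / 2)"
    and "expectation (\<lambda>\<omega>. sin (\<Sum>k=1..n. c k * X k \<omega>)) = 0"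
proof -
  have int: "integrable M (X k)" "expectation (X k) = 0" if "k \<in> {1..n}" for k
    using cen that unfolding centered_sequence_def by auto
  have 1: "integrable M (\<lambda>\<omega>. \<Sum>k=1..n. c k * X k \<omega>)"
    by (intro Bochner_Integration.integrable_sum integrable_mult_right int)
  have "expectation (\<lambda>\<omega>. \<Sum>k=1..n. c k * X k \<omega>) = (\<Sum>k=1..n. expectation (\<lambda>\<omega>. c k * X k \<omega>))"
    by (intro Bochner_Integration.integral_sum integrable_mult_right int)
  also have "\<dots> = 0" using int by (intro sum.neutral) auto
  finally have 2: "expectation (\<lambda>\<omega>. \<Sum>k=1..n. c k * X k \<omega>) = 0" .
  have 3: "gaussian_rv M (\<lambda>\<omega>. \<Sum>k=1..n. c k * X k \<omega>)" using g unfolding gaussian_sequence_def by blast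
  have "expectation (\<lambda>\<omega>. (\<Sum>k=1..n. c k * X k \<omega>)\<^sup>2) = expectation (\<lambda>\<omega>. \<Sum>k=1..n. \<Sum>l=1..n. c k * c l * (X k \<omega> * X l \<omega>))"
    by (simp add: power2_eq_square sum_product mult_ac)
  also have "\<dots> = (\<Sum>k=1..n. expectation (\<lambda>\<omega>. \<Sum>l=1..n. c k * c l * (X k \<omega> * X l \<omega>)))"
    using corr by (intro Bochner_Integration.integral_sum Bochner_Integration.integrable_sum integrable_mult_right) auto
  also have "\<dots> = (\<Sum>k=1..n. \<Sum>l=1..n. expectation (\<lambda>\<omega>. c k * c l * (X k \<omega> * X l \<omega>)))"
    using corr by (intro sum.cong refl Bochner_Integration.integral_sum integrable_mult_right) auto
  also have "\<dots> = (\<Sum>k=1..n. \<Sum>l=1..n. c k * c l * (\<integral>u. cos ((real k - real l) * u) * \<psi> u \<partial>circle))"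
    using corr by (intro sum.cong refl) auto
  finally have v: "expectation (\<lambda>\<omega>. (\<Sum>k=1..n. c k * X k \<omega>)\<^sup>2) = (\<Sum>k=1..n. \<Sum>l=1..n. c k * c l * (\<integral>u. cos ((real k - real l) * u) * \<psi> u \<partial>circle))" .
  show "expectation (\<lambda>\<omega>. cos (\<Sum>k=1..n. c k * X k \<omega>))
      = exp (- (\<Sum>k=1..n. \<Sum>l=1..n. c k * c l * (\<integral>u. cos ((real k - real l) * u) * \<psi> u \<partial>circle)) / 2)"
    and "expectation (\<lambda>\<omega>. sin (\<Sum>k=1..n. c k * X k \<omega>)) = 0"
    using gaussian_rv_cos_sin[OF 3 1 2] unfolding v by auto
qed

lemma indep_linear_combinations:
  "indep_var borel (\<lambda>\<omega>. \<Sum>k=1..n. c k * a k \<omega>) borel (\<lambda>\<omega>. \<Sum>k=1..n. d k * b k \<omega>)"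
proof -
  have m: "(\<lambda>f. \<Sum>k=1..n. c k * f k) \<in> path_space \<rightarrow>\<^sub>M borel" for c :: "nat \<Rightarrow> real"
    by (intro borel_measurable_sum borel_measurable_times borel_measurable_const measurable_component_singleton) auto
  have e: "(\<lambda>f. \<Sum>k=1..n. c k * f k) \<circ> sample_path X = (\<lambda>\<omega>. \<Sum>k=1..n. c k * X k \<omega>)" for c :: "nat \<Rightarrow> real" and X :: "nat \<Rightarrow> 'a \<Rightarrow> real"
    by (auto simp: fun_eq_iff sample_path_def intro!: sum.cong)
  show ?thesis using indep_var_compose[OF indep m m, of c d] unfolding e .
qed

lemma sample_measurable_pair:
  "(\<lambda>(\<omega>, x). sample n x \<omega>) \<in> borel_measurable (M \<Otimes>\<^sub>M lborel)" "(\<lambda>(\<omega>, x). sample_deriv n x \<omega>) \<in> borel_measurable (M \<Otimes>\<^sub>M lborel)"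
proof -
  have [measurable]: "(\<lambda>z. a k (fst z)) \<in> borel_measurable (M \<Otimes>\<^sub>M lborel)" "(\<lambda>z. b k (fst z)) \<in> borel_measurable (M \<Otimes>\<^sub>M lborel)"
    if "k \<in> {1..n}" for k
    using that coeff_measurable[of k] by (auto intro: measurable_compose[OF measurable_fst])
  show "(\<lambda>(\<omega>, x). sample n x \<omega>) \<in> borel_measurable (M \<Otimes>\<^sub>M lborel)"
    unfolding sample_def trig_poly_def case_prod_beta by (intro borel_measurable_times borel_measurable_sum borel_measurable_add) measurable
  show "(\<lambda>(\<omega>, x). sample_deriv n x \<omega>) \<in> borel_measurable (M \<Otimes>\<^sub>M lborel)"
    unfolding sample_deriv_def trig_poly_deriv_def case_prod_beta by (intro borel_measurable_times borel_measurable_sum borel_measurable_diff) measurable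
qed

lemma sample_measurable: "sample n x \<in> borel_measurable M" "sample_deriv n x \<in> borel_measurable M"
  using measurable_compose[OF measurable_Pair2'[of x lborel M] sample_measurable_pair(1)]
    measurable_compose[OF measurable_Pair2'[of x lborel M] sample_measurable_pair(2)] by simp_all

text \<open>Since \<open>\<integral> sin ((k - l) u) \<psi>(u) du = 0\<close>, multiplying the correlation by \<open>cos ((k - l) x)\<close> or
  \<open>sin ((k - l) x)\<close> translates the argument of the trigonometric function by \<open>x\<close>. The double sum then
  becomes the integral of the squared modulus of the preceding lemma against \<open>\<psi>(x - t)\<close>.\<close>
lemma covariance_sum:
  "(\<Sum>k=1..n. \<Sum>l=1..n. ((\<alpha>\<^sup>2 + \<beta>\<^sup>2 * (real k * real l)) * cos ((real k - real l) * x) - \<alpha> * \<beta> * (real k - real l) * sin ((real k - real l) * x))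
      * (\<integral>u. cos ((real k - real l) * u) * \<psi> u \<partial>circle))
    = mass n x * \<alpha>\<^sup>2 + 2 * cross n x * \<alpha> * \<beta> + (mass' n x + (mid n)\<^sup>2 * mass n x) * \<beta>\<^sup>2"
proof -
  define g where "g t = (\<alpha> * dirichlet n t + \<beta> * dirichlet' n t)\<^sup>2 + \<beta>\<^sup>2 * (mid n)\<^sup>2 * (dirichlet n t)\<^sup>2" for t
  define w1 where "w1 k l = \<alpha>\<^sup>2 + \<beta>\<^sup>2 * (real k * real l)" for k l :: nat
  define w2 where "w2 k l = \<alpha> * \<beta> * (real k - real l)" for k l :: nat
  have g_sum: "g t = (\<Sum>k=1..n. \<Sum>l=1..n. w1 k l * cos ((real k - real l) * t) - w2 k l * sin ((real k - real l) * t))" for t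
    unfolding g_def w1_def w2_def by (rule double_sum_kernel[symmetric])
  have int: "integrable circle (\<lambda>u. h u * \<psi> u)" if "continuous_on UNIV h" for h
    by (rule integrable_circle_mult_continuous[OF \<psi>_integrable that])
  have tm: "(w1 k l * cos ((real k - real l) * x) - w2 k l * sin ((real k - real l) * x)) * (\<integral>u. cos ((real k - real l) * u) * \<psi> u \<partial>circle)
      = (\<integral>u. (w1 k l * cos ((real k - real l) * (x - u)) - w2 k l * sin ((real k - real l) * (x - u))) * \<psi> u \<partial>circle)"
    if "k \<in> {1..n}" "l \<in> {1..n}" for k l
  proof -
    define m where "m = real k - real l"
    have 1: "integrable circle (\<lambda>u. cos (m * u) * \<psi> u)" "integrable circle (\<lambda>u. sin (m * u) * \<psi> u)"
      by (intro int continuous_intros)+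
    have "(\<integral>u. (w1 k l * cos (m * (x - u)) - w2 k l * sin (m * (x - u))) * \<psi> u \<partial>circle)
      = (\<integral>u. (w1 k l * cos (m * x) - w2 k l * sin (m * x)) * (cos (m * u) * \<psi> u) + (w1 k l * sin (m * x) + w2 k l * cos (m * x)) * (sin (m * u) * \<psi> u) \<partial>circle)"
      by (intro Bochner_Integration.integral_cong) (auto simp: right_diff_distrib[of m] cos_diff sin_diff algebra_simps)
    also have "\<dots> = (w1 k l * cos (m * x) - w2 k l * sin (m * x)) * (\<integral>u. cos (m * u) * \<psi> u \<partial>circle)
         + (w1 k l * sin (m * x) + w2 k l * cos (m * x)) * (\<integral>u. sin (m * u) * \<psi> u \<partial>circle)"
      using 1 by simp
    also have "(\<integral>u. sin (m * u) * \<psi> u \<partial>circle) = 0" unfolding m_def using that by (intro no_sin) auto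
    finally show ?thesis by (simp add: m_def)
  qed
  have per: "g (x - (u + 2 * pi)) * \<psi> (u + 2 * pi) = g (x - u) * \<psi> u" for u
  proof -
    have c: "cos ((real k - real l) * (x - (u + 2 * pi))) = cos ((real k - real l) * (x - u))"
      and s: "sin ((real k - real l) * (x - (u + 2 * pi))) = sin ((real k - real l) * (x - u))" for k l
    proof -
      have "(real k - real l) * (x - (u + 2 * pi)) = (real k - real l) * (x - u) - 2 * pi * of_int (int k - int l)" by (simp add: algebra_simps)
      then show "cos ((real k - real l) * (x - (u + 2 * pi))) = cos ((real k - real l) * (x - u))"
        "sin ((real k - real l) * (x - (u + 2 * pi))) = sin ((real k - real l) * (x - u))"
        by (simp_all only: cos_diff sin_diff cos_int_2pin sin_int_2pin mult_1_right mult_zero_right diff_zero add_0_right)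
    qed
    show ?thesis unfolding g_sum c s \<psi>_periodic ..
  qed
  have cg: "continuous_on UNIV g" unfolding g_def[abs_def] by (intro continuous_intros)
  have cgx: "continuous_on UNIV (\<lambda>u. g (x - u))"
    by (rule continuous_on_compose2[OF cg]) (auto intro!: continuous_intros)
  have [measurable]: "g \<in> borel_measurable borel" by (rule borel_measurable_continuous_onI[OF cg])
  have "(\<Sum>k=1..n. \<Sum>l=1..n. (w1 k l * cos ((real k - real l) * x) - w2 k l * sin ((real k - real l) * x)) * (\<integral>u. cos ((real k - real l) * u) * \<psi> u \<partial>circle))
     = (\<Sum>k=1..n. \<Sum>l=1..n. \<integral>u. (w1 k l * cos ((real k - real l) * (x - u)) - w2 k l * sin ((real k - real l) * (x - u))) * \<psi> u \<partial>circle)"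
    by (intro sum.cong refl tm)
  also have "\<dots> = (\<Sum>k=1..n. \<integral>u. (\<Sum>l=1..n. (w1 k l * cos ((real k - real l) * (x - u)) - w2 k l * sin ((real k - real l) * (x - u))) * \<psi> u) \<partial>circle)"
    by (intro sum.cong refl Bochner_Integration.integral_sum[symmetric] int continuous_intros)
  also have "\<dots> = (\<integral>u. (\<Sum>k=1..n. \<Sum>l=1..n. (w1 k l * cos ((real k - real l) * (x - u)) - w2 k l * sin ((real k - real l) * (x - u))) * \<psi> u) \<partial>circle)"
    by (intro Bochner_Integration.integral_sum[symmetric] Bochner_Integration.integrable_sum int continuous_intros)
  also have "\<dots> = (\<integral>u. g (x - u) * \<psi> u \<partial>circle)"
    unfolding g_sum sum_distrib_right ..
  also have "\<dots> = (\<integral>t. g t * \<psi> (x - t) \<partial>circle)"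
    using integral_circle_shift(2)[of "\<lambda>u. g (x - u) * \<psi> u" x] per int[OF cgx] by simp
  also have "\<dots> = (\<integral>t. \<alpha>\<^sup>2 * ((dirichlet n t)\<^sup>2 * \<psi> (x - t)) + 2 * \<alpha> * \<beta> * (dirichlet n t * dirichlet' n t * \<psi> (x - t))
      + \<beta>\<^sup>2 * ((dirichlet' n t)\<^sup>2 * \<psi> (x - t)) + \<beta>\<^sup>2 * (mid n)\<^sup>2 * ((dirichlet n t)\<^sup>2 * \<psi> (x - t)) \<partial>circle)"
    by (intro Bochner_Integration.integral_cong) (auto simp: g_def power2_sum power_mult_distrib algebra_simps)
  also have "\<dots> = \<alpha>\<^sup>2 * mass n x + 2 * \<alpha> * \<beta> * cross n x + \<beta>\<^sup>2 * mass' n x + \<beta>\<^sup>2 * (mid n)\<^sup>2 * mass n x"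
  proof -
    have i: "integrable circle (\<lambda>t. (dirichlet n t)\<^sup>2 * \<psi> (x - t))" "integrable circle (\<lambda>t. (dirichlet' n t)\<^sup>2 * \<psi> (x - t))"
      "integrable circle (\<lambda>t. dirichlet n t * dirichlet' n t * \<psi> (x - t))"
      by (intro integrable_mult_\<psi> continuous_intros)+
    show ?thesis unfolding mass_def mass'_def cross_def using i
      by (simp only: Bochner_Integration.integral_add integral_mult_right_zero Bochner_Integration.integrable_add integrable_mult_right)
  qed
  finally show ?thesis unfolding w1_def w2_def by (simp add: algebra_simps)
qed

lemma gaussian_pair_sample:
  assumes "n \<ge> 1"
  shows "gaussian_pair M (sample n x) (sample_deriv n x) (mass n x / real n) (cross n x / real n) ((mass' n x + (mid n)\<^sup>2 * mass n x) / real n)"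
proof (intro gaussian_pair.intro gaussian_pair_axioms.intro prob_space_axioms sample_measurable)
  fix t s :: real
  define c where "c k = (t * cos (real k * x) - s * real k * sin (real k * x)) / sqrt (real n)" for k
  define d where "d k = (t * sin (real k * x) + s * real k * cos (real k * x)) / sqrt (real n)" for k
  let ?r = "\<lambda>k l. \<integral>u. cos ((real k - real l) * u) * \<psi> u \<partial>circle"
  have "t * sample n x \<omega> + s * sample_deriv n x \<omega> = (\<Sum>k=1..n. c k * a k \<omega>) + (\<Sum>k=1..n. d k * b k \<omega>)" for \<omega>
  proof -
    have "t * sample n x \<omega> + s * sample_deriv n x \<omega> = (\<Sum>k=1..n. t * (1 / sqrt (real n)) * (a k \<omega> * cos (real k * x) + b k \<omega> * sin (real k * x))
        + s * (1 / sqrt (real n)) * (real k * (b k \<omega> * cos (real k * x) - a k \<omega> * sin (real k * x))))"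
      unfolding sample_def sample_deriv_def trig_poly_def trig_poly_deriv_def
      by (simp only: sum_distrib_left mult.assoc sum.distrib[symmetric])
    also have "\<dots> = (\<Sum>k=1..n. c k * a k \<omega> + d k * b k \<omega>)"
      by (intro sum.cong refl) (simp add: c_def d_def algebra_simps add_divide_distrib diff_divide_distrib)
    finally show ?thesis by (simp add: sum.distrib)
  qed
  then have "expectation (\<lambda>\<omega>. cos (t * sample n x \<omega> + s * sample_deriv n x \<omega>)) = expectation (\<lambda>\<omega>. cos ((\<Sum>k=1..n. c k * a k \<omega>) + (\<Sum>k=1..n. d k * b k \<omega>)))" by simp
  also have "\<dots> = exp (- ((\<Sum>k=1..n. \<Sum>l=1..n. c k * c l * ?r k l) + (\<Sum>k=1..n. \<Sum>l=1..n. d k * d l * ?r k l)) / 2)"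
    by (intro expectation_cos_indep_sum indep_linear_combinations
        linear_combination gauss centered corr_a corr_b)
  also have "(\<Sum>k=1..n. \<Sum>l=1..n. c k * c l * ?r k l) + (\<Sum>k=1..n. \<Sum>l=1..n. d k * d l * ?r k l)
      = (\<Sum>k=1..n. \<Sum>l=1..n. ((t\<^sup>2 + s\<^sup>2 * (real k * real l)) * cos ((real k - real l) * x) - t * s * (real k - real l) * sin ((real k - real l) * x)) * ?r k l / real n)"
    unfolding sum.distrib[symmetric]
  proof (intro sum.cong refl)
    fix k l
    have sq: "sqrt (real n) * sqrt (real n) = real n" by simp
    have "c k * c l + d k * d l = ((t\<^sup>2 + s\<^sup>2 * (real k * real l)) * cos ((real k - real l) * x) - t * s * (real k - real l) * sin ((real k - real l) * x)) / real n"
      unfolding c_def d_def times_divide_times_eq sq add_divide_distrib[symmetric] left_diff_distrib[of "real k" "real l" x] cos_diff sin_diff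
      by (rule arg_cong[of _ _ "\<lambda>y. y / real n"]) (simp add: power2_eq_square algebra_simps)
    then show "c k * c l * ?r k l + d k * d l * ?r k l = ((t\<^sup>2 + s\<^sup>2 * (real k * real l)) * cos ((real k - real l) * x) - t * s * (real k - real l) * sin ((real k - real l) * x)) * ?r k l / real n"
      by (simp only: distrib_right[symmetric]) simp
  qed
  also have "\<dots> = (mass n x * t\<^sup>2 + 2 * cross n x * t * s + (mass' n x + (mid n)\<^sup>2 * mass n x) * s\<^sup>2) / real n"
    unfolding sum_divide_distrib[symmetric] covariance_sum ..
  also have "\<dots> = mass n x / real n * t\<^sup>2 + 2 * (cross n x / real n) * t * s + (mass' n x + (mid n)\<^sup>2 * mass n x) / real n * s\<^sup>2"
    unfolding add_divide_distrib[of "_ + _" "_ * s\<^sup>2"] add_divide_distrib[of "mass n x * t\<^sup>2"] by simp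
  finally show "expectation (\<lambda>\<omega>. cos (t * sample n x \<omega> + s * sample_deriv n x \<omega>))
     = exp (- (mass n x / real n * t\<^sup>2 + 2 * (cross n x / real n) * t * s + (mass' n x + (mid n)\<^sup>2 * mass n x) / real n * s\<^sup>2) / 2)" .
qed

end

section \<open>The expected number of zeros\<close>

context circle_density
begin

lemma mass_measurable [measurable]:
  "mass n \<in> borel_measurable borel" "mass' n \<in> borel_measurable borel" "cross n \<in> borel_measurable borel"
proof -
  have s: "(\<lambda>z. g (snd z)) \<in> borel_measurable (borel \<Otimes>\<^sub>M circle)" if "g \<in> borel_measurable borel" for g :: "real \<Rightarrow> real"
    by (rule measurable_compose[OF measurable_snd measurable_circle[OF that]])
  have d: "(\<lambda>z. \<psi> (fst z - snd z)) \<in> borel_measurable (borel \<Otimes>\<^sub>M circle)"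
    by (rule measurable_compose[OF _ \<psi>_measurable], rule borel_measurable_diff)
      (rule measurable_fst, rule s, simp)
  have I: "(\<lambda>x. \<integral>t. g t * \<psi> (x - t) \<partial>circle) \<in> borel_measurable borel" if "g \<in> borel_measurable borel" for g :: "real \<Rightarrow> real"
    by (rule circle.borel_measurable_lebesgue_integral)
      (use borel_measurable_times[OF s[OF that] d] in \<open>simp add: case_prod_unfold\<close>)
  show "mass n \<in> borel_measurable borel" unfolding mass_def[abs_def] by (rule I) measurable
  show "mass' n \<in> borel_measurable borel" unfolding mass'_def[abs_def] by (rule I) measurable
  show "cross n \<in> borel_measurable borel" unfolding cross_def[abs_def] by (rule I) measurable
qed

lemma intensity_measurable [measurable]: "intensity n \<in> borel_measurable borel"
  unfolding intensity_def[abs_def] by measurable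

lemma limit_intensity_measurable [measurable]: "limit_intensity \<in> borel_measurable borel"
  unfolding limit_intensity_def[abs_def] by measurable

lemma mass'_le: "mass' n x \<le> (real n * real n)\<^sup>2"
proof -
  have "mass' n x \<le> (\<integral>t. (real n * real n)\<^sup>2 * \<psi> (x - t) \<partial>circle)"
    unfolding mass'_def
  proof (rule integral_mono)
    show "integrable circle (\<lambda>t. (dirichlet' n t)\<^sup>2 * \<psi> (x - t))" by (intro integrable_mult_\<psi> continuous_intros)
    show "integrable circle (\<lambda>t. (real n * real n)\<^sup>2 * \<psi> (x - t))" by (intro integrable_mult_right \<psi>_shift)
    show "(dirichlet' n t)\<^sup>2 * \<psi> (x - t) \<le> (real n * real n)\<^sup>2 * \<psi> (x - t)" for t
      using abs_dirichlet'_le[of n t] by (intro mult_right_mono \<psi>_nonneg) (simp add: abs_le_square_iff[symmetric])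
  qed
  then show ?thesis by (simp add: \<psi>_shift)
qed

end

context random_trig_poly
begin

lemma sample_trig_sum: "sample n x \<omega> = trig_sum (\<lambda>k. a k \<omega> / sqrt (real n)) (\<lambda>k. b k \<omega> / sqrt (real n)) n x"
  by (simp add: sample_def trig_poly_def trig_sum_def sum_divide_distrib add_divide_distrib)

lemma sample_deriv_trig_sum: "sample_deriv n x \<omega> = trig_sum (\<lambda>k. real k * b k \<omega> / sqrt (real n)) (\<lambda>k. - (real k * a k \<omega> / sqrt (real n))) n x"
  by (simp add: sample_deriv_def trig_poly_deriv_def trig_sum_def sum_divide_distrib right_diff_distrib diff_divide_distrib mult_ac)

lemma sample_has_derivative: "((\<lambda>x. sample n x \<omega>) has_real_derivative sample_deriv n x \<omega>) (at x)"
  unfolding sample_def sample_deriv_def trig_poly_def trig_poly_deriv_def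
  by (rule derivative_eq_intros refl | simp)+ (simp add: algebra_simps)

lemma sample_deriv_continuous: "continuous_on UNIV (\<lambda>x. sample_deriv n x \<omega>)"
  unfolding sample_deriv_def trig_poly_deriv_def by (intro continuous_intros)

lemma sample_nonzero_coeff:
  assumes "sample n x \<omega> \<noteq> 0"
  obtains k where "k \<in> {1..n}" "a k \<omega> \<noteq> 0 \<or> b k \<omega> \<noteq> 0"
proof -
  have "\<exists>k\<in>{1..n}. a k \<omega> \<noteq> 0 \<or> b k \<omega> \<noteq> 0"
    using assms by (rule contrapos_np) (simp add: sample_def trig_poly_def)
  then show thesis using that by blast
qed

lemma sample_zeros_card:
  assumes "sample n x \<omega> \<noteq> 0" "{p..q} \<subseteq> {0..2 * pi}"
  shows "finite {x \<in> {p..q}. sample n x \<omega> = 0}" "card {x \<in> {p..q}. sample n x \<omega> = 0} \<le> 2 * n + 1"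
    and "finite {x \<in> {p..q}. sample_deriv n x \<omega> = 0}" "card {x \<in> {p..q}. sample_deriv n x \<omega> = 0} \<le> 2 * n + 1"
proof -
  obtain k where k: "k \<in> {1..n}" "a k \<omega> \<noteq> 0 \<or> b k \<omega> \<noteq> 0" by (rule sample_nonzero_coeff[OF assms(1)])
  have 1: "a k \<omega> / sqrt (real n) \<noteq> 0 \<or> b k \<omega> / sqrt (real n) \<noteq> 0"
    and 2: "real k * b k \<omega> / sqrt (real n) \<noteq> 0 \<or> - (real k * a k \<omega> / sqrt (real n)) \<noteq> 0"
    using k by auto
  have c1: "finite {x \<in> {0..2 * pi}. sample n x \<omega> = 0} \<and> card {x \<in> {0..2 * pi}. sample n x \<omega> = 0} \<le> 2 * n + 1"
    unfolding sample_trig_sum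
    using card_zeros_trig_sum_le[of k n "\<lambda>k. a k \<omega> / sqrt (real n)" "\<lambda>k. b k \<omega> / sqrt (real n)", OF k(1) 1] by simp
  have c2: "finite {x \<in> {0..2 * pi}. sample_deriv n x \<omega> = 0} \<and> card {x \<in> {0..2 * pi}. sample_deriv n x \<omega> = 0} \<le> 2 * n + 1"
    unfolding sample_deriv_trig_sum
    using card_zeros_trig_sum_le[of k n "\<lambda>k. real k * b k \<omega> / sqrt (real n)" "\<lambda>k. - (real k * a k \<omega> / sqrt (real n))", OF k(1) 2] by simp
  have s: "{x \<in> {p..q}. sample n x \<omega> = 0} \<subseteq> {x \<in> {0..2 * pi}. sample n x \<omega> = 0}" "{x \<in> {p..q}. sample_deriv n x \<omega> = 0} \<subseteq> {x \<in> {0..2 * pi}. sample_deriv n x \<omega> = 0}"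
    using assms(2) by blast+
  show "finite {x \<in> {p..q}. sample n x \<omega> = 0}" "card {x \<in> {p..q}. sample n x \<omega> = 0} \<le> 2 * n + 1"
    "finite {x \<in> {p..q}. sample_deriv n x \<omega> = 0}" "card {x \<in> {p..q}. sample_deriv n x \<omega> = 0} \<le> 2 * n + 1"
    using s c1 c2 finite_subset[OF s(1)] finite_subset[OF s(2)] card_mono[OF _ s(1)] card_mono[OF _ s(2)] by auto
qed

text \<open>The density \<open>sqrt (A C - B\<^sup>2) / (\<pi> A)\<close> with \<open>A\<close> replaced by \<open>A + \<epsilon>\<^sup>2\<close>, as smoothing at scale \<open>\<epsilon>\<close>
  does.\<close>
definition regularized_intensity where
  "regularized_intensity n \<epsilon> x = sqrt (((mass' n x + (mid n)\<^sup>2 * mass n x) / real n - (cross n x / real n)\<^sup>2 / (mass n x / real n + \<epsilon>\<^sup>2)) / (mass n x / real n + \<epsilon>\<^sup>2)) / pi"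

lemma regularized_intensity_measurable [measurable]: "regularized_intensity n \<epsilon> \<in> borel_measurable borel"
  unfolding regularized_intensity_def[abs_def] by measurable

lemma expectation_kac_integral:
  assumes n: "n \<ge> 1" and \<epsilon>: "\<epsilon> > 0"
  shows "(\<integral>\<^sup>+\<omega>. kac_integral (\<lambda>x. sample n x \<omega>) (\<lambda>x. sample_deriv n x \<omega>) p q \<epsilon> \<partial>M)
     = (\<integral>\<^sup>+x. ennreal (regularized_intensity n \<epsilon> x) * indicator {p..q} x \<partial>lborel)"
proof -
  interpret P: pair_sigma_finite lborel M ..
  note [measurable] = sample_measurable_pair sample_measurable
  have sw: "(\<lambda>(x, \<omega>). sample n x \<omega>) \<in> borel_measurable (lborel \<Otimes>\<^sub>M M)" "(\<lambda>(x, \<omega>). sample_deriv n x \<omega>) \<in> borel_measurable (lborel \<Otimes>\<^sub>M M)"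
    using measurable_compose[OF measurable_pair_swap' sample_measurable_pair(1)] measurable_compose[OF measurable_pair_swap' sample_measurable_pair(2)]
    by (auto simp: case_prod_beta)
  note [measurable] = sw
  have "(\<integral>\<^sup>+\<omega>. kac_integral (\<lambda>x. sample n x \<omega>) (\<lambda>x. sample_deriv n x \<omega>) p q \<epsilon> \<partial>M)
      = (\<integral>\<^sup>+x. (\<integral>\<^sup>+\<omega>. ennreal (normal_density 0 \<epsilon> (sample n x \<omega>) * \<bar>sample_deriv n x \<omega>\<bar>) * indicator {p..q} x \<partial>M) \<partial>lborel)"
    unfolding kac_integral_def by (rule P.Fubini') measurable
  also have "\<dots> = (\<integral>\<^sup>+x. ennreal (regularized_intensity n \<epsilon> x) * indicator {p..q} x \<partial>lborel)"
  proof (intro nn_integral_cong)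
    fix x
    have "(\<integral>\<^sup>+\<omega>. ennreal (normal_density 0 \<epsilon> (sample n x \<omega>) * \<bar>sample_deriv n x \<omega>\<bar>) * indicator {p..q} x \<partial>M)
       = (\<integral>\<^sup>+\<omega>. ennreal (normal_density 0 \<epsilon> (sample n x \<omega>) * \<bar>sample_deriv n x \<omega>\<bar>) \<partial>M) * indicator {p..q} x"
      by (rule nn_integral_multc) measurable
    then show "(\<integral>\<^sup>+\<omega>. ennreal (normal_density 0 \<epsilon> (sample n x \<omega>) * \<bar>sample_deriv n x \<omega>\<bar>) * indicator {p..q} x \<partial>M)
       = ennreal (regularized_intensity n \<epsilon> x) * indicator {p..q} x"
      unfolding gaussian_pair.expectation_normal_density_abs[OF gaussian_pair_sample[OF n] \<epsilon>] regularized_intensity_def by simp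
  qed
  finally show ?thesis .
qed

lemma regularized_intensity_limit:
  assumes n: "n \<ge> 1" and A: "mass n x > 0" and e: "e \<longlonglongrightarrow> 0"
  shows "(\<lambda>j. regularized_intensity n (e j) x) \<longlonglongrightarrow> intensity n x"
proof -
  have eq: "intensity n x = sqrt (((mass' n x + (mid n)\<^sup>2 * mass n x) / real n - (cross n x / real n)\<^sup>2 / (mass n x / real n + 0\<^sup>2)) / (mass n x / real n + 0\<^sup>2)) / pi"
  proof -
    have "((d + m * r) / N - (c / N)\<^sup>2 / (r / N + 0\<^sup>2)) / (r / N + 0\<^sup>2) = m + d / r - (c / r)\<^sup>2"
      if "N > 0" "r > 0" for d m r N c :: real
      using that by (simp add: field_simps power2_eq_square)
    then show ?thesis using n A unfolding intensity_def by simp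
  qed
  show ?thesis
    unfolding eq regularized_intensity_def using n A
    by (intro tendsto_intros e) auto
qed

lemma regularized_intensity_le:
  assumes n: "n \<ge> 1" and A: "mass n x \<ge> 1 / 3"
  shows "regularized_intensity n \<epsilon> x \<le> sqrt (3 * (real n * real n)\<^sup>2 + (mid n)\<^sup>2) / pi"
proof -
  define A' where "A' = mass n x / real n + \<epsilon>\<^sup>2"
  have n0: "real n > 0" using n by simp
  have A0: "mass n x > 0" using A by linarith
  have A': "mass n x / real n \<le> A'" "A' > 0" using A0 n0 by (auto simp: A'_def intro: add_pos_nonneg)
  have "((mass' n x + (mid n)\<^sup>2 * mass n x) / real n - (cross n x / real n)\<^sup>2 / A') / A' \<le> ((mass' n x + (mid n)\<^sup>2 * mass n x) / real n) / A'"
    using A' by (intro divide_right_mono) auto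
  also have "\<dots> \<le> ((mass' n x + (mid n)\<^sup>2 * mass n x) / real n) / (mass n x / real n)"
    using A' A0 n0 mass'_nonneg[of n x] by (intro divide_left_mono) auto
  also have "\<dots> = mass' n x / mass n x + (mid n)\<^sup>2"
  proof -
    have "(d + m * r) / N / (r / N) = d / r + m" if "N > 0" "r > 0" for d m r N :: real
    proof -
      have "(d + m * r) / N / (r / N) = (d + m * r) / r" using that by simp
      then show ?thesis using that by (simp add: add_divide_distrib)
    qed
    then show ?thesis using A0 n0 by blast
  qed
  also have "mass' n x / mass n x \<le> mass' n x / (1 / 3)"
    using A A0 mass'_nonneg[of n x] by (intro divide_left_mono) auto
  also have "mass' n x / (1 / 3) \<le> 3 * (real n * real n)\<^sup>2" using mass'_le[of n x] by simp
  finally show ?thesis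
    unfolding regularized_intensity_def A'_def[symmetric] by (intro divide_right_mono real_sqrt_le_mono) auto
qed

lemma AE_sample_nonzero:
  assumes n: "n \<ge> 1" and A: "mass n x \<ge> 1 / 3"
  shows "AE \<omega> in M. sample n x \<omega> \<noteq> 0"
  by (rule gaussian_pair.AE_nonzero[OF gaussian_pair_sample[OF n]]) (use assms in simp)

text \<open>Both limits as \<open>\<epsilon>\<close> tends to \<open>0\<close> are taken by dominated convergence: on the probability space
  the Kac integrals are at most \<open>4 n + 3\<close>, since \<open>f\<^sub>n\<close> and \<open>f\<^sub>n'\<close> have at most \<open>2 n + 1\<close> zeros each, and on
  the line the smoothed densities are bounded uniformly in \<open>\<epsilon>\<close>. The variable \<open>N\<close> is a measurable
  version of the number of zeros.\<close>
lemma kac_rice: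
  assumes n: "n \<ge> 1" and A: "\<And>x. mass n x \<ge> 1 / 3" and pq: "0 \<le> p" "p < q" "q \<le> 2 * pi"
  shows "(\<integral>\<^sup>+\<omega>. num_zeros (\<lambda>x. sample n x \<omega>) {p..q} \<partial>M) = (\<integral>\<^sup>+x. ennreal (intensity n x) * indicator {p..q} x \<partial>lborel)"
proof -
  note [measurable] = sample_measurable_pair
  define e where "e j = inverse (real (Suc j))" for j
  have e: "\<And>j. e j > 0" "e \<longlonglongrightarrow> 0"
    unfolding e_def using LIMSEQ_inverse_real_of_nat by auto
  define K where "K j \<omega> = kac_integral (\<lambda>x. sample n x \<omega>) (\<lambda>x. sample_deriv n x \<omega>) p q (e j)" for j \<omega>
  have K_meas [measurable]: "K j \<in> borel_measurable M" for j
    unfolding K_def kac_integral_def by measurable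
  have AE: "AE \<omega> in M. sample n p \<omega> \<noteq> 0 \<and> sample n q \<omega> \<noteq> 0"
    using AE_sample_nonzero[OF n A, of p] AE_sample_nonzero[OF n A, of q] by eventually_elim simp
  have kac: "(\<lambda>j. K j \<omega>) \<longlonglongrightarrow> num_zeros (\<lambda>x. sample n x \<omega>) {p..q} \<and> (\<forall>j. K j \<omega> \<le> of_nat (4 * n + 3))"
    if nz: "sample n p \<omega> \<noteq> 0" "sample n q \<omega> \<noteq> 0" for \<omega>
  proof -
    have sub: "{p..q} \<subseteq> {0..2 * pi}" using pq by auto
    have U: "{x \<in> {p..q}. sample n x \<omega> = 0 \<or> sample_deriv n x \<omega> = 0} = {x \<in> {p..q}. sample n x \<omega> = 0} \<union> {x \<in> {p..q}. sample_deriv n x \<omega> = 0}" by blast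
    note Z = sample_zeros_card[OF nz(1) sub]
    have fin: "finite {x \<in> {p..q}. sample n x \<omega> = 0 \<or> sample_deriv n x \<omega> = 0}" unfolding U using Z by simp
    have "card {x \<in> {p..q}. sample n x \<omega> = 0 \<or> sample_deriv n x \<omega> = 0} \<le> card {x \<in> {p..q}. sample n x \<omega> = 0} + card {x \<in> {p..q}. sample_deriv n x \<omega> = 0}"
      unfolding U by (rule card_Un_le)
    then have c: "card {x \<in> {p..q}. sample n x \<omega> = 0 \<or> sample_deriv n x \<omega> = 0} + 1 \<le> 4 * n + 3" using Z by linarith
    note k = kac_counting[of "\<lambda>x. sample n x \<omega>" "\<lambda>x. sample_deriv n x \<omega>", OF sample_has_derivative sample_deriv_continuous pq(2) fin nz e]
    show ?thesis
      unfolding K_def using k(1) order_trans[OF k(2) of_nat_mono[OF c]] by blast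
  qed
  define N where "N \<omega> = liminf (\<lambda>j. K j \<omega>)" for \<omega>
  have [measurable]: "N \<in> borel_measurable M" unfolding N_def by measurable
  have N: "AE \<omega> in M. num_zeros (\<lambda>x. sample n x \<omega>) {p..q} = N \<omega>"
    using AE by eventually_elim (use kac in \<open>auto simp: N_def intro!: lim_imp_Liminf[symmetric]\<close>)
  have "(\<lambda>j. \<integral>\<^sup>+\<omega>. K j \<omega> \<partial>M) \<longlonglongrightarrow> (\<integral>\<^sup>+\<omega>. N \<omega> \<partial>M)"
  proof (rule nn_integral_dominated_convergence[where w="\<lambda>_. of_nat (4 * n + 3)"])
    show "AE \<omega> in M. K j \<omega> \<le> of_nat (4 * n + 3)" for j
      using AE by eventually_elim (use kac in blast)
    show "(\<integral>\<^sup>+\<omega>. of_nat (4 * n + 3) \<partial>M) < \<infinity>"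
      by (simp add: emeasure_space_1 of_nat_less_top del: of_nat_add of_nat_mult)
    show "AE \<omega> in M. (\<lambda>j. K j \<omega>) \<longlonglongrightarrow> N \<omega>"
      using AE N
    proof eventually_elim
      case (elim \<omega>)
      then show ?case using kac[of \<omega>] unfolding elim(2)[symmetric] by blast
    qed
  qed measurable
  moreover have "(\<lambda>j. \<integral>\<^sup>+\<omega>. K j \<omega> \<partial>M) \<longlonglongrightarrow> (\<integral>\<^sup>+x. ennreal (intensity n x) * indicator {p..q} x \<partial>lborel)"
    unfolding K_def expectation_kac_integral[OF n e(1)]
  proof (rule tendsto_nn_integral_interval[where V=UNIV])
    show "(\<lambda>j. ennreal (regularized_intensity n (e j) x)) \<longlonglongrightarrow> ennreal (intensity n x)" for x
      using A[of x] by (intro tendsto_ennrealI regularized_intensity_limit n e) linarith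
    show "\<forall>\<^sub>F j in sequentially. \<forall>y\<in>{p..q}. ennreal (regularized_intensity n (e j) y) \<le> ennreal (sqrt (3 * (real n * real n)\<^sup>2 + (mid n)\<^sup>2) / pi)"
      using regularized_intensity_le[OF n A] by (intro always_eventually allI ballI ennreal_leI)
  qed auto
  ultimately have "(\<integral>\<^sup>+\<omega>. N \<omega> \<partial>M) = (\<integral>\<^sup>+x. ennreal (intensity n x) * indicator {p..q} x \<partial>lborel)"
    by (rule LIMSEQ_unique)
  then show ?thesis using nn_integral_cong_AE[OF N] by simp
qed

definition coeff_sum where
  "coeff_sum n \<omega> = (\<Sum>k=1..n. \<bar>a k \<omega> / sqrt (real n)\<bar> + \<bar>b k \<omega> / sqrt (real n)\<bar>)"

lemma expectation_coeff_sum: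
  assumes n: "n \<ge> 1"
  shows "integrable M (coeff_sum n)" "expectation (coeff_sum n) \<le> 2 * sqrt (real n)"
proof -
  have one: "integrable M (\<lambda>\<omega>. \<bar>X k \<omega> / sqrt (real n)\<bar>)" "expectation (\<lambda>\<omega>. \<bar>X k \<omega> / sqrt (real n)\<bar>) \<le> 1 / sqrt (real n)"
    if c: "centered_sequence M X" and k: "k \<ge> 1"
      and sq: "integrable M (\<lambda>\<omega>. X k \<omega> * X k \<omega>) \<and> expectation (\<lambda>\<omega>. X k \<omega> * X k \<omega>) = (\<integral>u. cos ((real k - real k) * u) * \<psi> u \<partial>circle)"
    for X :: "nat \<Rightarrow> 'a \<Rightarrow> real" and k
  proof -
    have i: "integrable M (X k)" using c k by (simp add: centered_sequence_def)
    then show "integrable M (\<lambda>\<omega>. \<bar>X k \<omega> / sqrt (real n)\<bar>)" by auto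
    have "expectation (\<lambda>\<omega>. \<bar>X k \<omega>\<bar>) \<le> expectation (\<lambda>\<omega>. (1 + X k \<omega> * X k \<omega>) / 2)"
    proof (rule integral_mono)
      show "integrable M (\<lambda>\<omega>. (1 + X k \<omega> * X k \<omega>) / 2)" using sq by simp
      fix \<omega>
      have "2 * 1 * \<bar>X k \<omega>\<bar> \<le> 1\<^sup>2 + \<bar>X k \<omega>\<bar>\<^sup>2" by (rule sum_squares_bound)
      then show "\<bar>X k \<omega>\<bar> \<le> (1 + X k \<omega> * X k \<omega>) / 2" by (simp add: power2_eq_square)
    qed (use i in auto)
    also have "\<dots> = 1" using sq \<psi>_integral by (simp add: prob_space)
    finally show "expectation (\<lambda>\<omega>. \<bar>X k \<omega> / sqrt (real n)\<bar>) \<le> 1 / sqrt (real n)"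
      by (simp add: abs_divide divide_right_mono)
  qed
  have a: "integrable M (\<lambda>\<omega>. \<bar>a k \<omega> / sqrt (real n)\<bar>)" "expectation (\<lambda>\<omega>. \<bar>a k \<omega> / sqrt (real n)\<bar>) \<le> 1 / sqrt (real n)"
    and b: "integrable M (\<lambda>\<omega>. \<bar>b k \<omega> / sqrt (real n)\<bar>)" "expectation (\<lambda>\<omega>. \<bar>b k \<omega> / sqrt (real n)\<bar>) \<le> 1 / sqrt (real n)"
    if "k \<in> {1..n}" for k
    using one[OF centered(1), of k] one[OF centered(2), of k] corr_a[of k k] corr_b[of k k] that by auto
  show "integrable M (coeff_sum n)" unfolding coeff_sum_def
    by (intro Bochner_Integration.integrable_sum Bochner_Integration.integrable_add a b)
  have "expectation (coeff_sum n) = (\<Sum>k=1..n. expectation (\<lambda>\<omega>. \<bar>a k \<omega> / sqrt (real n)\<bar> + \<bar>b k \<omega> / sqrt (real n)\<bar>))"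
    unfolding coeff_sum_def by (intro Bochner_Integration.integral_sum Bochner_Integration.integrable_add a b)
  also have "\<dots> \<le> (\<Sum>k=1..n. 2 / sqrt (real n))"
  proof (rule sum_mono)
    fix k assume k: "k \<in> {1..n}"
    show "expectation (\<lambda>\<omega>. \<bar>a k \<omega> / sqrt (real n)\<bar> + \<bar>b k \<omega> / sqrt (real n)\<bar>) \<le> 2 / sqrt (real n)"
      using a[OF k] b[OF k] by (subst Bochner_Integration.integral_add) auto
  qed
  also have "\<dots> = 2 * (real n / sqrt (real n))" by simp
  also have "\<dots> = 2 * sqrt (real n)" by (simp only: real_div_sqrt of_nat_0_le_iff)
  finally show "expectation (coeff_sum n) \<le> 2 * sqrt (real n)" .
qed

text \<open>The part of the bound on the mean number of zeros that does not depend on the length of the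
  interval, divided by \<open>n\<close>.\<close>
definition interval_error where
  "interval_error n = ((2 * sqrt (real n) + 2 * ln (real n)) / ln 2 + (2 * real n + 1) * (2 * (1 / (real n)\<^sup>2) / sqrt (1 / 3 / real n))) / real n"

lemma interval_error_tendsto: "interval_error \<longlonglongrightarrow> 0"
  unfolding interval_error_def[abs_def] by real_asymp

text \<open>Apart from the event \<open>B\<close> that \<open>\<bar>f\<^sub>n(p)\<bar>\<close> is at most \<open>1 / n\<^sup>2\<close>, the logarithm of the Jensen bound
  gives at most \<open>(S + 6 n (q - p) + 2 ln n) / ln 2\<close> zeros, where \<open>S\<close> is the sum of the absolute values
  of the coefficients and has mean at most \<open>2 sqrt n\<close>. On \<open>B\<close> there are at most \<open>2 n + 1\<close> zeros, and
  the probability of \<open>B\<close> is \<open>O(n powr (-3/2))\<close>.\<close>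
lemma intensity_interval_bound:
  assumes n: "n \<ge> 1" and A: "\<And>x. mass n x \<ge> 1 / 3" and pq: "0 \<le> p" "p < q" "q \<le> 2 * pi" "q - p < 2 * pi"
  shows "(\<integral>\<^sup>+x. ennreal (intensity n x / real n) * indicator {p..q} x \<partial>lborel) \<le> ennreal (6 / ln 2 * (q - p) + interval_error n)"
proof -
  have n0: "real n > 0" using n by simp
  \<comment> \<open>Any power of \<open>1 / n\<close> makes \<open>ln (1 / \<eta>)\<close> negligible against \<open>n\<close>; the exponent \<open>2\<close> makes the
    probability of \<open>B\<close> times \<open>2 n + 1\<close> tend to \<open>0\<close> as well.\<close>
  define \<eta> where "\<eta> = 1 / (real n)\<^sup>2"
  have \<eta>: "\<eta> > 0" using n0 by (simp add: \<eta>_def)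
  note [measurable] = sample_measurable
  define B where "B = {\<omega> \<in> space M. \<bar>sample n p \<omega>\<bar> \<le> \<eta>}"
  have [measurable]: "B \<in> sets M" unfolding B_def by measurable
  define c where "c = 6 * real n * (q - p) + 2 * ln (real n)"
  have c: "c \<ge> 0" unfolding c_def using n pq by (intro add_nonneg_nonneg mult_nonneg_nonneg) auto
  have S0: "coeff_sum n \<omega> \<ge> 0" for \<omega> unfolding coeff_sum_def by (intro sum_nonneg) auto
  have [measurable]: "coeff_sum n \<in> borel_measurable M" using expectation_coeff_sum(1)[OF n] by auto
  have pt: "num_zeros (\<lambda>x. sample n x \<omega>) {p..q} \<le> ennreal ((coeff_sum n \<omega> + c) / ln 2) + ennreal (2 * real n + 1) * indicator B \<omega>"
    if nz: "sample n p \<omega> \<noteq> 0" and \<omega>: "\<omega> \<in> space M" for \<omega>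
  proof -
    have sub: "{p..q} \<subseteq> {0..2 * pi}" using pq by auto
    note Z = sample_zeros_card[OF nz sub]
    let ?N = "card {x \<in> {p..q}. sample n x \<omega> = 0}"
    have num: "num_zeros (\<lambda>x. sample n x \<omega>) {p..q} = ennreal (real ?N)"
      unfolding num_zeros_def using Z(1) by (simp add: emeasure_count_space_finite ennreal_of_nat_eq_real_of_nat)
    show ?thesis
    proof (cases "\<omega> \<in> B")
      case True
      have "real ?N \<le> 2 * real n + 1" using Z(2) by linarith
      then have "ennreal (real ?N) \<le> ennreal (2 * real n + 1)" by (rule ennreal_leI)
      also have "\<dots> \<le> ennreal ((coeff_sum n \<omega> + c) / ln 2) + ennreal (2 * real n + 1)" by simp
      finally show ?thesis using True num by simp
    next
      case False
      then have big: "\<eta> < \<bar>sample n p \<omega>\<bar>" using \<omega> by (simp add: B_def)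
      obtain k where k: "k \<in> {1..n}" "a k \<omega> \<noteq> 0 \<or> b k \<omega> \<noteq> 0" by (rule sample_nonzero_coeff[OF nz])
      have k': "a k \<omega> / sqrt (real n) \<noteq> 0 \<or> b k \<omega> / sqrt (real n) \<noteq> 0" using k by auto
      have J: "\<bar>sample n p \<omega>\<bar> * 2 ^ ?N \<le> coeff_sum n \<omega> * exp (6 * real n * (q - p))"
        using trig_sum_zeros_interval[of p q k n "\<lambda>k. a k \<omega> / sqrt (real n)" "\<lambda>k. b k \<omega> / sqrt (real n)"] pq k(1) k'
        unfolding sample_trig_sum coeff_sum_def by simp
      have "\<eta> * 2 ^ ?N \<le> \<bar>sample n p \<omega>\<bar> * 2 ^ ?N" using big by (intro mult_right_mono) auto
      with J have J2: "\<eta> * 2 ^ ?N \<le> coeff_sum n \<omega> * exp (6 * real n * (q - p))" by linarith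
      have lhs: "\<eta> * 2 ^ ?N > 0" using \<eta> by simp
      then have S: "coeff_sum n \<omega> > 0" using J2 S0[of \<omega>] by (cases "coeff_sum n \<omega> = 0") auto
      have "ln (\<eta> * 2 ^ ?N) \<le> ln (coeff_sum n \<omega> * exp (6 * real n * (q - p)))"
        using J2 lhs S by (intro iffD2[OF ln_le_cancel_iff]) auto
      then have "ln \<eta> + real ?N * ln 2 \<le> ln (coeff_sum n \<omega>) + 6 * real n * (q - p)"
        using \<eta> S by (simp add: ln_mult_pos ln_realpow)
      moreover have "ln \<eta> = - 2 * ln (real n)" unfolding \<eta>_def using n0 by (simp add: ln_div ln_realpow)
      moreover have "ln (coeff_sum n \<omega>) \<le> coeff_sum n \<omega>" using ln_le_minus_one[OF S] by linarith
      ultimately have "real ?N * ln 2 \<le> coeff_sum n \<omega> + c" unfolding c_def by linarith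
      then have "real ?N \<le> (coeff_sum n \<omega> + c) / ln 2" by (simp add: pos_le_divide_eq)
      then show ?thesis using False num by (simp add: ennreal_leI)
    qed
  qed
  have PB: "prob B \<le> 2 * \<eta> / sqrt (1 / 3 / real n)"
  proof -
    have "prob B \<le> 2 * \<eta> / sqrt (mass n p / real n)"
      unfolding B_def using A[of p] n0 \<eta> by (intro gaussian_pair.prob_abs_le[OF gaussian_pair_sample[OF n]]) auto
    also have "\<dots> \<le> 2 * \<eta> / sqrt (1 / 3 / real n)"
      using A[of p] n0 \<eta> by (intro divide_left_mono real_sqrt_le_mono divide_right_mono mult_pos_pos) auto
    finally show ?thesis .
  qed
  have "(\<integral>\<^sup>+x. ennreal (intensity n x) * indicator {p..q} x \<partial>lborel) = (\<integral>\<^sup>+\<omega>. num_zeros (\<lambda>x. sample n x \<omega>) {p..q} \<partial>M)"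
    by (rule kac_rice[symmetric]) fact+
  also have "\<dots> \<le> (\<integral>\<^sup>+\<omega>. ennreal ((coeff_sum n \<omega> + c) / ln 2) + ennreal (2 * real n + 1) * indicator B \<omega> \<partial>M)"
    by (intro nn_integral_mono_AE) (use AE_sample_nonzero[OF n A, of p] AE_space in eventually_elim, use pt in blast)
  also have "\<dots> = (\<integral>\<^sup>+\<omega>. ennreal ((coeff_sum n \<omega> + c) / ln 2) \<partial>M) + ennreal (2 * real n + 1) * emeasure M B"
    by (subst nn_integral_add) (auto simp: nn_integral_cmult_indicator)
  also have "(\<integral>\<^sup>+\<omega>. ennreal ((coeff_sum n \<omega> + c) / ln 2) \<partial>M) = ennreal ((expectation (coeff_sum n) + c) / ln 2)"
    using expectation_coeff_sum(1)[OF n] S0 c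
    by (subst nn_integral_eq_integral) (auto simp: prob_space)
  also have "ennreal (2 * real n + 1) * emeasure M B = ennreal ((2 * real n + 1) * prob B)"
    by (simp add: emeasure_eq_measure ennreal_mult)
  also have "ennreal ((expectation (coeff_sum n) + c) / ln 2) + ennreal ((2 * real n + 1) * prob B)
     = ennreal ((expectation (coeff_sum n) + c) / ln 2 + (2 * real n + 1) * prob B)"
    using c S0 by (intro ennreal_plus[symmetric]) (auto intro!: divide_nonneg_pos add_nonneg_nonneg integral_nonneg_AE)
  also have "\<dots> \<le> ennreal ((2 * sqrt (real n) + c) / ln 2 + (2 * real n + 1) * (2 * \<eta> / sqrt (1 / 3 / real n)))"
    using expectation_coeff_sum(2)[OF n] PB by (intro ennreal_leI add_mono divide_right_mono mult_left_mono) auto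
  finally have main: "(\<integral>\<^sup>+x. ennreal (intensity n x) * indicator {p..q} x \<partial>lborel)
     \<le> ennreal ((2 * sqrt (real n) + c) / ln 2 + (2 * real n + 1) * (2 * \<eta> / sqrt (1 / 3 / real n)))" .
  have "(\<integral>\<^sup>+x. ennreal (intensity n x / real n) * indicator {p..q} x \<partial>lborel)
     = (\<integral>\<^sup>+x. ennreal (1 / real n) * (ennreal (intensity n x) * indicator {p..q} x) \<partial>lborel)"
    using n0 by (intro nn_integral_cong) (simp add: ennreal_mult'[symmetric] mult.assoc[symmetric])
  also have "\<dots> = ennreal (1 / real n) * (\<integral>\<^sup>+x. ennreal (intensity n x) * indicator {p..q} x \<partial>lborel)"
    by (rule nn_integral_cmult) measurable
  also have "\<dots> \<le> ennreal (1 / real n) * ennreal ((2 * sqrt (real n) + c) / ln 2 + (2 * real n + 1) * (2 * \<eta> / sqrt (1 / 3 / real n)))"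
    by (intro mult_left_mono main) auto
  also have "\<dots> = ennreal (1 / real n * ((2 * sqrt (real n) + c) / ln 2 + (2 * real n + 1) * (2 * \<eta> / sqrt (1 / 3 / real n))))"
    by (rule ennreal_mult'[symmetric]) simp
  also have "1 / real n * ((2 * sqrt (real n) + c) / ln 2 + (2 * real n + 1) * (2 * \<eta> / sqrt (1 / 3 / real n)))
     = 6 / ln 2 * (q - p) + interval_error n"
  proof -
    have "1 / N * ((s + (6 * N * d + l)) / g + y) = 6 / g * d + ((s + l) / g + y) / N" if "N > 0" for N s d l g y :: real
      using that by (simp add: add_divide_distrib distrib_left mult.commute)
    from this[OF n0, of "2 * sqrt (real n)" "q - p" "2 * ln (real n)" "ln 2"]
    show ?thesis unfolding interval_error_def c_def \<eta>_def by simp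
  qed
  finally show ?thesis .
qed

lemma expected_zeros_limit:
  assumes U: "open U" "AE x in lborel. x \<in> U" and C1: "C1_hoelder_on U \<psi>"
  shows "(\<lambda>n. (\<integral>\<^sup>+\<omega>. num_zeros (\<lambda>x. sample n x \<omega>) {0..2 * pi} \<partial>M) / of_nat n)
     \<longlonglongrightarrow> (\<integral>\<^sup>+x. ennreal (limit_intensity x) * indicator {0..2 * pi} x \<partial>lborel)"
proof -
  have good: "\<forall>\<^sub>F n in sequentially. n \<ge> 1 \<and> (\<forall>x. 1 / 3 \<le> mass n x)"
    using mass_bounded_below eventually_ge_at_top[of 1] by eventually_elim auto
  have "(\<lambda>n. \<integral>\<^sup>+x. ennreal (intensity n x / real n) * indicator {0..2 * pi} x \<partial>lborel)
     \<longlonglongrightarrow> (\<integral>\<^sup>+x. ennreal (limit_intensity x) * indicator {0..2 * pi} x \<partial>lborel)"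
  proof (rule tendsto_nn_integral_by_intervals[OF _ _ U])
    show "(\<lambda>n. ennreal (intensity n x / real n)) \<longlonglongrightarrow> ennreal (limit_intensity x)" if "x \<in> U" for x
      by (intro tendsto_ennrealI intensity_limit[OF U(1) C1 that])
    show "\<exists>\<delta>>0. \<exists>H. \<forall>\<^sub>F n in sequentially. \<forall>y\<in>ball x \<delta>. ennreal (intensity n y / real n) \<le> ennreal H" if xU: "x \<in> U" for x
    proof -
      obtain \<delta> H where \<delta>: "\<delta> > 0" and ev: "\<forall>\<^sub>F n in sequentially. \<forall>x\<in>ball x \<delta>. intensity n x \<le> H * real n"
        using intensity_locally_bounded[OF U(1) C1 xU] by blast
      have "\<forall>\<^sub>F n in sequentially. \<forall>y\<in>ball x \<delta>. ennreal (intensity n y / real n) \<le> ennreal H"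
        using ev eventually_ge_at_top[of 1] by eventually_elim (auto intro!: ennreal_leI simp: divide_le_eq)
      then show ?thesis using \<delta> by blast
    qed
    show "\<forall>\<^sub>F n in sequentially. \<forall>p q. 0 \<le> p \<longrightarrow> p < q \<longrightarrow> q \<le> 2 * pi \<longrightarrow> q - p < 2 * pi \<longrightarrow>
       (\<integral>\<^sup>+x. ennreal (intensity n x / real n) * indicator {p..q} x \<partial>lborel) \<le> ennreal (6 / ln 2 * (q - p) + interval_error n)"
      using good by eventually_elim (use intensity_interval_bound in blast)
    have "(\<integral>\<^sup>+x. ennreal (limit_intensity x) * indicator {0..2 * pi} x \<partial>lborel) \<le> (\<integral>\<^sup>+x. ennreal 1 * indicator {0..2 * pi} x \<partial>lborel)"
    proof (intro nn_integral_mono mult_right_mono ennreal_leI)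
      fix x
      have "1 \<le> pi * sqrt 2" "1 \<le> pi * sqrt 3"
        using pi_gt3 mult_mono[of 1 pi 1 "sqrt 2"] mult_mono[of 1 pi 1 "sqrt 3"] by auto
      then show "limit_intensity x \<le> 1" by (auto simp: limit_intensity_def divide_le_eq_1)
    qed auto
    also have "\<dots> < \<infinity>" by (simp add: nn_integral_cmult_indicator)
    finally show "(\<integral>\<^sup>+x. ennreal (limit_intensity x) * indicator {0..2 * pi} x \<partial>lborel) < \<infinity>" .
  qed (use interval_error_tendsto in auto)
  moreover have "\<forall>\<^sub>F n in sequentially. (\<integral>\<^sup>+x. ennreal (intensity n x / real n) * indicator {0..2 * pi} x \<partial>lborel)
     = (\<integral>\<^sup>+\<omega>. num_zeros (\<lambda>x. sample n x \<omega>) {0..2 * pi} \<partial>M) / of_nat n"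
    using good
  proof eventually_elim
    case (elim n)
    then have n0: "real n > 0" by simp
    have "(\<integral>\<^sup>+x. ennreal (intensity n x / real n) * indicator {0..2 * pi} x \<partial>lborel)
      = (\<integral>\<^sup>+x. (ennreal (intensity n x) * indicator {0..2 * pi} x) / of_nat n \<partial>lborel)"
    proof (intro nn_integral_cong)
      fix x
      have "ennreal (intensity n x / real n) = ennreal (intensity n x) / of_nat n"
      proof (cases "0 \<le> intensity n x")
        case True
        then show ?thesis using n0 by (simp add: divide_ennreal ennreal_of_nat_eq_real_of_nat)
      next
        case False
        then show ?thesis using n0 by (simp add: ennreal_neg divide_nonpos_pos)
      qed
      then show "ennreal (intensity n x / real n) * indicator {0..2 * pi} x = ennreal (intensity n x) * indicator {0..2 * pi} x / of_nat n"
        by (simp add: indicator_def)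
    qed
    also have "\<dots> = (\<integral>\<^sup>+x. ennreal (intensity n x) * indicator {0..2 * pi} x \<partial>lborel) / of_nat n"
      by (rule nn_integral_divide) measurable
    also have "(\<integral>\<^sup>+x. ennreal (intensity n x) * indicator {0..2 * pi} x \<partial>lborel) = (\<integral>\<^sup>+\<omega>. num_zeros (\<lambda>x. sample n x \<omega>) {0..2 * pi} \<partial>M)"
      using elim by (intro kac_rice[symmetric]) auto
    finally show ?case .
  qed
  ultimately show ?thesis by (rule Lim_transform_eventually)
qed

end

context circle_density
begin

lemma integral_limit_intensity:
  defines "Z \<equiv> {x \<in> {- pi..pi}. \<psi> x = 0}"
  shows "(\<integral>\<^sup>+x. ennreal (limit_intensity x) * indicator {0..2 * pi} x \<partial>lborel)
     = ennreal (measure lebesgue Z / (pi * sqrt 2) + (2 * pi - measure lebesgue Z) / (pi * sqrt 3))"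
proof -
  have Z [measurable]: "Z \<in> sets borel" unfolding Z_def by measurable
  have Zsub: "Z \<subseteq> {- pi..pi}" by (auto simp: Z_def)
  have mZ: "measure lebesgue Z = measure lborel Z" by simp
  have fin: "emeasure lborel Z < \<infinity>" "emeasure lborel ({- pi..pi} - Z) < \<infinity>"
    using emeasure_mono[OF Zsub, of lborel] emeasure_mono[of "{- pi..pi} - Z" "{- pi..pi}" lborel]
    by (auto simp: less_top[symmetric] top_unique)
  have mC: "measure lborel ({- pi..pi} - Z) = 2 * pi - measure lborel Z"
    using fin Zsub by (subst measure_Diff) auto
  have "(\<integral>\<^sup>+x. ennreal (limit_intensity x) * indicator {0..2 * pi} x \<partial>lborel)
     = (\<integral>\<^sup>+x. ennreal (limit_intensity x) * indicator {- pi..- pi + 2 * pi} x \<partial>lborel)"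
    by (rule nn_integral_period_window[symmetric]) (auto simp: limit_intensity_def \<psi>_periodic)
  also have "\<dots> = (\<integral>\<^sup>+x. ennreal (1 / (pi * sqrt 2)) * indicator Z x + ennreal (1 / (pi * sqrt 3)) * indicator ({- pi..pi} - Z) x \<partial>lborel)"
    by (intro nn_integral_cong) (auto simp: Z_def limit_intensity_def indicator_def)
  also have "\<dots> = ennreal (1 / (pi * sqrt 2)) * emeasure lborel Z + ennreal (1 / (pi * sqrt 3)) * emeasure lborel ({- pi..pi} - Z)"
    by (subst nn_integral_add) (auto simp: nn_integral_cmult_indicator)
  also have "\<dots> = ennreal (1 / (pi * sqrt 2) * measure lborel Z + 1 / (pi * sqrt 3) * measure lborel ({- pi..pi} - Z))"
    using fin by (simp add: emeasure_eq_ennreal_measure less_top ennreal_mult'[symmetric] ennreal_plus[symmetric] del: ennreal_plus)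
  finally show ?thesis unfolding mC mZ by simp
qed

end

lemma circle_density_of_spectral:
  assumes \<mu>: "spectral_measure \<mu>" and d: "spectral_density \<mu> \<psi>"
  shows "circle_density \<psi>"
    and "correlation \<mu> k = (\<integral>u. exp (- (\<i> * of_int k * complex_of_real u)) * complex_of_real (\<psi> u) \<partial>circle)"
proof -
  have [measurable]: "\<psi> \<in> borel_measurable borel" and nn: "\<And>x. 0 \<le> \<psi> x" and per: "\<And>x. \<psi> (x + 2 * pi) = \<psi> x"
    and D: "\<mu> = density lborel (\<lambda>x. ennreal (indicator {- pi..pi} x * \<psi> x))"
    using d unfolding spectral_density_def by auto
  have "prob_space \<mu>" using \<mu> unfolding spectral_measure_def real_distribution_def by auto
  then have "emeasure \<mu> (space \<mu>) = 1" by (rule prob_space.emeasure_space_1)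
  then have "(\<integral>\<^sup>+x. ennreal (indicator {- pi..pi} x * \<psi> x) \<partial>lborel) = 1"
    unfolding D by (subst (asm) emeasure_density) auto
  moreover have "(\<integral>\<^sup>+x. ennreal (indicator {- pi..pi} x * \<psi> x) \<partial>lborel) = (\<integral>\<^sup>+x. ennreal (\<psi> x) \<partial>circle)"
    unfolding nn_integral_circle by (intro nn_integral_cong) (auto simp: indicator_def)
  ultimately have 1: "(\<integral>\<^sup>+x. ennreal (\<psi> x) \<partial>circle) = 1" by simp
  have int: "integrable circle \<psi>"
    using 1 nn by (intro integrableI_nonneg measurable_circle) auto
  have "ennreal (\<integral>x. \<psi> x \<partial>circle) = ennreal 1"
    using nn_integral_eq_integral[OF int] 1 nn by simp
  then have "(\<integral>x. \<psi> x \<partial>circle) = 1" using nn by (subst (asm) ennreal_inj) (auto intro!: integral_nonneg_AE)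
  then show "circle_density \<psi>" using nn per int by unfold_locales auto
  show "correlation \<mu> k = (\<integral>u. exp (- (\<i> * of_int k * complex_of_real u)) * complex_of_real (\<psi> u) \<partial>circle)"
  proof -
    have "correlation \<mu> k = (\<integral>x. (indicator {- pi..pi} x * \<psi> x) *\<^sub>R exp (- (\<i> * of_int k * complex_of_real x)) \<partial>lborel)"
      unfolding correlation_def D by (rule integral_density) (auto simp: nn)
    also have "\<dots> = (\<integral>u. exp (- (\<i> * of_int k * complex_of_real u)) * complex_of_real (\<psi> u) \<partial>circle)"
      unfolding circle_def by (subst integral_restrict_space)
        (auto intro!: Bochner_Integration.integral_cong simp: scaleR_conv_of_real mult_ac indicator_def)
    finally show ?thesis .
  qed
qed

text \<open>The correlations are real, so the sine coefficients of \<open>\<psi>\<close> vanish.\<close>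
lemma correlation_re_im:
  assumes c: "circle_density \<psi>"
    and eq: "complex_of_real r = (\<integral>u. exp (- (\<i> * of_int m * complex_of_real u)) * complex_of_real (\<psi> u) \<partial>circle)"
  shows "r = (\<integral>u. cos (of_int m * u) * \<psi> u \<partial>circle)" "(\<integral>u. sin (of_int m * u) * \<psi> u \<partial>circle) = 0"
proof -
  interpret circle_density \<psi> by fact
  define g where "g u = exp (- (\<i> * of_int m * complex_of_real u)) * complex_of_real (\<psi> u)" for u
  have g: "Re (g u) = cos (of_int m * u) * \<psi> u" "Im (g u) = - (sin (of_int m * u) * \<psi> u)" for u
    unfolding g_def by (simp_all add: Re_exp Im_exp)
  have gm: "g \<in> borel_measurable circle"
  proof -
    have "g \<in> borel_measurable lborel" unfolding g_def[abs_def] by measurable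
    then show ?thesis unfolding circle_def by (rule measurable_restrict_space1)
  qed
  have int: "integrable circle g"
    by (rule Bochner_Integration.integrable_bound[OF \<psi>_integrable gm]) (auto simp: g_def norm_mult)
  have "r = Re (\<integral>u. g u \<partial>circle)" "0 = Im (\<integral>u. g u \<partial>circle)"
    using eq unfolding g_def[symmetric] by (metis Re_complex_of_real, metis Im_complex_of_real)
  then show "r = (\<integral>u. cos (of_int m * u) * \<psi> u \<partial>circle)" "(\<integral>u. sin (of_int m * u) * \<psi> u \<partial>circle) = 0"
    using integral_Re[OF int] integral_Im[OF int] unfolding g by simp_all
qed

lemma random_trig_polyI:
  assumes "prob_space M"
    and "spectral_measure \<mu>"
    and "gaussian_sequence M a" "centered_sequence M a"
    and "gaussian_sequence M b" "centered_sequence M b"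
    and corr: "has_correlation M a (correlation \<mu>)" "has_correlation M b (correlation \<mu>)"
    and "prob_space.indep_var M path_space (sample_path a) path_space (sample_path b)"
    and "spectral_density \<mu> \<psi>"
  shows "random_trig_poly M \<psi> a b"
proof -
  have cd: "circle_density \<psi>" by (rule circle_density_of_spectral(1)) fact+
  have *: "integrable M (\<lambda>\<omega>. X k \<omega> * X l \<omega>) \<and> (LINT \<omega>|M. X k \<omega> * X l \<omega>) = (\<integral>u. cos ((real k - real l) * u) * \<psi> u \<partial>circle)
      \<and> (\<integral>u. sin ((real k - real l) * u) * \<psi> u \<partial>circle) = 0"
    if X: "has_correlation M X (correlation \<mu>)" and kl: "k \<ge> 1" "l \<ge> 1" for X k l
  proof -
    define m where "m = \<bar>int k - int l\<bar>"
    have i: "integrable M (\<lambda>\<omega>. X k \<omega> * X l \<omega>)" and e: "complex_of_real (LINT \<omega>|M. X k \<omega> * X l \<omega>) = correlation \<mu> m"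
      using X kl unfolding has_correlation_def m_def by auto
    note e' = e[unfolded circle_density_of_spectral(2)[OF assms(2) assms(10)]]
    note ri = correlation_re_im[OF cd e']
    consider "real k - real l = of_int m" | "real k - real l = - of_int m" unfolding m_def by linarith
    then show ?thesis
    proof cases
      case 1 then show ?thesis using i ri by simp
    next
      case 2 then show ?thesis using i ri by simp
    qed
  qed
  interpret prob_space M by fact
  interpret circle_density \<psi> by (rule cd)
  show ?thesis
    using assms *[OF corr(1)] *[OF corr(2)] by unfold_locales auto
qed

theorem theorem1p1:
  fixes M :: "'a measure" and a b :: "nat \<Rightarrow> 'a \<Rightarrow> real"
    and \<mu> :: "real measure" and \<psi> :: "real \<Rightarrow> real" and U :: "real set"
  assumes "prob_space M"
    and "spectral_measure \<mu>"
    and "gaussian_sequence M a" "centered_sequence M a" "stationary_sequence M a"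
    and "gaussian_sequence M b" "centered_sequence M b" "stationary_sequence M b"
    and "has_correlation M a (correlation \<mu>)" "has_correlation M b (correlation \<mu>)"
    and "prob_space.indep_var M path_space (sample_path a) path_space (sample_path b)"
    and "spectral_density \<mu> \<psi>"
    and "open_full_measure U" "C1_hoelder_on U \<psi>"
  shows "(\<lambda>n. (\<integral>\<^sup>+ \<omega>. num_zeros (trig_poly (\<lambda>k. a k \<omega>) (\<lambda>k. b k \<omega>) n) {0..2 * pi} \<partial>M)
                 / of_nat n)
           \<longlonglongrightarrow> ennreal
             (measure lebesgue {x \<in> {-pi..pi}. \<psi> x = 0} / (pi * sqrt 2) +
              (2 * pi - measure lebesgue {x \<in> {-pi..pi}. \<psi> x = 0}) / (pi * sqrt 3))"
proof -
  interpret random_trig_poly M \<psi> a b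
    by (rule random_trig_polyI) fact+
  have "open U" "AE x in lborel. x \<in> U"
    using \<open>open_full_measure U\<close> by (auto simp: open_full_measure_def)
  from expected_zeros_limit[OF this \<open>C1_hoelder_on U \<psi>\<close>]
  show ?thesis
    unfolding integral_limit_intensity sample_def .
qed

end
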